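(* Let $\mathcal{T}$ be a T-mesh, let $\mathbf{r}$ be a smoothness distribution on $\mathcal{T}$, and let $m,m'\in\mathbb{N}$. Then $$\dim \mathcal{S}_{m,m'}^{\mathbf{r}}(\mathcal{T}) = \sum_{\sigma\in\mathcal{T}_2}(m+1)(m'+1) - \sum_{\tau\in\mathcal{T}_1^{o,h}}(m+1)(\mathbf{r}(\tau)+1) - \sum_{\tau\in\mathcal{T}_1^{o,v}}(m'+1)(\mathbf{r}(\tau)+1) + \sum_{\gamma\in\mathcal{T}_0^o}(\mathbf{r}_h(\gamma)+1)(\mathbf{r}_v(\gamma)+1) + h_{m,m'}^{\mathbf{r}}(\mathcal{T}),$$ where $h_{m,m'}^{\mathbf{r}}(\mathcal{T})=\dim H_0(\mathfrak{I}_{m,m'}^{\mathbf{r}}(\mathcal{T}^o))$.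
   Context: T-mesh. A T-mesh $\mathcal{T}$ of $\mathbb{R}^2$ consists of a finite set $\mathcal{T}_2$ of closed axis-aligned rectangles (cells), a finite set $\mathcal{T}_1$ of closed axis-aligned segments (edges) contained in $\bigcup_{\sigma\in\mathcal{T}_2}\partial\sigma$, and the finite set $\mathcal{T}_0=\bigcup_{\tau\in\mathcal{T}_1}\partial\tau$ of end points of edges (vertices), such that: for $\sigma\in\mathcal{T}_2$, $\partial\sigma$ is a finite union of elements of $\mathcal{T}_1$; for $\sigma\ne\sigma'$ in $\mathcal{T}_2$, $\sigma\cap\sigma'=\partial\sigma\cap\partial\sigma'$ is a finite union of elements of $\mathcal{T}_1\cup\mathcal{T}_0$; for $\tau\neq\tau'$ in $\mathcal{T}_1$, $\tau\cap\tau'=\partial\tau\cap\partial\tau'\subset\mathcal{T}_0$. The domain is $\Omega=\bigcup_{\sigma\in\mathcal{T}_2}\sigma$, with interior $\Omega^\circ$. Edges parallel to the first axis are horizontal, those parallel to the second axis are vertical. Standing assumptions: every vertex belongs to at least one horizontal edge and at least one vertical edge; $\Omega$ is simply connected and $\Omega^\circ$ is connected. An edge is interior if it meets $\Omega^\circ$; $\mathcal{T}_1^o$, $\mathcal{T}_1^{o,h}$, $\mathcal{T}_1^{o,v}$ are the sets of interior, horizontal interior, vertical interior edges. A vertex is interior if it lies in $\Omega^\circ$; $\mathcal{T}_0^o$ is the set of interior vertices. Smoothness. Use coordinates $(s,t)$ on $\mathbb{R}^2$ and $0\in\mathbb N$. Let $\nu_h(\mathcal{T})$ be the set of first coordinates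 of points of vertical edges and $\nu_v(\mathcal{T})$ the set of second coordinates of points of horizontal edges. A smoothness distribution $\mathbf{r}$ is a pair of maps $\mathbf{r}_h:\nu_h(\mathcal{T})\to\mathbb{N}$, $\mathbf{r}_v:\nu_v(\mathcal{T})\to\mathbb{N}$. For a vertical edge $\tau$ on the line $s=a$, $\mathbf{r}(\tau)=\mathbf{r}_h(a)$; for a horizontal edge $\tau$ on the line $t=b$, $\mathbf{r}(\tau)=\mathbf{r}_v(b)$. For a vertex $\gamma=(a,b)$, $\mathbf{r}_h(\gamma)=\mathbf{r}_h(a)$ and $\mathbf{r}_v(\gamma)=\mathbf{r}_v(b)$. Splines. $R_{m,m'}$ is the space of polynomials in $\mathbb{R}[s,t]$ of degree $\le m$ in $s$ and $\le m'$ in $t$. $\mathcal{S}_{m,m'}^{\mathbf{r}}(\mathcal{T})$ is the vector space of functions on $\Omega$ that coincide with an element of $R_{m,m'}$ on each cell, and that are of class $C^{\mathbf{r}(\tau)}$ in $s$ (resp. in $t$) at every point of $\tau\cap\Omega^\circ$ for every vertical (resp. horizontal) interior edge $\tau$. The number $h$. For an edge $\tau$, let $l_\tau$ be a nonzero polynomial of degree 1 defining the line supporting $\tau$, $\Delta^{\mathbf{r}}(\tau)=l_\tau^{\mathbf{r}(\tau)+1}$, and $\mathfrak{I}^{\mathbf{r}}_{m,m'}(\tau)=(\Delta^{\mathbf{r}}(\tau))\cap R_{m,m'}$. For a vertex $\gamma$, $\mathfrak{I}^{\mathbf{r}}_{m,m'}(\gamma)=\mathfrak{I}^{\mathbf{r}}_{m,m'}(\tau_v)+\mathfrak{I}^{\mathbf{r}}_{m,m'}(\tau_h)$,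 where $\tau_v$, $\tau_h$ are any vertical and horizontal edges containing $\gamma$. With formal symbols $[\tau]$, $[\gamma]$ and a chosen orientation of each edge, let $$\partial_1:\bigoplus_{\tau\in\mathcal{T}_1^o}[\tau]\,\mathfrak{I}^{\mathbf{r}}_{m,m'}(\tau)\to\bigoplus_{\gamma\in\mathcal{T}_0^o}[\gamma]\,\mathfrak{I}^{\mathbf{r}}_{m,m'}(\gamma),\qquad [\tau]p\mapsto[\gamma_2]p-[\gamma_1]p$$ for $\tau$ oriented from $\gamma_1$ to $\gamma_2$, where $[\gamma]=0$ if $\gamma\notin\mathcal{T}_0^o$. Then $H_0(\mathfrak{I}_{m,m'}^{\mathbf{r}}(\mathcal{T}^o))$ is the cokernel of $\partial_1$.
   Formalization: The formal theorem also assumes r(τ) ≤ m on vertical and r(τ) ≤ m' on horizontal interior edges; without this the formula fails, e.g. two cells sharing a vertical edge, m = m' = 0, r = 1: the dimension is 1, the formula gives 0. *)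

theory Defs
  imports "HOL-Analysis.Analysis" "HOL-Algebra.AbelCoset" "Jordan_Normal_Form.VS_Connect"
begin

type_synonym point = "real \<times> real"

text \<open>Coordinates on the plane are \<open>(s, t)\<close>; cells and edges are represented by their point sets.\<close>

definition is_cell :: "point set \<Rightarrow> bool" where
  "is_cell \<sigma> \<longleftrightarrow> (\<exists>a b c d. a < b \<and> c < d \<and> \<sigma> = {a..b} \<times> {c..d})"

definition horizontal :: "point set \<Rightarrow> bool" where
  "horizontal \<tau> \<longleftrightarrow> (\<exists>a b c. a < b \<and> \<tau> = {a..b} \<times> {c})"

definition vertical :: "point set \<Rightarrow> bool" where
  "vertical \<tau> \<longleftrightarrow> (\<exists>a c d. c < d \<and> \<tau> = {a} \<times> {c..d})"

record tmesh =
  cells :: "point set set"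
  edges :: "point set set"

text \<open>For a cell, the boundary is the topological frontier in the plane; for an edge \<open>\<tau>\<close> it is
  the relative frontier, i.e. the set of its two end points.\<close>

definition vertices :: "tmesh \<Rightarrow> point set" where
  "vertices T = (\<Union>\<tau>\<in>edges T. rel_frontier \<tau>)"

definition T_mesh :: "tmesh \<Rightarrow> bool" where
  "T_mesh T \<longleftrightarrow>
     finite (cells T) \<and> (\<forall>\<sigma>\<in>cells T. is_cell \<sigma>) \<and>
     finite (edges T) \<and>
     (\<forall>\<tau>\<in>edges T. (horizontal \<tau> \<or> vertical \<tau>) \<and> \<tau> \<subseteq> (\<Union>\<sigma>\<in>cells T. frontier \<sigma>)) \<and>
     (\<forall>\<sigma>\<in>cells T. \<exists>E\<subseteq>edges T. frontier \<sigma> = \<Union>E) \<and>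
     (\<forall>\<sigma>\<in>cells T. \<forall>\<sigma>'\<in>cells T. \<sigma> \<noteq> \<sigma>' \<longrightarrow>
        \<sigma> \<inter> \<sigma>' = frontier \<sigma> \<inter> frontier \<sigma>' \<and>
        (\<exists>E\<subseteq>edges T \<union> (\<lambda>\<gamma>. {\<gamma>}) ` vertices T. \<sigma> \<inter> \<sigma>' = \<Union>E)) \<and>
     (\<forall>\<tau>\<in>edges T. \<forall>\<tau>'\<in>edges T. \<tau> \<noteq> \<tau>' \<longrightarrow>
        \<tau> \<inter> \<tau>' = rel_frontier \<tau> \<inter> rel_frontier \<tau>' \<and> \<tau> \<inter> \<tau>' \<subseteq> vertices T)"

definition mesh_domain :: "tmesh \<Rightarrow> point set" where
  "mesh_domain T = \<Union>(cells T)"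

definition interior_edges :: "tmesh \<Rightarrow> point set set" where
  "interior_edges T = {\<tau> \<in> edges T. \<tau> \<inter> interior (mesh_domain T) \<noteq> {}}"

definition interior_hedges :: "tmesh \<Rightarrow> point set set" where
  "interior_hedges T = {\<tau> \<in> interior_edges T. horizontal \<tau>}"

definition interior_vedges :: "tmesh \<Rightarrow> point set set" where
  "interior_vedges T = {\<tau> \<in> interior_edges T. vertical \<tau>}"

definition interior_vertices :: "tmesh \<Rightarrow> point set" where
  "interior_vertices T = vertices T \<inter> interior (mesh_domain T)"

text \<open>The line \<open>s = a\<close> (resp. \<open>t = b\<close>) supporting a vertical (resp. horizontal) edge.\<close>

definition s_coord :: "point set \<Rightarrow> real" where
  "s_coord \<tau> = the_elem (fst ` \<tau>)"

definition t_coord :: "point set \<Rightarrow> real" where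
  "t_coord \<tau> = the_elem (snd ` \<tau>)"

text \<open>A smoothness distribution is given by total functions \<open>rh\<close> and \<open>rv\<close>; only their values at
  first coordinates of vertical edges, resp. second coordinates of horizontal edges, are ever used.\<close>

definition smoothness :: "(real \<Rightarrow> nat) \<Rightarrow> (real \<Rightarrow> nat) \<Rightarrow> point set \<Rightarrow> nat" where
  "smoothness rh rv \<tau> = (if vertical \<tau> then rh (s_coord \<tau>) else rv (t_coord \<tau>))"

text \<open>A polynomial in \<open>\<real>[s, t]\<close> is a polynomial in \<open>t\<close> with coefficients in \<open>\<real>[s]\<close>.\<close>

definition R_space :: "nat \<Rightarrow> nat \<Rightarrow> real poly poly set" where
  "R_space m m' = {p. degree p \<le> m' \<and> (\<forall>j. degree (coeff p j) \<le> m)}"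

definition eval2 :: "real poly poly \<Rightarrow> point \<Rightarrow> real" where
  "eval2 p x = poly (poly p [:snd x:]) (fst x)"

text \<open>Class \<open>C\<^sup>k\<close> in \<open>s\<close> at \<open>x\<close>: on a neighbourhood of \<open>x\<close>, the partial derivatives
  \<open>\<partial>\<^sup>j f / \<partial>s\<^sup>j\<close> for \<open>j \<le> k\<close> (given by \<open>D j\<close>) exist and are continuous.\<close>

definition C_in_s :: "nat \<Rightarrow> (point \<Rightarrow> real) \<Rightarrow> point \<Rightarrow> bool" where
  "C_in_s k f x \<longleftrightarrow>
     (\<exists>U D. open U \<and> x \<in> U \<and> (\<forall>y\<in>U. D 0 y = f y) \<and>
        (\<forall>j\<le>k. continuous_on U (D j)) \<and>
        (\<forall>j<k. \<forall>(s, t)\<in>U. ((\<lambda>z. D j (z, t)) has_real_derivative D (Suc j) (s, t)) (at s)))"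

definition C_in_t :: "nat \<Rightarrow> (point \<Rightarrow> real) \<Rightarrow> point \<Rightarrow> bool" where
  "C_in_t k f x \<longleftrightarrow>
     (\<exists>U D. open U \<and> x \<in> U \<and> (\<forall>y\<in>U. D 0 y = f y) \<and>
        (\<forall>j\<le>k. continuous_on U (D j)) \<and>
        (\<forall>j<k. \<forall>(s, t)\<in>U. ((\<lambda>z. D j (s, z)) has_real_derivative D (Suc j) (s, t)) (at t)))"

text \<open>Functions on \<open>\<Omega>\<close> are represented by functions on the plane that vanish outside \<open>\<Omega>\<close>. The
  smoothness conditions are local at points of \<open>\<Omega>\<^sup>\<circ>\<close>, so they do not depend on this extension.\<close>

definition splines ::
    "tmesh \<Rightarrow> (real \<Rightarrow> nat) \<Rightarrow> (real \<Rightarrow> nat) \<Rightarrow> nat \<Rightarrow> nat \<Rightarrow> (point \<Rightarrow> real) set" where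
  "splines T rh rv m m' =
     {f. (\<forall>x. x \<notin> mesh_domain T \<longrightarrow> f x = 0) \<and>
         (\<forall>\<sigma>\<in>cells T. \<exists>p\<in>R_space m m'. \<forall>x\<in>\<sigma>. f x = eval2 p x) \<and>
         (\<forall>\<tau>\<in>interior_vedges T. \<forall>x\<in>\<tau> \<inter> interior (mesh_domain T).
            C_in_s (smoothness rh rv \<tau>) f x) \<and>
         (\<forall>\<tau>\<in>interior_hedges T. \<forall>x\<in>\<tau> \<inter> interior (mesh_domain T).
            C_in_t (smoothness rh rv \<tau>) f x)}"

text \<open>Vector spaces are \<open>module\<close> records over the field \<open>class_ring :: real ring\<close>; the ring
  multiplication fields of such a record play no role.\<close>

definition spline_space ::
    "tmesh \<Rightarrow> (real \<Rightarrow> nat) \<Rightarrow> (real \<Rightarrow> nat) \<Rightarrow> nat \<Rightarrow> nat \<Rightarrow> (real, point \<Rightarrow> real) module" where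
  "spline_space T rh rv m m' =
     \<lparr>carrier = splines T rh rv m m', mult = undefined, one = undefined,
      zero = (\<lambda>x. 0), add = (\<lambda>f g x. f x + g x), smult = (\<lambda>c f x. c * f x)\<rparr>"

definition edge_poly :: "point set \<Rightarrow> real poly poly" where
  "edge_poly \<tau> = (if vertical \<tau> then [:[:- s_coord \<tau>, 1:]:] else [:[:- t_coord \<tau>:], 1:])"

definition Delta :: "(real \<Rightarrow> nat) \<Rightarrow> (real \<Rightarrow> nat) \<Rightarrow> point set \<Rightarrow> real poly poly" where
  "Delta rh rv \<tau> = edge_poly \<tau> ^ (smoothness rh rv \<tau> + 1)"

definition J_edge ::
    "(real \<Rightarrow> nat) \<Rightarrow> (real \<Rightarrow> nat) \<Rightarrow> nat \<Rightarrow> nat \<Rightarrow> point set \<Rightarrow> real poly poly set" where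
  "J_edge rh rv m m' \<tau> = {p. Delta rh rv \<tau> dvd p} \<inter> R_space m m'"

text \<open>\<open>J_edge\<close> depends only on the line supporting the edge, so the union over all
  choices of \<open>\<tau>\<^sub>v\<close>, \<open>\<tau>\<^sub>h\<close> below is the sum obtained from any single choice.\<close>

definition J_vertex ::
    "tmesh \<Rightarrow> (real \<Rightarrow> nat) \<Rightarrow> (real \<Rightarrow> nat) \<Rightarrow> nat \<Rightarrow> nat \<Rightarrow> point \<Rightarrow> real poly poly set" where
  "J_vertex T rh rv m m' \<gamma> =
     {p + q | p q \<tau>\<^sub>v \<tau>\<^sub>h. \<tau>\<^sub>v \<in> edges T \<and> vertical \<tau>\<^sub>v \<and> \<gamma> \<in> \<tau>\<^sub>v \<and> p \<in> J_edge rh rv m m' \<tau>\<^sub>v \<and>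
                     \<tau>\<^sub>h \<in> edges T \<and> horizontal \<tau>\<^sub>h \<and> \<gamma> \<in> \<tau>\<^sub>h \<and> q \<in> J_edge rh rv m m' \<tau>\<^sub>h}"

text \<open>An element \<open>\<Sum> [\<tau>] c\<^sub>\<tau>\<close> of a finite direct sum is the function \<open>\<tau> \<mapsto> c\<^sub>\<tau>\<close>,
  extended by \<open>0\<close> outside the index set.\<close>

definition edge_chains ::
    "tmesh \<Rightarrow> (real \<Rightarrow> nat) \<Rightarrow> (real \<Rightarrow> nat) \<Rightarrow> nat \<Rightarrow> nat \<Rightarrow> (point set \<Rightarrow> real poly poly) set" where
  "edge_chains T rh rv m m' =
     {c. (\<forall>\<tau>\<in>interior_edges T. c \<tau> \<in> J_edge rh rv m m' \<tau>) \<and>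
         (\<forall>\<tau>. \<tau> \<notin> interior_edges T \<longrightarrow> c \<tau> = 0)}"

definition vertex_chains ::
    "tmesh \<Rightarrow> (real \<Rightarrow> nat) \<Rightarrow> (real \<Rightarrow> nat) \<Rightarrow> nat \<Rightarrow> nat \<Rightarrow> (point \<Rightarrow> real poly poly) set" where
  "vertex_chains T rh rv m m' =
     {c. (\<forall>\<gamma>\<in>interior_vertices T. c \<gamma> \<in> J_vertex T rh rv m m' \<gamma>) \<and>
         (\<forall>\<gamma>. \<gamma> \<notin> interior_vertices T \<longrightarrow> c \<gamma> = 0)}"

definition vertex_chain_space ::
    "tmesh \<Rightarrow> (real \<Rightarrow> nat) \<Rightarrow> (real \<Rightarrow> nat) \<Rightarrow> nat \<Rightarrow> nat
       \<Rightarrow> (real, point \<Rightarrow> real poly poly) module" where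
  "vertex_chain_space T rh rv m m' =
     \<lparr>carrier = vertex_chains T rh rv m m', mult = undefined, one = undefined,
      zero = (\<lambda>\<gamma>. 0), add = (\<lambda>c d \<gamma>. c \<gamma> + d \<gamma>),
      smult = (\<lambda>a c \<gamma>. Polynomial.smult [:a:] (c \<gamma>))\<rparr>"

text \<open>An orientation assigns to each edge the pair (initial vertex, final vertex).\<close>

definition orientation :: "tmesh \<Rightarrow> (point set \<Rightarrow> point \<times> point) \<Rightarrow> bool" where
  "orientation T ori \<longleftrightarrow> (\<forall>\<tau>\<in>edges T. rel_frontier \<tau> = {fst (ori \<tau>), snd (ori \<tau>)})"

text \<open>The element \<open>[\<gamma>] p\<close>, with \<open>[\<gamma>] = 0\<close> for a vertex that is not interior.\<close>

definition vertex_gen :: "tmesh \<Rightarrow> point \<Rightarrow> real poly poly \<Rightarrow> point \<Rightarrow> real poly poly" where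
  "vertex_gen T \<gamma> p = (\<lambda>x. if x = \<gamma> \<and> \<gamma> \<in> interior_vertices T then p else 0)"

definition boundary1 ::
    "tmesh \<Rightarrow> (point set \<Rightarrow> point \<times> point) \<Rightarrow> (point set \<Rightarrow> real poly poly)
       \<Rightarrow> point \<Rightarrow> real poly poly" where
  "boundary1 T ori c =
     (\<lambda>x. \<Sum>\<tau>\<in>interior_edges T. vertex_gen T (snd (ori \<tau>)) (c \<tau>) x - vertex_gen T (fst (ori \<tau>)) (c \<tau>) x)"

text \<open>The quotient of a module \<open>V\<close> by a submodule with carrier \<open>W\<close>, as a module of cosets.\<close>

definition quotient_space :: "('a, 'b, 'c) module_scheme \<Rightarrow> 'b set \<Rightarrow> ('a, 'b set) module" where
  "quotient_space V W =
     \<lparr>carrier = a_rcosets\<^bsub>V\<^esub> W, mult = undefined, one = undefined,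
      zero = W, add = set_add V, smult = (\<lambda>a X. \<Union>x\<in>X. W +>\<^bsub>V\<^esub> (a \<odot>\<^bsub>V\<^esub> x))\<rparr>"

definition H0 ::
    "tmesh \<Rightarrow> (point set \<Rightarrow> point \<times> point) \<Rightarrow> (real \<Rightarrow> nat) \<Rightarrow> (real \<Rightarrow> nat) \<Rightarrow> nat \<Rightarrow> nat
       \<Rightarrow> (real, (point \<Rightarrow> real poly poly) set) module" where
  "H0 T ori rh rv m m' =
     quotient_space (vertex_chain_space T rh rv m m') (boundary1 T ori ` edge_chains T rh rv m m')"

abbreviation real_dim :: "(real, 'b) module \<Rightarrow> nat" where
  "real_dim V \<equiv> vectorspace.dim (class_ring :: real ring) V"

definition h_number ::
    "tmesh \<Rightarrow> (point set \<Rightarrow> point \<times> point) \<Rightarrow> (real \<Rightarrow> nat) \<Rightarrow> (real \<Rightarrow> nat) \<Rightarrow> nat \<Rightarrow> nat \<Rightarrow> nat" where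
  "h_number T ori rh rv m m' = real_dim (H0 T ori rh rv m m')"

end

theory Submission
  imports Defs "HOL-Library.Function_Algebras" "HOL-Complex_Analysis.Riemann_Mapping"
begin

text \<open>Let \<open>R\<close> be the space of polynomials of bidegree at most \<open>(m, m')\<close>. Families of elements of \<open>R\<close>
  indexed by cells, interior edges and interior vertices form a complex
  \<open>C\<^sub>2 \<rightarrow> C\<^sub>1 \<rightarrow> C\<^sub>0\<close>: the first map takes the jump across an edge, the second is the boundary
  map. A spline is an element of \<open>C\<^sub>2\<close> whose jumps lie in the ideals of the edges. Since the complex is
  exact at \<open>C\<^sub>1\<close> and \<open>C\<^sub>0\<close>, the formula follows from the rank-nullity theorem.

  Exactness at \<open>C\<^sub>0\<close> holds because some edge leaves each interior vertex to the right or upwards.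
  At \<open>C\<^sub>1\<close>, a cycle \<open>c\<close> gives the function
  \<open>\<Sum> c\<^sub>\<tau> Ln ((z - hi \<tau>) / (z - lo \<tau>))\<close>, which jumps by \<open>2 \<pi> \<i> c\<^sub>\<tau>\<close> across \<open>\<tau>\<close>
  and whose derivative is holomorphic on the simply connected interior of the domain; subtracting a
  primitive of the derivative leaves the required function, constant on each cell. Simple
  connectedness also excludes that two cells meet at a boundary point without being linked there by
  interior edges; otherwise single-valuedness at that point would be an extra condition.\<close>

section \<open>Dimensions of spaces of real-valued and polynomial-valued functions\<close>

text \<open>Jumps and boundaries act on each coefficient of a polynomial separately, so exactness at
  the edges is a question on real coefficients. There the derivative of the sum of logarithms has
  residue \<open>bdry c v\<close> at the vertex \<open>v\<close>, which turns the cycle condition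
  into the absence of poles in the interior.

  The local obstacle is the T-junction, where one cell fills two of the four quadrants at a vertex
  and an edge is missing. Local arguments therefore speak of the cells occupying the quadrants at a
  point: adjacent quadrants in different cells are separated by an edge, and otherwise every
  difference across the missing edge is zero. Jumps around a vertex, divisibility and
  differentiability can then be treated as if all four edges were present.

  In the count, the kernel of the jump map cancels, and the edge and vertex terms are codimensions
  of ideals in \<open>R\<close>. The vertex term is a product because a polynomial in
  \<open>s\<close> and one in \<open>t\<close> have only the multiples of their product in
  common.\<close>

definition lin_space :: "(real \<Rightarrow> 'b \<Rightarrow> 'b) \<Rightarrow> 'b set \<Rightarrow> (real, 'b::ab_group_add) module" where
  "lin_space scl A =
     \<lparr>carrier = A, mult = undefined, one = undefined, zero = 0, add = (+), smult = scl\<rparr>"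

definition is_lin :: "(real \<Rightarrow> 'b \<Rightarrow> 'b) \<Rightarrow> 'b::ab_group_add set \<Rightarrow> bool" where
  "is_lin scl A \<longleftrightarrow> vector_space scl \<and> 0 \<in> A \<and> (\<forall>x\<in>A. \<forall>y\<in>A. x + y \<in> A) \<and> (\<forall>a. \<forall>x\<in>A. scl a x \<in> A)"

definition fin_lin :: "(real \<Rightarrow> 'b \<Rightarrow> 'b) \<Rightarrow> 'b::ab_group_add set \<Rightarrow> bool" where
  "fin_lin scl A \<longleftrightarrow> is_lin scl A \<and> vectorspace.fin_dim class_ring (lin_space scl A)"

definition ldim :: "(real \<Rightarrow> 'b \<Rightarrow> 'b) \<Rightarrow> 'b::ab_group_add set \<Rightarrow> nat" where
  "ldim scl A = real_dim (lin_space scl A)"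

definition lin_on :: "'b set \<Rightarrow> (real \<Rightarrow> 'b \<Rightarrow> 'b) \<Rightarrow> (real \<Rightarrow> 'c \<Rightarrow> 'c) \<Rightarrow> ('b::ab_group_add \<Rightarrow> 'c::ab_group_add) \<Rightarrow> bool"
  where "lin_on A scl scl' f \<longleftrightarrow>
    (\<forall>x\<in>A. \<forall>y\<in>A. f (x + y) = f x + f y) \<and> (\<forall>a. \<forall>x\<in>A. f (scl a x) = scl' a (f x))"

lemma lin_space_sel [simp]:
  "carrier (lin_space scl A) = A" "zero (lin_space scl A) = 0" "add (lin_space scl A) = (+)"
  "module.smult (lin_space scl A) = scl"
  by (simp_all add: lin_space_def)

lemma lin_space_carrier_update: "(lin_space scl A)\<lparr>carrier := B\<rparr> = lin_space scl B"
  by (simp add: lin_space_def)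

lemma vector_space_facts:
  assumes "vector_space scl"
  shows "scl a (x + y) = scl a x + scl a y" "scl (a + b) x = scl a x + scl b x"
    "scl a (scl b x) = scl (a * b) x" "scl 1 x = x" "scl 0 x = 0" "scl a 0 = 0" "scl (- a) x = - scl a x"
proof -
  interpret vector_space scl by fact
  show "scl a (x + y) = scl a x + scl a y" "scl (a + b) x = scl a x + scl b x"
    "scl a (scl b x) = scl (a * b) x" "scl 1 x = x" "scl 0 x = 0" "scl a 0 = 0" "scl (- a) x = - scl a x"
    by (simp_all add: scale_right_distrib scale_left_distrib)
qed

lemma is_lin_neg: "is_lin scl A \<Longrightarrow> x \<in> A \<Longrightarrow> - x \<in> A"
  unfolding is_lin_def by (metis vector_space_facts(4,7))

lemma is_lin_diff: "is_lin scl A \<Longrightarrow> x \<in> A \<Longrightarrow> y \<in> A \<Longrightarrow> x - y \<in> A"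
  using is_lin_neg[of scl A y] unfolding is_lin_def by (metis uminus_add_conv_diff add.commute)

lemma is_lin_sum: "is_lin scl A \<Longrightarrow> (\<And>i. i \<in> I \<Longrightarrow> f i \<in> A) \<Longrightarrow> sum f I \<in> A"
  by (induction I rule: infinite_finite_induct) (auto simp: is_lin_def)

lemma vectorspace_lin_space:
  assumes "is_lin scl A"
  shows "vectorspace class_ring (lin_space scl A)"
proof (rule vs_criteria)
  note v = vector_space_facts[of scl]
  have vs: "vector_space scl" using assms by (simp add: is_lin_def)
  show "field (class_ring :: real ring)" by (rule class_field)
  show "\<forall>v\<in>carrier (lin_space scl A). \<exists>n\<in>carrier (lin_space scl A).
      v \<oplus>\<^bsub>lin_space scl A\<^esub> n = \<zero>\<^bsub>lin_space scl A\<^esub>"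
    using is_lin_neg[OF assms] by (auto intro!: bexI[where x = "- _"])
qed (use assms in \<open>auto simp: is_lin_def vector_space_facts ac_simps\<close>)

lemma lin_space_span:
  assumes "is_lin scl A" "G \<subseteq> A" "finite G"
  shows "module.span class_ring (lin_space scl A) G = {\<Sum>g\<in>G. scl (c g) g | c. True}"
proof -
  interpret V: vectorspace "class_ring :: real ring" "lin_space scl A"
    by (rule vectorspace_lin_space) fact
  have fs: "finsum (lin_space scl A) h I = sum h I" if "finite I" "h ` I \<subseteq> A" for h and I :: "'a set"
    using that
  proof (induction I)
    case (insert i I)
    then have "finsum (lin_space scl A) h (insert i I) = h i + finsum (lin_space scl A) h I"
      by (subst V.finsum_insert) auto
    then show ?case using insert by simp
  qed simp
  have "V.lincomb c G = (\<Sum>g\<in>G. scl (c g) g)" for c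
    unfolding V.lincomb_def lin_space_sel using assms by (subst fs) (auto simp: is_lin_def)
  then show ?thesis using assms V.finite_span[of G] by auto
qed

text \<open>Expresses finite dimension by ordinary finite sums, so that the arguments on subspaces
  and extensions avoid linear combinations inside module records.\<close>

lemma fin_lin_iff:
  "fin_lin scl A \<longleftrightarrow> is_lin scl A \<and> (\<exists>G. finite G \<and> G \<subseteq> A \<and> (\<forall>x\<in>A. \<exists>c. x = (\<Sum>g\<in>G. scl (c g) g)))"
proof (cases "is_lin scl A")
  case True
  interpret V: vectorspace "class_ring :: real ring" "lin_space scl A"
    by (rule vectorspace_lin_space) fact
  have "module.span class_ring (lin_space scl A) G = A \<longleftrightarrow> (\<forall>x\<in>A. \<exists>c. x = (\<Sum>g\<in>G. scl (c g) g))"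
    if "finite G" "G \<subseteq> A" for G
  proof -
    have "(\<Sum>g\<in>G. scl (c g) g) \<in> A" for c
      using that True by (intro is_lin_sum[OF True]) (auto simp: is_lin_def)
    then have "{\<Sum>g\<in>G. scl (c g) g | c. True} = A \<longleftrightarrow> (\<forall>x\<in>A. \<exists>c. x = (\<Sum>g\<in>G. scl (c g) g))"
      by blast
    then show ?thesis using lin_space_span[OF True that(2,1)] by simp
  qed
  then have "V.fin_dim \<longleftrightarrow> (\<exists>G. finite G \<and> G \<subseteq> A \<and> (\<forall>x\<in>A. \<exists>c. x = (\<Sum>g\<in>G. scl (c g) g)))"
    unfolding V.fin_dim_def lin_space_sel by (simp cong: conj_cong)
  then show ?thesis using True by (simp add: fin_lin_def)
qed (simp add: fin_lin_def)

lemma fin_lin_generators: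
  assumes "fin_lin scl A"
  obtains G where "finite G" "G \<subseteq> A" "\<And>x. x \<in> A \<Longrightarrow> \<exists>c. x = (\<Sum>g\<in>G. scl (c g) g)"
  using assms unfolding fin_lin_iff by auto

lemma fin_lin_is_lin: "fin_lin scl A \<Longrightarrow> is_lin scl A"
  by (simp add: fin_lin_def)

text \<open>A maximal independent subset of \<open>B\<close> is finite, because it lies in the span
  of a finite set.\<close>

lemma fin_lin_subset:
  assumes "fin_lin scl A" "is_lin scl B" "B \<subseteq> A"
  shows "fin_lin scl B"
proof -
  interpret vector_space scl using assms(2) by (simp add: is_lin_def)
  obtain G where G: "finite G" "G \<subseteq> A" "\<And>x. x \<in> A \<Longrightarrow> \<exists>c. x = (\<Sum>g\<in>G. scl (c g) g)"
    using fin_lin_generators[OF assms(1)] by auto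
  obtain C where C: "C \<subseteq> B" "independent C" "B \<subseteq> span C"
    using maximal_independent_subset[of B] by auto
  have "C \<subseteq> span G" using C(1) assms(3) G(3) by (fastforce simp: span_finite[OF G(1)])
  then have "finite C" using independent_span_bound[OF G(1) C(2)] by simp
  moreover have "\<exists>c. x = (\<Sum>g\<in>C. scl (c g) g)" if "x \<in> B" for x
    using C(3) that span_finite[OF \<open>finite C\<close>] by auto
  ultimately show ?thesis using assms(2) C(1) unfolding fin_lin_iff by blast
qed

section \<open>Linear maps: images, kernels and rank-nullity\<close>

lemma lin_on_0: "lin_on A scl scl' f \<Longrightarrow> 0 \<in> A \<Longrightarrow> f 0 = 0"
  unfolding lin_on_def by (metis add_cancel_right_right)

lemma is_lin_image:
  assumes "lin_on A scl scl' f" "is_lin scl A" "vector_space scl'"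
  shows "is_lin scl' (f ` A)"
  using assms lin_on_0[OF assms(1)] unfolding is_lin_def lin_on_def
  by (auto simp: image_iff) metis+

lemma is_lin_kernel:
  assumes "lin_on A scl scl' f" "is_lin scl A" "vector_space scl'"
  shows "is_lin scl {x \<in> A. f x = 0}"
  using assms lin_on_0[OF assms(1)] vector_space_facts(6)[OF assms(3)]
  unfolding is_lin_def lin_on_def by auto

lemma is_lin_vimage:
  assumes "lin_on A scl scl' f" "is_lin scl A" "is_lin scl' B"
  shows "is_lin scl {x \<in> A. f x \<in> B}"
  using assms lin_on_0[OF assms(1)] unfolding is_lin_def lin_on_def by auto

text \<open>The codomain is an arbitrary record so that the projection onto a quotient, whose
  elements are cosets, is covered as well.\<close>

lemma rank_nullity_record:
  assumes A: "fin_lin scl A" and W: "vectorspace class_ring W"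
    and hom: "f \<in> module_hom class_ring (lin_space scl A) W"
  shows "real_dim (W\<lparr>carrier := f ` A\<rparr>) + ldim scl {x \<in> A. f x = zero W} = ldim scl A"
proof -
  have V: "vectorspace class_ring (lin_space scl A)"
    using A by (simp add: vectorspace_lin_space fin_lin_def)
  interpret linear_map "class_ring :: real ring" "lin_space scl A" W f
    using V W hom by (simp add: linear_map_def mod_hom_def mod_hom_axioms_def vectorspace.is_module)
      (simp add: vectorspace_def)
  show ?thesis
    using rank_nullity A
    by (simp add: fin_lin_def ldim_def im_def ker_def lin_space_carrier_update)
qed

lemma rank_nullity_lin:
  assumes A: "fin_lin scl A" and f: "lin_on A scl scl' f" and vs: "vector_space scl'"
  shows "ldim scl' (f ` A) + ldim scl {x \<in> A. f x = 0} = ldim scl A"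
    and "fin_lin scl' (f ` A)" and "fin_lin scl {x \<in> A. f x = 0}"
proof -
  have iA: "is_lin scl A" using A by (simp add: fin_lin_def)
  note im = is_lin_image[OF f iA vs]
  have hom: "f \<in> module_hom class_ring (lin_space scl A) (lin_space scl' (f ` A))"
    using f by (auto simp: module_hom_def lin_on_def)
  show "ldim scl' (f ` A) + ldim scl {x \<in> A. f x = 0} = ldim scl A"
    using rank_nullity_record[OF A vectorspace_lin_space[OF im] hom]
    by (simp add: ldim_def lin_space_carrier_update)
  show "fin_lin scl {x \<in> A. f x = 0}"
    by (rule fin_lin_subset[OF A is_lin_kernel[OF f iA vs]]) auto
  interpret linear_map "class_ring :: real ring" "lin_space scl A" "lin_space scl' (f ` A)" f
    using vectorspace_lin_space[OF im] vectorspace_lin_space[OF iA] hom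
    by (simp add: linear_map_def mod_hom_def mod_hom_axioms_def vectorspace.is_module)
      (simp add: vectorspace_def)
  show "fin_lin scl' (f ` A)"
    using rank_nullity_main(2) A im by (simp add: fin_lin_def)
qed

lemma lin_on_sum:
  assumes "lin_on A scl scl' f" "is_lin scl A" "\<And>i. i \<in> I \<Longrightarrow> h i \<in> A"
  shows "f (sum h I) = (\<Sum>i\<in>I. f (h i))"
  using assms(3)
proof (induction I rule: infinite_finite_induct)
  case (insert i I)
  have "sum h I \<in> A" by (rule is_lin_sum[OF assms(2)]) (use insert.prems in auto)
  moreover have "h i \<in> A" using insert.prems by auto
  ultimately show ?case using insert assms(1) by (simp add: lin_on_def)
qed (use assms lin_on_0 in \<open>auto simp: is_lin_def\<close>)

text \<open>Preimages of generators of the image together with generators of the kernel span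
  \<open>A\<close>. In contrast to rank-nullity, finite dimension of \<open>A\<close> is a
  conclusion.\<close>

lemma fin_lin_extension:
  assumes f: "lin_on A scl scl' f" and A: "is_lin scl A"
    and im: "fin_lin scl' (f ` A)" and ker: "fin_lin scl {x \<in> A. f x = 0}"
  shows "fin_lin scl A"
proof -
  have vs: "vector_space scl" using A by (simp add: is_lin_def)
  obtain G where G: "finite G" "G \<subseteq> f ` A" "\<And>x. x \<in> f ` A \<Longrightarrow> \<exists>c. x = (\<Sum>g\<in>G. scl' (c g) g)"
    using fin_lin_generators[OF im] by auto
  obtain K where K: "finite K" "K \<subseteq> {x \<in> A. f x = 0}"
      "\<And>x. x \<in> {x \<in> A. f x = 0} \<Longrightarrow> \<exists>c. x = (\<Sum>g\<in>K. scl (c g) g)"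
    using fin_lin_generators[OF ker] by auto
  define l where "l = inv_into A f"
  have l: "l g \<in> A \<and> f (l g) = g" if "g \<in> G" for g
    using that G(2) inv_into_into[of g f A] f_inv_into_f[of g f A] by (auto simp: l_def)
  let ?H = "l ` G \<union> K"
  have span: "\<exists>c. x = (\<Sum>g\<in>?H. scl (c g) g)" if x: "x \<in> A" for x
  proof -
    obtain c where c: "f x = (\<Sum>g\<in>G. scl' (c g) g)" using G(3) x by blast
    let ?y = "\<Sum>g\<in>G. scl (c g) (l g)"
    have y: "?y \<in> A" using l A by (intro is_lin_sum[OF A]) (auto simp: is_lin_def)
    have "f ?y = (\<Sum>g\<in>G. f (scl (c g) (l g)))"
      using l A by (intro lin_on_sum[OF f A]) (auto simp: is_lin_def)
    also have "\<dots> = f x" unfolding c using l f by (intro sum.cong) (auto simp: lin_on_def)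
    finally have fy: "f ?y = f x" .
    have "f (x - ?y) + f ?y = f x"
      using f is_lin_diff[OF A x y] y unfolding lin_on_def by (metis diff_add_cancel)
    then have "x - ?y \<in> {x \<in> A. f x = 0}" using fy is_lin_diff[OF A x y] by simp
    then obtain d where d: "x - ?y = (\<Sum>g\<in>K. scl (d g) g)" using K(3) by blast
    have "inj_on l G" using l by (intro inj_on_inverseI[where g = f]) auto
    then have y': "?y = (\<Sum>g\<in>l ` G. scl (c (f g)) g)"
      using l by (simp add: sum.reindex)
    \<comment> \<open>The lifted generators and \<open>K\<close> may share an element, so each sum
      is padded with zero coefficients to the union before the coefficients are added.\<close>
    have "?y = (\<Sum>g\<in>?H. scl (if g \<in> l ` G then c (f g) else 0) g)"
      unfolding y' using G(1) K(1) vector_space_facts[OF vs]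
      by (intro sum.mono_neutral_cong_left) auto
    moreover have "x - ?y = (\<Sum>g\<in>?H. scl (if g \<in> K then d g else 0) g)"
      unfolding d using G(1) K(1) vector_space_facts[OF vs]
      by (intro sum.mono_neutral_cong_left) auto
    moreover have "x = ?y + (x - ?y)" by simp
    ultimately have "x = (\<Sum>g\<in>?H. scl ((if g \<in> l ` G then c (f g) else 0) + (if g \<in> K then d g else 0)) g)"
      unfolding vector_space_facts(2)[OF vs] sum.distrib by argo
    then show ?thesis
      by (intro exI[of _ "\<lambda>g. (if g \<in> l ` G then c (f g) else 0) + (if g \<in> K then d g else 0)"])
  qed
  have "finite ?H" "?H \<subseteq> A" using G(1) K(1,2) l by auto
  then show ?thesis unfolding fin_lin_iff using A span by blast
qed

lemma ldim_zero:
  fixes scl :: "real \<Rightarrow> 'b::ab_group_add \<Rightarrow> 'b"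
  assumes "vector_space scl"
  shows "fin_lin scl {0}" "ldim scl {0} = 0"
proof -
  have l: "is_lin scl {0}" using assms vector_space_facts(6)[OF assms] by (simp add: is_lin_def)
  have "finite {} \<and> {} \<subseteq> {0::'b} \<and> (\<forall>x\<in>{0::'b}. \<exists>c. x = (\<Sum>g\<in>{}. scl (c g) g))" by simp
  then show "fin_lin scl {0}"
    unfolding fin_lin_iff using l by blast
  interpret V: vectorspace "class_ring :: real ring" "lin_space scl {0}"
    by (rule vectorspace_lin_space) fact
  have "V.span {} = {0}" using lin_space_span[OF l, of "{}"] by simp
  then have "V.dim \<le> card ({} :: 'b set)" by (intro V.gen_ge_dim) auto
  then show "ldim scl {0} = 0" by (simp add: ldim_def)
qed

lemma ldim_inj_on:
  assumes A: "fin_lin scl A" and f: "lin_on A scl scl' f" and vs: "vector_space scl'"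
    and inj: "\<And>x. x \<in> A \<Longrightarrow> f x = 0 \<Longrightarrow> x = 0"
  shows "ldim scl' (f ` A) = ldim scl A"
proof -
  have "0 \<in> A" using A by (simp add: fin_lin_def is_lin_def)
  then have "{x \<in> A. f x = 0} = {0}" using inj lin_on_0[OF f] by auto
  moreover have "vector_space scl" using A by (simp add: fin_lin_def is_lin_def)
  ultimately show ?thesis using rank_nullity_lin(1)[OF A f vs] ldim_zero(2)[of scl] by simp
qed

lemma vector_space_real: "vector_space ((*) :: real \<Rightarrow> real \<Rightarrow> real)"
  by unfold_locales (auto simp: algebra_simps)

lemma ldim_real: "fin_lin (*) (UNIV :: real set)" "ldim (*) (UNIV :: real set) = 1"
proof -
  have l: "is_lin (*) (UNIV :: real set)" by (simp add: is_lin_def vector_space_real)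
  have "finite {1::real} \<and> {1::real} \<subseteq> UNIV \<and> (\<forall>x::real\<in>UNIV. \<exists>c. x = (\<Sum>g\<in>{1}. (c g) * g))"
    by (auto intro: exI[of _ "\<lambda>_. _"])
  then show "fin_lin (*) (UNIV :: real set)" unfolding fin_lin_iff using l by blast
  interpret V: vectorspace "class_ring :: real ring" "lin_space (*) (UNIV :: real set)"
    by (rule vectorspace_lin_space) fact
  have "V.span {1} = UNIV" using lin_space_span[OF l, of "{1}"] by auto
  then have le: "V.dim \<le> card ({1} :: real set)" by (intro V.gen_ge_dim) auto
  have fd: "V.fin_dim" using \<open>fin_lin (*) (UNIV :: real set)\<close> by (simp add: fin_lin_def)
  have "V.dim \<noteq> 0"
  proof
    assume "V.dim = 0"
    obtain B where B: "finite B" "V.basis B" using fd V.finite_basis_exists by blast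
    then have "card B = 0" using V.dim_basis \<open>V.dim = 0\<close> by simp
    then have "B = {}" using B by simp
    then have "V.span {} = UNIV" using B by (simp add: V.basis_def)
    then have "UNIV = {0::real}" using lin_space_span[OF l, of "{}"] by simp
    then show False by (metis UNIV_I singletonD zero_neq_one)
  qed
  then show "ldim (*) (UNIV :: real set) = 1" using le by (simp add: ldim_def)
qed

section \<open>Finite direct sums as families\<close>

definition fscale :: "(real \<Rightarrow> 'b \<Rightarrow> 'b) \<Rightarrow> real \<Rightarrow> ('i \<Rightarrow> 'b) \<Rightarrow> 'i \<Rightarrow> 'b" where
  "fscale scl a f = (\<lambda>i. scl a (f i))"

definition chains :: "'i set \<Rightarrow> ('i \<Rightarrow> 'b set) \<Rightarrow> ('i \<Rightarrow> 'b::zero) set" where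
  "chains I A = {c. (\<forall>i\<in>I. c i \<in> A i) \<and> (\<forall>i. i \<notin> I \<longrightarrow> c i = 0)}"

lemma vector_space_fscale:
  "vector_space scl \<Longrightarrow> vector_space (fscale scl)"
  unfolding vector_space_def fscale_def by (auto simp: plus_fun_def)

lemma is_lin_chains:
  assumes "vector_space scl" "\<And>i. i \<in> I \<Longrightarrow> is_lin scl (A i)"
  shows "is_lin (fscale scl) (chains I A)"
  using assms(2) vector_space_facts(6)[OF assms(1)] vector_space_fscale[OF assms(1)]
  unfolding is_lin_def chains_def by (auto simp: fscale_def)

text \<open>Induction on the index set: evaluation at the new index maps onto its summand, with the
  direct sum over the old indices as kernel.\<close>

lemma ldim_chains:
  assumes "vector_space scl" "finite I" "\<And>i. i \<in> I \<Longrightarrow> fin_lin scl (A i)"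
  shows "fin_lin (fscale scl) (chains I A)" "ldim (fscale scl) (chains I A) = (\<Sum>i\<in>I. ldim scl (A i))"
proof -
  have "fin_lin (fscale scl) (chains I A) \<and> ldim (fscale scl) (chains I A) = (\<Sum>i\<in>I. ldim scl (A i))"
    using assms(2,3)
  proof (induction I)
    case empty
    have "chains {} A = {0}" by (auto simp: chains_def)
    then show ?case using ldim_zero[OF vector_space_fscale[OF assms(1)]] by simp
  next
    case (insert i I)
    let ?f = "\<lambda>c. c i"
    let ?C = "chains (insert i I) A"
    have lin: "is_lin (fscale scl) ?C"
      by (rule is_lin_chains[OF assms(1)]) (use insert in \<open>auto simp: fin_lin_def\<close>)
    have f: "lin_on ?C (fscale scl) scl ?f" by (simp add: lin_on_def fscale_def)
    have im: "?f ` ?C = A i"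
    proof (rule antisym)
      show "A i \<subseteq> ?f ` ?C"
      proof
        fix x assume "x \<in> A i"
        then have "(\<lambda>j. if j = i then x else 0) \<in> ?C"
          using insert by (auto simp: chains_def fin_lin_def is_lin_def)
        then show "x \<in> ?f ` ?C" by (rule rev_image_eqI) simp
      qed
    qed (auto simp: chains_def)
    have "0 \<in> A i" using insert.prems by (simp add: fin_lin_def is_lin_def)
    then have ker: "{c \<in> ?C. ?f c = 0} = chains I A"
      using insert.hyps(2) unfolding chains_def by fastforce
    have "fin_lin (fscale scl) ?C"
      using insert by (intro fin_lin_extension[OF f lin]) (simp_all add: im ker)
    then show ?case
      using rank_nullity_lin(1)[OF _ f assms(1)] insert by (simp add: im ker)
  qed
  then show "fin_lin (fscale scl) (chains I A)" "ldim (fscale scl) (chains I A) = (\<Sum>i\<in>I. ldim scl (A i))"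
    by auto
qed

text \<open>The projection \<open>q\<close> is onto with kernel \<open>B\<close>, so rank-nullity
  gives the count; the work lies in showing that the operations on cosets are those on
  representatives.\<close>

lemma ldim_quotient_space:
  assumes A: "fin_lin scl A" and B: "is_lin scl B" "B \<subseteq> A"
  shows "real_dim (quotient_space (lin_space scl A) B) + ldim scl B = ldim scl A"
proof -
  let ?V = "lin_space scl A"
  let ?Q = "quotient_space ?V B"
  have vs: "vector_space scl" and iA: "is_lin scl A" using A by (auto simp: fin_lin_def is_lin_def)
  note v = vector_space_facts[OF vs]
  define q where "q x = {y. y - x \<in> B}" for x
  have coset: "B +>\<^bsub>?V\<^esub> x = q x" for x
    by (force simp: a_r_coset_def' q_def)
  have B0: "0 \<in> B" using B by (simp add: is_lin_def)
  have q_eq: "q x = q y \<longleftrightarrow> x - y \<in> B" for x y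
  proof
    assume "q x = q y"
    moreover have "x \<in> q x" using B0 by (simp add: q_def)
    ultimately show "x - y \<in> B" by (simp add: q_def)
  next
    assume xy: "x - y \<in> B"
    have "z - x \<in> B \<longleftrightarrow> z - y \<in> B" for z
    proof
      assume "z - x \<in> B"
      then have "(z - x) + (x - y) \<in> B" using xy B(1) unfolding is_lin_def by blast
      then show "z - y \<in> B" by simp
    next
      assume "z - y \<in> B"
      then have "(z - y) - (x - y) \<in> B" using xy is_lin_diff[OF B(1)] by blast
      then show "z - x \<in> B" by simp
    qed
    then show "q x = q y" by (simp add: q_def)
  qed
  have carr: "carrier ?Q = q ` A"
    by (auto simp: quotient_space_def A_RCOSETS_def' coset)
  have zero: "zero ?Q = q 0" by (simp add: quotient_space_def q_def)
  have add: "q x \<oplus>\<^bsub>?Q\<^esub> q y = q (x + y)" for x y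
  proof -
    have "(\<exists>h\<in>q x. \<exists>k\<in>q y. z = h + k) \<longleftrightarrow> z \<in> q (x + y)" for z
    proof
      assume "\<exists>h\<in>q x. \<exists>k\<in>q y. z = h + k"
      then obtain h k where hk: "h - x \<in> B" "k - y \<in> B" "z = h + k" by (auto simp: q_def)
      then have "(h - x) + (k - y) \<in> B" using B(1) unfolding is_lin_def by blast
      then show "z \<in> q (x + y)" using hk by (simp add: q_def algebra_simps)
    next
      assume "z \<in> q (x + y)"
      then have "z - y \<in> q x" "y \<in> q y" using B0 by (auto simp: q_def algebra_simps)
      then show "\<exists>h\<in>q x. \<exists>k\<in>q y. z = h + k" by (metis diff_add_cancel)
    qed
    then show ?thesis by (auto simp: quotient_space_def set_add_def')
  qed
  \<comment> \<open>Scalar multiplication of a coset is defined as a union over all its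
    representatives; each of them contributes the same coset.\<close>
  have sm: "a \<odot>\<^bsub>?Q\<^esub> q x = q (scl a x)" for a x
  proof -
    have "scl a y - scl a x \<in> B" if "y - x \<in> B" for y
    proof -
      have "scl a (y - x) \<in> B" using that B(1) by (simp add: is_lin_def)
      then show ?thesis using v(1)[of a y "- x"] v(1)[of a x "- x"] v(6)
        by (metis add_eq_0_iff diff_conv_add_uminus right_minus)
    qed
    then have "q (scl a y) = q (scl a x)" if "y \<in> q x" for y
      using that q_eq by (simp add: q_def)
    moreover have "x \<in> q x" using B0 by (simp add: q_def)
    moreover have "a \<odot>\<^bsub>?Q\<^esub> q x = (\<Union>y\<in>q x. q (scl a y))" by (simp add: quotient_space_def coset)
    ultimately show ?thesis by blast
  qed
  have cl: "0 \<in> A" "x \<in> A \<Longrightarrow> y \<in> A \<Longrightarrow> x + y \<in> A" "x \<in> A \<Longrightarrow> scl a x \<in> A" for x y a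
    using iA by (auto simp: is_lin_def)
  have W: "vectorspace class_ring ?Q"
  proof (rule vs_criteria)
    show "field (class_ring :: real ring)" by (rule class_field)
    show "\<forall>u\<in>carrier ?Q. \<exists>n\<in>carrier ?Q. u \<oplus>\<^bsub>?Q\<^esub> n = \<zero>\<^bsub>?Q\<^esub>"
    proof
      fix u assume "u \<in> carrier ?Q"
      then obtain x where "x \<in> A" "u = q x" by (auto simp: carr)
      then have "q (- x) \<in> carrier ?Q" "u \<oplus>\<^bsub>?Q\<^esub> q (- x) = \<zero>\<^bsub>?Q\<^esub>"
        using is_lin_neg[OF iA] by (auto simp: carr add zero)
      then show "\<exists>n\<in>carrier ?Q. u \<oplus>\<^bsub>?Q\<^esub> n = \<zero>\<^bsub>?Q\<^esub>" by blast
    qed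
  qed (auto simp: carr zero add sm cl v(1-4) ac_simps)
  have hom: "q \<in> module_hom class_ring ?V ?Q"
    by (auto simp: module_hom_def carr add sm)
  have ker: "{x \<in> A. q x = zero ?Q} = B"
    using B(2) by (auto simp: zero q_eq)
  have "?Q\<lparr>carrier := q ` A\<rparr> = ?Q" using carr by (simp add: quotient_space_def)
  then show ?thesis using rank_nullity_record[OF A W hom] ker by simp
qed

text \<open>By exactness at \<open>A1\<close>, \<open>d2\<close> maps the space on the left onto the
  cycles in \<open>I1\<close>, and its kernel there is the whole kernel of \<open>d2\<close>, since
  \<open>I1\<close> contains 0. Rank-nullity for \<open>d2\<close> on both spaces and for
  \<open>d1\<close> on \<open>A1\<close> and \<open>I1\<close> leaves only dimensions of the terms;
  the failure of \<open>d1\<close> to map \<open>I1\<close> onto \<open>I0\<close> is measured by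
  the quotient.\<close>

lemma exact_complex_dim:
  assumes A2: "fin_lin s2 A2" and A1: "fin_lin s1 A1" and A0: "fin_lin s0 A0"
    and d2: "lin_on A2 s2 s1 d2" and d1: "lin_on A1 s1 s0 d1"
    and ex0: "d1 ` A1 = A0" and ex1: "{c \<in> A1. d1 c = 0} = d2 ` A2"
    and I1: "is_lin s1 I1" "I1 \<subseteq> A1" and I0: "is_lin s0 I0" "I0 \<subseteq> A0" and sub: "d1 ` I1 \<subseteq> I0"
  shows "int (ldim s2 {c \<in> A2. d2 c \<in> I1}) =
     int (ldim s2 A2) - int (ldim s1 A1) + int (ldim s0 A0) + int (ldim s1 I1) - int (ldim s0 I0)
     + int (real_dim (quotient_space (lin_space s0 I0) (d1 ` I1)))"
proof -
  have v0: "vector_space s0" and v1: "vector_space s1"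
    using A0 A1 by (auto simp: fin_lin_def is_lin_def)
  let ?S = "{c \<in> A2. d2 c \<in> I1}"
  have fI1: "fin_lin s1 I1" by (rule fin_lin_subset[OF A1 I1])
  have fI0: "fin_lin s0 I0" by (rule fin_lin_subset[OF A0 I0])
  have fS: "fin_lin s2 ?S"
    by (rule fin_lin_subset[OF A2 is_lin_vimage[OF d2 fin_lin_is_lin[OF A2] I1(1)]]) auto
  have d2S: "lin_on ?S s2 s1 d2" and d1I: "lin_on I1 s1 s0 d1"
    using d2 d1 I1(2) unfolding lin_on_def by blast+
  have "d2 ` ?S = {c \<in> I1. d1 c = 0}" using ex1 I1(2) by auto
  moreover have "{c \<in> ?S. d2 c = 0} = {c \<in> A2. d2 c = 0}" using I1(1) by (auto simp: is_lin_def)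
  moreover note rank_nullity_lin(1)[OF A2 d2 v1] rank_nullity_lin(1)[OF A1 d1 v0]
    rank_nullity_lin(1)[OF fS d2S v1] rank_nullity_lin(1)[OF fI1 d1I v0]
    ldim_quotient_space[OF fI0 is_lin_image[OF d1I I1(1) v0] sub]
  ultimately show ?thesis using ex0 ex1 by simp
qed

lemma fin_lin_inj:
  assumes f: "lin_on A scl scl' f" and A: "is_lin scl A" and im: "fin_lin scl' (f ` A)"
    and inj: "\<And>x. x \<in> A \<Longrightarrow> f x = 0 \<Longrightarrow> x = 0"
  shows "fin_lin scl A" "ldim scl A = ldim scl' (f ` A)"
proof -
  have vs: "vector_space scl" "vector_space scl'" using A im by (auto simp: fin_lin_def is_lin_def)
  have "{x \<in> A. f x = 0} = {0}" using inj lin_on_0[OF f] A by (auto simp: is_lin_def)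
  then have "fin_lin scl {x \<in> A. f x = 0}" using ldim_zero(1)[OF vs(1)] by simp
  then show *: "fin_lin scl A" by (rule fin_lin_extension[OF f A im])
  show "ldim scl A = ldim scl' (f ` A)" using ldim_inj_on[OF * f vs(2) inj] by simp
qed

text \<open>The kernel of addition on the direct sum of \<open>A\<close> and \<open>B\<close>
  consists of the pairs \<open>(x, - x)\<close>, a copy of \<open>A \<inter> B\<close>. The direct
  sum is realized as families indexed by \<open>bool\<close>.\<close>

lemma ldim_sum_inter:
  assumes A: "fin_lin scl A" and B: "fin_lin scl B"
  shows "ldim scl {x + y | x y. x \<in> A \<and> y \<in> B} + ldim scl (A \<inter> B) = ldim scl A + ldim scl B"
    and "fin_lin scl {x + y | x y. x \<in> A \<and> y \<in> B}"
proof -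
  have vs: "vector_space scl" using A by (auto simp: fin_lin_def is_lin_def)
  define F where "F b = (if b then A else B)" for b
  let ?C = "chains (UNIV :: bool set) F"
  let ?f = "\<lambda>c. c True + c False"
  have C: "fin_lin (fscale scl) ?C" "ldim (fscale scl) ?C = ldim scl A + ldim scl B"
    using ldim_chains[OF vs, of UNIV F] A B by (auto simp: F_def UNIV_bool)
  have f: "lin_on ?C (fscale scl) scl ?f"
    by (simp add: lin_on_def fscale_def vector_space_facts[OF vs])
  have im: "?f ` ?C = {x + y | x y. x \<in> A \<and> y \<in> B}"
  proof (intro subset_antisym subsetI)
    fix z assume "z \<in> {x + y | x y. x \<in> A \<and> y \<in> B}"
    then obtain x y where "z = x + y" "x \<in> A" "y \<in> B" by blast
    then have "z = ?f (\<lambda>b. if b then x else y)" "(\<lambda>b. if b then x else y) \<in> ?C"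
      by (auto simp: chains_def F_def)
    then show "z \<in> ?f ` ?C" by (rule image_eqI)
  next
    fix z assume "z \<in> ?f ` ?C"
    then obtain c where "c \<in> ?C" "z = c True + c False" by blast
    then show "z \<in> {x + y | x y. x \<in> A \<and> y \<in> B}"
      by (auto simp: chains_def F_def all_bool_eq)
  qed
  let ?K = "{c \<in> ?C. ?f c = 0}"
  have K: "fin_lin (fscale scl) ?K" by (rule rank_nullity_lin(3)[OF C(1) f vs])
  have ev: "lin_on ?K (fscale scl) scl (\<lambda>c. c True)" by (simp add: lin_on_def fscale_def)
  have "(\<lambda>c. c True) ` ?K = A \<inter> B"
  proof (intro subset_antisym subsetI)
    fix x assume x: "x \<in> A \<inter> B"
    then have "- x \<in> B" using is_lin_neg[OF fin_lin_is_lin[OF B]] by blast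
    then have "(\<lambda>b. if b then x else - x) \<in> ?K" using x by (auto simp: chains_def F_def)
    then show "x \<in> (\<lambda>c. c True) ` ?K" by (rule rev_image_eqI) simp
  next
    fix x assume "x \<in> (\<lambda>c. c True) ` ?K"
    then obtain c where c: "c True \<in> A" "c False \<in> B" "c True + c False = 0" "x = c True"
      by (auto simp: chains_def F_def all_bool_eq)
    then have "x = - c False" by (simp add: eq_neg_iff_add_eq_0)
    then show "x \<in> A \<inter> B" using c is_lin_neg[OF fin_lin_is_lin[OF B]] by auto
  qed
  moreover have "c = 0" if "c \<in> ?K" "c True = 0" for c
    using that by (auto simp: fun_eq_iff all_bool_eq)
  ultimately have "ldim scl (A \<inter> B) = ldim (fscale scl) ?K"
    using ldim_inj_on[OF K ev vs] by simp
  then show "ldim scl {x + y | x y. x \<in> A \<and> y \<in> B} + ldim scl (A \<inter> B) = ldim scl A + ldim scl B"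
    using rank_nullity_lin(1)[OF C(1) f vs] C(2) im by simp
  show "fin_lin scl {x + y | x y. x \<in> A \<and> y \<in> B}"
    using rank_nullity_lin(2)[OF C(1) f vs] im by simp
qed

section \<open>Polynomials of bounded bidegree\<close>

definition pscale :: "real \<Rightarrow> real poly poly \<Rightarrow> real poly poly" where
  "pscale a p = Polynomial.smult [:a:] p"

lemma vector_space_pscale: "vector_space pscale"
  unfolding pscale_def by unfold_locales (simp_all add: smult_add_right smult_add_left[symmetric] mult.commute one_pCons[symmetric])

lemma coeff_pscale [simp]: "coeff (coeff (pscale a p) j) i = a * coeff (coeff p j) i"
  by (simp add: pscale_def)

text \<open>The bounds on the exponents are strict: bound 0 gives the zero space, so division by a
  factor of degree \<open>n\<close> lowers a bound \<open>M\<close> to \<open>M - n\<close> even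
  where the subtraction is truncated.\<close>

definition bideg_lt :: "nat \<Rightarrow> nat \<Rightarrow> real poly poly set" where
  "bideg_lt M M' = {p. \<forall>j i. M \<le> i \<or> M' \<le> j \<longrightarrow> coeff (coeff p j) i = 0}"

lemma poly2_eqI: "(\<And>j i. coeff (coeff p j) i = coeff (coeff q j) i) \<Longrightarrow> p = (q :: 'a::zero poly poly)"
  by (simp add: poly_eq_iff)

lemma degree_le_iff: "degree p \<le> n \<longleftrightarrow> (\<forall>j\<ge>Suc n. coeff p j = 0)"
  by (metis Suc_le_eq coeff_eq_0 degree_le order_le_less_trans)

lemma R_space_eq: "R_space m m' = bideg_lt (Suc m) (Suc m')"
  by (auto simp: R_space_def bideg_lt_def degree_le_iff poly_eq_iff)

lemma is_lin_bideg_lt: "is_lin pscale (bideg_lt M M')"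
  by (auto simp: is_lin_def vector_space_pscale bideg_lt_def)

definition poly2 :: "nat \<Rightarrow> nat \<Rightarrow> (nat \<Rightarrow> nat \<Rightarrow> real) \<Rightarrow> real poly poly" where
  "poly2 M M' c = (\<Sum>j<M'. monom (\<Sum>i<M. monom (c j i) i) j)"

lemma coeff_poly2 [simp]: "coeff (coeff (poly2 M M' c) j) i = (if i < M \<and> j < M' then c j i else 0)"
  by (simp add: poly2_def coeff_sum)

lemma poly2_in_bideg_lt: "poly2 M M' c \<in> bideg_lt M M'"
  by (auto simp: bideg_lt_def)

lemma ldim_bideg_lt: "fin_lin pscale (bideg_lt M M')" "ldim pscale (bideg_lt M M') = M * M'"
proof -
  let ?I = "{..<M'} \<times> {..<M}"
  let ?C = "chains ?I (\<lambda>_. UNIV :: real set)"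
  let ?f = "\<lambda>p (j, i). coeff (coeff p j) i"
  have f: "lin_on (bideg_lt M M') pscale (fscale (*)) ?f"
    by (auto simp: lin_on_def fscale_def fun_eq_iff)
  have im: "?f ` bideg_lt M M' = ?C"
  proof (intro subset_antisym subsetI)
    fix c assume "c \<in> ?C"
    then have "c = ?f (poly2 M M' (\<lambda>j i. c (j, i)))" by (auto simp: chains_def fun_eq_iff)
    then show "c \<in> ?f ` bideg_lt M M'" using poly2_in_bideg_lt by (rule image_eqI)
  qed (auto simp: chains_def bideg_lt_def)
  have C: "fin_lin (fscale (*)) ?C" "ldim (fscale (*)) ?C = M * M'"
    using ldim_chains[OF vector_space_real, of ?I "\<lambda>_. UNIV"] by (simp_all add: ldim_real)
  have inj: "p = 0" if "?f p = 0" for p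
    using that by (intro poly2_eqI) (auto simp: fun_eq_iff)
  have "fin_lin (fscale (*)) (?f ` bideg_lt M M')" using C(1) im by simp
  then show "fin_lin pscale (bideg_lt M M')" "ldim pscale (bideg_lt M M') = M * M'"
    using fin_lin_inj[OF f is_lin_bideg_lt _ inj] C(2) im by simp_all
qed

section \<open>Multiples of a polynomial in \<open>s\<close> and of a power of
  \<open>t - b\<close>\<close>

lemma bideg_lt_iff:
  "p \<in> bideg_lt M M' \<longleftrightarrow> (\<forall>j. coeff p j = 0 \<or> j < M' \<and> degree (coeff p j) < M)"
proof -
  have *: "(\<forall>i\<ge>M. coeff q i = 0) \<longleftrightarrow> q = 0 \<or> degree q < M" for q :: "real poly"
    by (metis coeff_eq_0 leading_coeff_0_iff le_cases not_le order_less_le_trans coeff_0)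
  show ?thesis
    unfolding bideg_lt_def mem_Collect_eq using *[of "coeff p _"]
    by (metis coeff_0 linorder_not_le poly_eq_iff)
qed

lemma const_multiples_bideg_lt:
  assumes "u \<noteq> 0"
  shows "{p. [:u:] dvd p} \<inter> bideg_lt M M' = Polynomial.smult u ` bideg_lt (M - degree u) M'"
proof -
  have "Polynomial.smult u q \<in> bideg_lt M M' \<longleftrightarrow> q \<in> bideg_lt (M - degree u) M'" for q
    using assms by (auto simp: bideg_lt_iff degree_mult_eq less_diff_conv add.commute)
  moreover have "[:u:] dvd p \<longleftrightarrow> (\<exists>q. p = Polynomial.smult u q)" for p by (auto simp: dvd_def)
  ultimately show ?thesis by auto
qed

text \<open>Coefficient \<open>l + 1\<close> of the product is coefficient \<open>l\<close> of
  \<open>q\<close> minus \<open>b\<close> times coefficient \<open>l + 1\<close> of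
  \<open>q\<close>. A bound on the degrees in \<open>s\<close> therefore passes from the product to
  \<open>q\<close>, by descent from the top coefficient.\<close>

lemma linear_mult_inner_degree:
  fixes q :: "real poly poly"
  shows "(\<forall>j. \<forall>i\<ge>M. coeff (coeff ([:[:- b:], 1:] * q) j) i = 0) \<longleftrightarrow> (\<forall>j. \<forall>i\<ge>M. coeff (coeff q j) i = 0)"
proof -
  have cf: "coeff ([:[:- b:], 1:] * q) j = Polynomial.smult (- b) (coeff q j) + (case j of 0 \<Rightarrow> 0 | Suc l \<Rightarrow> coeff q l)" for j
    by (simp add: coeff_pCons split: nat.split)
  show ?thesis
  proof (intro iffI allI impI)
    fix j i assume *: "\<forall>j. \<forall>i\<ge>M. coeff (coeff ([:[:- b:], 1:] * q) j) i = 0" and i: "M \<le> i"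
    have "\<forall>l. degree q < l + n \<longrightarrow> coeff (coeff q l) i = 0" for n
    proof (induction n)
      case (Suc n)
      show ?case
      proof (intro allI impI)
        fix l assume "degree q < l + Suc n"
        then have "coeff (coeff q (Suc l)) i = 0" using Suc by simp
        then show "coeff (coeff q l) i = 0" using *[rule_format, OF i, of "Suc l"] by (simp add: cf)
      qed
    qed (simp add: coeff_eq_0)
    from this[of "Suc (degree q)"] show "coeff (coeff q j) i = 0" by simp
  next
    fix j i assume "\<forall>j. \<forall>i\<ge>M. coeff (coeff q j) i = 0" "M \<le> i"
    then show "coeff (coeff ([:[:- b:], 1:] * q) j) i = 0" unfolding cf by (cases j) auto
  qed
qed

lemma linear_power_mult_inner_degree:
  fixes q :: "real poly poly"
  shows "(\<forall>j. \<forall>i\<ge>M. coeff (coeff ([:[:- b:], 1:] ^ n * q) j) i = 0) \<longleftrightarrow> (\<forall>j. \<forall>i\<ge>M. coeff (coeff q j) i = 0)"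
proof (induction n)
  case (Suc n)
  have "[:[:- b:], 1:] ^ Suc n * q = [:[:- b:], 1:] * ([:[:- b:], 1:] ^ n * q)" by (simp only: power_Suc mult.assoc)
  then show ?case using Suc linear_mult_inner_degree[of M b "[:[:- b:], 1:] ^ n * q"] by (simp only:)
qed simp

lemma bideg_lt_iff2:
  "p \<in> bideg_lt M M' \<longleftrightarrow> (p = 0 \<or> degree p < M') \<and> (\<forall>j. \<forall>i\<ge>M. coeff (coeff p j) i = 0)"
proof
  assume p: "p \<in> bideg_lt M M'"
  have "coeff p (degree p) = 0 \<or> degree p < M'" using p bideg_lt_iff by blast
  then show "(p = 0 \<or> degree p < M') \<and> (\<forall>j. \<forall>i\<ge>M. coeff (coeff p j) i = 0)"
    using p by (auto simp: bideg_lt_def)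
next
  assume "(p = 0 \<or> degree p < M') \<and> (\<forall>j. \<forall>i\<ge>M. coeff (coeff p j) i = 0)"
  then show "p \<in> bideg_lt M M'" by (auto simp: bideg_lt_def coeff_eq_0)
qed

lemma linear_power_multiples_bideg_lt:
  "{p. [:[:- b:], 1:] ^ n dvd p} \<inter> bideg_lt M M' = (\<lambda>q. [:[:- b:], 1:] ^ n * q) ` bideg_lt M (M' - n)"
proof -
  have deg: "degree ([:[:- b:], 1 :: real poly:] ^ n) = n" by (simp add: degree_power_eq)
  have ne: "[:[:- b:], 1 :: real poly:] ^ n \<noteq> 0" by simp
  have "[:[:- b:], 1:] ^ n * q \<in> bideg_lt M M' \<longleftrightarrow> q \<in> bideg_lt M (M' - n)" for q
    unfolding bideg_lt_iff2 linear_power_mult_inner_degree using ne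
    by (cases "q = 0") (simp_all add: degree_mult_eq deg less_diff_conv add.commute)
  then show ?thesis by (auto simp: dvd_def)
qed

text \<open>Divisibility by a power of \<open>t - b\<close> is a condition on the order of the root
  \<open>b\<close>, which a nonzero factor in \<open>s\<close> alone does not change. This is the
  coprimality behind the dimension of the intersection.\<close>

lemma linear_power_dvd_smult:
  fixes q :: "real poly poly"
  assumes "u \<noteq> 0"
  shows "[:[:- b:], 1:] ^ n dvd Polynomial.smult u q \<longleftrightarrow> [:[:- b:], 1:] ^ n dvd q"
  using order_divides[of "[:b:]" n "Polynomial.smult u q"] order_divides[of "[:b:]" n q]
    order_smult[OF assms, of "[:b:]" q] assms by simp

lemma lin_on_smult: "lin_on A pscale pscale (Polynomial.smult u)"
  by (simp add: lin_on_def pscale_def smult_add_right mult.commute)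

lemma lin_on_mult: "lin_on A pscale pscale ((*) v)"
  by (simp add: lin_on_def pscale_def distrib_left)

lemma ldim_const_multiples:
  assumes "u \<noteq> 0"
  shows "fin_lin pscale ({p. [:u:] dvd p} \<inter> bideg_lt M M')"
    "ldim pscale ({p. [:u:] dvd p} \<inter> bideg_lt M M') = (M - degree u) * M'"
proof -
  show "fin_lin pscale ({p. [:u:] dvd p} \<inter> bideg_lt M M')"
    unfolding const_multiples_bideg_lt[OF assms]
    by (rule rank_nullity_lin(2)[OF ldim_bideg_lt(1) lin_on_smult vector_space_pscale])
  have "ldim pscale (Polynomial.smult u ` bideg_lt (M - degree u) M') = ldim pscale (bideg_lt (M - degree u) M')"
    by (rule ldim_inj_on[OF ldim_bideg_lt(1) lin_on_smult vector_space_pscale]) (use assms in simp)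
  then show "ldim pscale ({p. [:u:] dvd p} \<inter> bideg_lt M M') = (M - degree u) * M'"
    by (simp add: const_multiples_bideg_lt[OF assms] ldim_bideg_lt)
qed

lemma ldim_linear_multiples:
  "fin_lin pscale ({p. [:[:- b:], 1:] ^ n dvd p} \<inter> bideg_lt M M')"
  "ldim pscale ({p. [:[:- b:], 1:] ^ n dvd p} \<inter> bideg_lt M M') = M * (M' - n)"
proof -
  show "fin_lin pscale ({p. [:[:- b:], 1:] ^ n dvd p} \<inter> bideg_lt M M')"
    unfolding linear_power_multiples_bideg_lt
    by (rule rank_nullity_lin(2)[OF ldim_bideg_lt(1) lin_on_mult vector_space_pscale])
  have "ldim pscale ((*) ([:[:- b:], 1:] ^ n) ` bideg_lt M (M' - n)) = ldim pscale (bideg_lt M (M' - n))"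
    by (rule ldim_inj_on[OF ldim_bideg_lt(1) lin_on_mult vector_space_pscale]) simp
  then show "ldim pscale ({p. [:[:- b:], 1:] ^ n dvd p} \<inter> bideg_lt M M') = M * (M' - n)"
    by (simp add: linear_power_multiples_bideg_lt ldim_bideg_lt)
qed

lemma ldim_inter_multiples:
  assumes "u \<noteq> 0"
  shows "ldim pscale (({p. [:u:] dvd p} \<inter> bideg_lt M M') \<inter> ({p. [:[:- b:], 1:] ^ n dvd p} \<inter> bideg_lt M M'))
    = (M - degree u) * (M' - n)"
proof -
  let ?B = "{p. [:[:- b:], 1:] ^ n dvd p} \<inter> bideg_lt (M - degree u) M'"
  have "({p. [:u:] dvd p} \<inter> bideg_lt M M') \<inter> ({p. [:[:- b:], 1:] ^ n dvd p} \<inter> bideg_lt M M') =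
    ({p. [:u:] dvd p} \<inter> bideg_lt M M') \<inter> {p. [:[:- b:], 1:] ^ n dvd p}" by blast
  also have "\<dots> = Polynomial.smult u ` ?B"
    unfolding const_multiples_bideg_lt[OF assms] using linear_power_dvd_smult[OF assms] by blast
  also have "ldim pscale (Polynomial.smult u ` ?B) = ldim pscale ?B"
    by (rule ldim_inj_on[OF ldim_linear_multiples(1) lin_on_smult vector_space_pscale]) (use assms in simp)
  finally show ?thesis by (simp add: ldim_linear_multiples)
qed

text \<open>Inclusion-exclusion for the two spaces of multiples. The codimension, a product of two
  degrees, becomes the vertex term of the formula.\<close>

lemma ldim_sum_multiples:
  assumes "u \<noteq> 0" "degree u \<le> M" "n \<le> M'"
  shows "int (ldim pscale {p + q | p q. p \<in> {p. [:u:] dvd p} \<inter> bideg_lt M M' \<and> q \<in> {p. [:[:- b:], 1:] ^ n dvd p} \<inter> bideg_lt M M'})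
    = int M * int M' - int (degree u) * int n"
    and "fin_lin pscale {p + q | p q. p \<in> {p. [:u:] dvd p} \<inter> bideg_lt M M' \<and> q \<in> {p. [:[:- b:], 1:] ^ n dvd p} \<inter> bideg_lt M M'}"
proof -
  note s = ldim_sum_inter[OF ldim_const_multiples(1)[OF assms(1), of M M'] ldim_linear_multiples(1)[of b n M M']]
  show "fin_lin pscale {p + q | p q. p \<in> {p. [:u:] dvd p} \<inter> bideg_lt M M' \<and> q \<in> {p. [:[:- b:], 1:] ^ n dvd p} \<inter> bideg_lt M M'}"
    by (rule s(2))
  have "int (ldim pscale {p + q | p q. p \<in> {p. [:u:] dvd p} \<inter> bideg_lt M M' \<and> q \<in> {p. [:[:- b:], 1:] ^ n dvd p} \<inter> bideg_lt M M'})
    = int ((M - degree u) * M') + int (M * (M' - n)) - int ((M - degree u) * (M' - n))"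
    using s(1) ldim_const_multiples(2)[OF assms(1), of M M'] ldim_linear_multiples(2)[of b n M M']
      ldim_inter_multiples[OF assms(1), of M M' b n] by linarith
  also have "\<dots> = int M * int M' - int (degree u) * int n"
  proof -
    \<comment> \<open>Removes the truncated subtractions; this is where the two degree bounds
      enter.\<close>
    obtain a c where "M = degree u + a" "M' = n + c" using assms(2,3) by (auto simp: le_iff_add)
    then show ?thesis by (simp add: algebra_simps)
  qed
  finally show "int (ldim pscale {p + q | p q. p \<in> {p. [:u:] dvd p} \<inter> bideg_lt M M' \<and> q \<in> {p. [:[:- b:], 1:] ^ n dvd p} \<inter> bideg_lt M M'})
    = int M * int M' - int (degree u) * int n" .
qed

section \<open>Cells and edges in coordinates\<close>

text \<open>An axis is a Boolean, \<open>True\<close> for the first coordinate, so that vertical and horizontal edges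
  are treated alike: an edge of axis \<open>k\<close> lies on a line \<open>coord k x = a\<close>, and axis \<open>True\<close> means
  vertical.\<close>

definition coord :: "bool \<Rightarrow> point \<Rightarrow> real" where
  "coord k x = (if k then fst x else snd x)"

definition pt :: "bool \<Rightarrow> real \<Rightarrow> real \<Rightarrow> point" where
  "pt k u v = (if k then (u, v) else (v, u))"

definition Lo :: "point set \<Rightarrow> bool \<Rightarrow> real" where "Lo S k = Inf (coord k ` S)"
definition Hi :: "point set \<Rightarrow> bool \<Rightarrow> real" where "Hi S k = Sup (coord k ` S)"

definition is_edge :: "bool \<Rightarrow> point set \<Rightarrow> bool" where
  "is_edge k \<tau> \<longleftrightarrow> (if k then vertical \<tau> else horizontal \<tau>)"

definition lo :: "point set \<Rightarrow> point" where "lo \<tau> = (Lo \<tau> True, Lo \<tau> False)"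
definition hi :: "point set \<Rightarrow> point" where "hi \<tau> = (Hi \<tau> True, Hi \<tau> False)"

lemma coord_pt [simp]: "coord k (pt k u v) = u" "coord (\<not> k) (pt k u v) = v"
  by (auto simp: coord_def pt_def)

lemma pt_coord [simp]: "pt k (coord k x) (coord (\<not> k) x) = x"
  by (auto simp: coord_def pt_def)

lemma all_axis: "(\<forall>j. P j) \<longleftrightarrow> P k \<and> P (\<not> k)" for k :: bool
  by (cases k) (auto simp: all_bool_eq)

lemma point_eqI: "(\<And>k. coord k x = coord k y) \<Longrightarrow> x = y"
  by (metis (full_types) pt_coord)

lemma coord_lo [simp]: "coord k (lo \<tau>) = Lo \<tau> k" and coord_hi [simp]: "coord k (hi \<tau>) = Hi \<tau> k"
  by (auto simp: coord_def lo_def hi_def)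

lemma Lo_Hi_box:
  assumes "\<forall>k. l k \<le> u k"
  shows "Lo {x. \<forall>k. l k \<le> coord k x \<and> coord k x \<le> u k} j = l j" "Hi {x. \<forall>k. l k \<le> coord k x \<and> coord k x \<le> u k} j = u j"
proof -
  have "coord j ` {x. \<forall>k. l k \<le> coord k x \<and> coord k x \<le> u k} = {l j..u j}"
  proof (rule antisym)
    show "{l j..u j} \<subseteq> coord j ` {x. \<forall>k. l k \<le> coord k x \<and> coord k x \<le> u k}"
    proof
      fix z assume "z \<in> {l j..u j}"
      then have "pt j z (l (\<not> j)) \<in> {x. \<forall>k. l k \<le> coord k x \<and> coord k x \<le> u k}"
        using assms by (auto simp: all_axis[of _ j])
      then show "z \<in> coord j ` {x. \<forall>k. l k \<le> coord k x \<and> coord k x \<le> u k}" by (rule rev_image_eqI) simp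
    qed
  qed auto
  then show "Lo {x. \<forall>k. l k \<le> coord k x \<and> coord k x \<le> u k} j = l j" "Hi {x. \<forall>k. l k \<le> coord k x \<and> coord k x \<le> u k} j = u j"
    using assms by (auto simp: Lo_def Hi_def)
qed

lemma Times_eq_box:
  "{a..b} \<times> {c..d} = {x. \<forall>k. (if k then a else c) \<le> coord k x \<and> coord k x \<le> (if k then b else d)}"
  by (auto simp: coord_def all_axis[of _ True])

lemma cell_bounds:
  assumes "is_cell \<sigma>"
  shows "Lo \<sigma> k < Hi \<sigma> k" and "x \<in> \<sigma> \<longleftrightarrow> (\<forall>k. Lo \<sigma> k \<le> coord k x \<and> coord k x \<le> Hi \<sigma> k)"
    and "x \<in> interior \<sigma> \<longleftrightarrow> (\<forall>k. Lo \<sigma> k < coord k x \<and> coord k x < Hi \<sigma> k)" and "closed \<sigma>"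
proof -
  obtain a b c d where abcd: "a < b" "c < d" "\<sigma> = {a..b} \<times> {c..d}"
    using assms by (auto simp: is_cell_def)
  define l u where "l = (\<lambda>k. if k then a else c)" and "u = (\<lambda>k. if k then b else d)"
  have s: "\<sigma> = {x. \<forall>k. l k \<le> coord k x \<and> coord k x \<le> u k}"
    unfolding abcd(3) Times_eq_box l_def u_def ..
  have lu: "\<forall>k. l k < u k" using abcd by (auto simp: l_def u_def)
  then have le: "\<forall>k. l k \<le> u k" by (auto intro: less_imp_le)
  note LH = Lo_Hi_box[OF le, folded s]
  show "Lo \<sigma> k < Hi \<sigma> k" using lu LH by simp
  show "x \<in> \<sigma> \<longleftrightarrow> (\<forall>k. Lo \<sigma> k \<le> coord k x \<and> coord k x \<le> Hi \<sigma> k)" unfolding LH by (simp add: s)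
  have "interior \<sigma> = {a<..<b} \<times> {c<..<d}"
    by (simp add: abcd(3) interior_Times)
  then show "x \<in> interior \<sigma> \<longleftrightarrow> (\<forall>k. Lo \<sigma> k < coord k x \<and> coord k x < Hi \<sigma> k)"
    unfolding LH by (cases x) (auto simp: l_def u_def coord_def all_axis[of _ True])
  show "closed \<sigma>" by (simp add: abcd(3) closed_Times)
qed

lemma edge_closed_segment:
  assumes "is_edge k \<tau>"
  obtains a c d where "c < d" "\<tau> = {x. coord k x = a \<and> c \<le> coord (\<not> k) x \<and> coord (\<not> k) x \<le> d}"
    "\<tau> = closed_segment (pt k a c) (pt k a d)"
proof -
  have *: "closed_segment (pt k a c) (pt k a d) = {x. coord k x = a \<and> c \<le> coord (\<not> k) x \<and> coord (\<not> k) x \<le> d}"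
    if "c < d" for a c d
  proof -
    have "closed_segment (pt k a c) (pt k a d) = pt k a ` closed_segment c d"
      by (cases k) (force simp: closed_segment_def pt_def image_iff algebra_simps)+
    also have "\<dots> = {x. coord k x = a \<and> c \<le> coord (\<not> k) x \<and> coord (\<not> k) x \<le> d}"
      using that by (cases k) (auto simp: closed_segment_eq_real_ivl pt_def coord_def)
    finally show ?thesis .
  qed
  obtain a c d where cd: "c < d" and "\<tau> = (if k then {a} \<times> {c..d} else {c..d} \<times> {a})"
    using assms by (cases k) (auto simp: is_edge_def vertical_def horizontal_def)
  then have "\<tau> = {x. coord k x = a \<and> c \<le> coord (\<not> k) x \<and> coord (\<not> k) x \<le> d}"
    by (cases k) (auto simp: coord_def)
  then show ?thesis using that[OF cd] *[OF cd] by blast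
qed

lemma edge_bounds:
  assumes "is_edge k \<tau>"
  shows "Lo \<tau> (\<not> k) < Hi \<tau> (\<not> k)" "Hi \<tau> k = Lo \<tau> k"
    "x \<in> \<tau> \<longleftrightarrow> coord k x = Lo \<tau> k \<and> Lo \<tau> (\<not> k) \<le> coord (\<not> k) x \<and> coord (\<not> k) x \<le> Hi \<tau> (\<not> k)"
    "rel_frontier \<tau> = {lo \<tau>, hi \<tau>}" "lo \<tau> \<noteq> hi \<tau>"
proof -
  obtain a c d where cd: "c < d" and t: "\<tau> = {x. coord k x = a \<and> c \<le> coord (\<not> k) x \<and> coord (\<not> k) x \<le> d}"
    and seg: "\<tau> = closed_segment (pt k a c) (pt k a d)"
    by (rule edge_closed_segment[OF assms])
  define l u where "l = (\<lambda>j. if j = k then a else c)" and "u = (\<lambda>j. if j = k then a else d)"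
  have s: "\<tau> = {x. \<forall>k. l k \<le> coord k x \<and> coord k x \<le> u k}"
    unfolding t by (auto simp: l_def u_def all_axis[of _ k])
  have le: "\<forall>k. l k \<le> u k" using cd by (auto simp: l_def u_def)
  note LH = Lo_Hi_box[OF le, folded s]
  show 1: "Lo \<tau> (\<not> k) < Hi \<tau> (\<not> k)" "Hi \<tau> k = Lo \<tau> k"
    "x \<in> \<tau> \<longleftrightarrow> coord k x = Lo \<tau> k \<and> Lo \<tau> (\<not> k) \<le> coord (\<not> k) x \<and> coord (\<not> k) x \<le> Hi \<tau> (\<not> k)"
    unfolding LH using cd by (auto simp: l_def u_def t)
  have ne: "pt k a c \<noteq> pt k a d" using cd by (auto simp: pt_def)
  have "rel_frontier \<tau> = {pt k a c, pt k a d}"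
    using ne by (simp add: seg rel_frontier_def rel_interior_closed_segment open_segment_def) (auto simp: ends_in_segment)
  moreover have "coord j (pt k a c) = l j" "coord j (pt k a d) = u j" for j
    by (cases j; cases k; simp add: l_def u_def coord_def pt_def)+
  then have "lo \<tau> = pt k a c" "hi \<tau> = pt k a d"
    by (auto intro!: point_eqI simp: LH)
  ultimately show "rel_frontier \<tau> = {lo \<tau>, hi \<tau>}" "lo \<tau> \<noteq> hi \<tau>" using ne by auto
qed

lemma is_edge_unique: "is_edge k \<tau> \<Longrightarrow> is_edge j \<tau> \<longleftrightarrow> j = k"
  using edge_bounds(1,2)[of k \<tau>] edge_bounds(1,2)[of j \<tau>]
  by (cases j; cases k) auto

section \<open>Consequences of the mesh axioms; quadrants at a point\<close>

locale mesh =
  fixes T :: tmesh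
  assumes mesh: "T_mesh T"
begin

abbreviation "Om \<equiv> mesh_domain T"

lemma finite_cells: "finite (cells T)" and finite_edges: "finite (edges T)"
  using mesh by (auto simp: T_mesh_def)

lemma is_cell: "\<sigma> \<in> cells T \<Longrightarrow> is_cell \<sigma>"
  using mesh by (auto simp: T_mesh_def)

lemmas cellD = cell_bounds[OF is_cell]

lemma edge_cases:
  assumes "\<tau> \<in> edges T"
  obtains k where "is_edge k \<tau>"
  using mesh assms unfolding T_mesh_def is_edge_def by metis

lemma cell_overlap:
  assumes "\<sigma> \<in> cells T" "\<sigma>' \<in> cells T" "x \<in> interior \<sigma>" "x \<in> \<sigma>'"
  shows "\<sigma> = \<sigma>'"
proof (rule ccontr)
  assume "\<sigma> \<noteq> \<sigma>'"
  then have "\<sigma> \<inter> \<sigma>' = frontier \<sigma> \<inter> frontier \<sigma>'" using mesh assms by (simp add: T_mesh_def)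
  then show False using assms interior_subset[of \<sigma>] by (auto simp: frontier_def)
qed

lemma edge_not_interior:
  assumes "\<tau> \<in> edges T" "x \<in> \<tau>" "\<sigma> \<in> cells T"
  shows "x \<notin> interior \<sigma>"
proof
  assume x: "x \<in> interior \<sigma>"
  have "\<tau> \<subseteq> (\<Union>\<sigma>\<in>cells T. frontier \<sigma>)"
    using mesh assms(1) by (simp add: T_mesh_def)
  then obtain \<sigma>' where s': "\<sigma>' \<in> cells T" "x \<in> frontier \<sigma>'"
    using assms(2) by blast
  then have "x \<in> \<sigma>'" using cellD(4)[OF s'(1)] frontier_subset_closed by blast
  then show False using cell_overlap[OF assms(3) s'(1) x] s'(2) x by (auto simp: frontier_def)
qed

lemma frontier_edge:
  assumes "\<sigma> \<in> cells T" "x \<in> frontier \<sigma>"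
  obtains \<tau> where "\<tau> \<in> edges T" "x \<in> \<tau>" "\<tau> \<subseteq> frontier \<sigma>"
proof -
  have "\<forall>\<sigma>\<in>cells T. \<exists>E\<subseteq>edges T. frontier \<sigma> = \<Union>E"
    using mesh by (simp add: T_mesh_def)
  then obtain E where "E \<subseteq> edges T" "frontier \<sigma> = \<Union>E"
    using assms(1) by blast
  then show ?thesis using that assms(2) by blast
qed

lemma edges_meet:
  assumes "\<tau> \<in> edges T" "\<tau>' \<in> edges T" "\<tau> \<noteq> \<tau>'" "x \<in> \<tau>" "x \<in> \<tau>'"
  shows "x = lo \<tau> \<or> x = hi \<tau>"
proof -
  obtain k where k: "is_edge k \<tau>" using edge_cases[OF assms(1)] .
  have "\<tau> \<inter> \<tau>' = rel_frontier \<tau> \<inter> rel_frontier \<tau>'"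
    using mesh assms(1-3) by (simp add: T_mesh_def)
  then have "x \<in> rel_frontier \<tau>" using assms(4,5) by blast
  then show ?thesis using edge_bounds(4)[OF k] by auto
qed

text \<open>Finitely many numbers bound the cells and edges, so within some distance
  \<open>e\<close> of \<open>x\<close> the only bounding coordinates are those of \<open>x\<close>
  itself. At this scale the mesh is cut only along the two axis-parallel lines through
  \<open>x\<close>.\<close>

lemma gap:
  obtains e where "0 < e"
    "\<And>S k. S \<in> cells T \<union> edges T \<Longrightarrow> Lo S k = coord k x \<or> e \<le> \<bar>Lo S k - coord k x\<bar>"
    "\<And>S k. S \<in> cells T \<union> edges T \<Longrightarrow> Hi S k = coord k x \<or> e \<le> \<bar>Hi S k - coord k x\<bar>"
proof -
  let ?D = "(\<lambda>(S, k). \<bar>Lo S k - coord k x\<bar>) ` ((cells T \<union> edges T) \<times> UNIV)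
      \<union> (\<lambda>(S, k). \<bar>Hi S k - coord k x\<bar>) ` ((cells T \<union> edges T) \<times> UNIV)"
  \<comment> \<open>The 1 keeps the set nonempty when there is no positive distance.\<close>
  define e where "e = Min (insert 1 {d \<in> ?D. 0 < d})"
  have fin: "finite (insert 1 {d \<in> ?D. 0 < d})" using finite_cells finite_edges by simp
  have "e \<in> insert 1 {d \<in> ?D. 0 < d}" unfolding e_def by (rule Min_in[OF fin]) simp
  then have "0 < e" by auto
  moreover have "e \<le> d" if "d \<in> ?D" "0 < d" for d
    unfolding e_def using that fin by (intro Min_le) auto
  ultimately show ?thesis by (intro that[of e]) force+
qed

text \<open>A direction \<open>e\<close> selects the quadrant at \<open>x\<close> in which \<open>coord k\<close> increases if \<open>e k\<close> and
  decreases otherwise; \<open>occ e x \<sigma>\<close> states that \<open>\<sigma>\<close> contains this quadrant near \<open>x\<close>.\<close>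

definition occ :: "(bool \<Rightarrow> bool) \<Rightarrow> point \<Rightarrow> point set \<Rightarrow> bool" where
  "occ e x \<sigma> \<longleftrightarrow> \<sigma> \<in> cells T \<and> (\<forall>k. if e k then Lo \<sigma> k \<le> coord k x \<and> coord k x < Hi \<sigma> k
                                     else Lo \<sigma> k < coord k x \<and> coord k x \<le> Hi \<sigma> k)"

lemma occ_cell: "occ e x \<sigma> \<Longrightarrow> \<sigma> \<in> cells T"
  by (simp add: occ_def)

lemma occ_mem:
  assumes "occ e x \<sigma>"
  shows "x \<in> \<sigma>"
proof -
  have "Lo \<sigma> k \<le> coord k x \<and> coord k x \<le> Hi \<sigma> k" for k
    using assms by (cases "e k") (auto simp: occ_def intro: less_imp_le dest!: spec[of _ k])
  then show ?thesis using cellD(2)[OF occ_cell[OF assms]] by simp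
qed

lemma occ_unique:
  assumes "occ e x \<sigma>" "occ e x \<sigma>'"
  shows "\<sigma> = \<sigma>'"
proof -
  \<comment> \<open>A point of the open quadrant, halfway from \<open>x\<close> to the nearer of the
    two far sides, hence interior to both cells.\<close>
  define y where "y k = (if e k then (coord k x + min (Hi \<sigma> k) (Hi \<sigma>' k)) / 2
                         else (coord k x + max (Lo \<sigma> k) (Lo \<sigma>' k)) / 2)" for k
  let ?p = "pt True (y True) (y False)"
  have p: "coord k ?p = y k" for k by (cases k) (auto simp: coord_def pt_def)
  have "Lo \<sigma> k < y k \<and> y k < Hi \<sigma> k \<and> Lo \<sigma>' k < y k \<and> y k < Hi \<sigma>' k" for k
    using assms by (cases "e k") (auto simp: occ_def y_def min_def max_def dest!: spec[of _ k])
  then have "?p \<in> interior \<sigma>" "?p \<in> interior \<sigma>'"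
    using cellD(3) occ_cell assms by (auto simp: p)
  then show ?thesis using cell_overlap[OF occ_cell occ_cell, OF assms] interior_subset by blast
qed

lemma occ_exists:
  assumes "\<sigma> \<in> cells T" "x \<in> \<sigma>"
  obtains e where "occ e x \<sigma>"
proof -
  \<comment> \<open>Upwards in each coordinate, except where \<open>x\<close> lies on the upper
    side.\<close>
  have "occ (\<lambda>k. coord k x < Hi \<sigma> k) x \<sigma>"
    using assms cellD[OF assms(1)] by (auto simp: occ_def) (meson order_le_less_trans not_less order_less_le_trans)+
  then show ?thesis using that by blast
qed

text \<open>A side of \<open>\<sigma>\<close> that separates \<open>x\<close> from \<open>y\<close>
  in some coordinate would be at distance at most \<open>d\<close> from \<open>x\<close>, against
  the gap.\<close>

lemma occ_from_near:
  assumes g: "\<And>S k. S \<in> cells T \<union> edges T \<Longrightarrow> Lo S k = coord k x \<or> g \<le> \<bar>Lo S k - coord k x\<bar>"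
    "\<And>S k. S \<in> cells T \<union> edges T \<Longrightarrow> Hi S k = coord k x \<or> g \<le> \<bar>Hi S k - coord k x\<bar>"
    and d: "0 < d" "d < g" and s: "\<sigma> \<in> cells T" "y \<in> \<sigma>"
    and y: "\<And>k. coord k y = coord k x + (if e k then d else - d)"
  shows "occ e x \<sigma>"
proof -
  have "if e k then Lo \<sigma> k \<le> coord k x \<and> coord k x < Hi \<sigma> k else Lo \<sigma> k < coord k x \<and> coord k x \<le> Hi \<sigma> k" for k
  proof -
    have "Lo \<sigma> k \<le> coord k y" "coord k y \<le> Hi \<sigma> k" using s cellD(2)[OF s(1)] by auto
    then show ?thesis
      using g(1)[of \<sigma> k] g(2)[of \<sigma> k] d s(1) y[of k] by (auto split: if_splits)
  qed
  then show ?thesis using s(1) by (simp add: occ_def)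
qed

lemma occ_interior:
  assumes "x \<in> interior Om"
  obtains \<sigma> where "occ e x \<sigma>"
proof -
  obtain g where g: "0 < g"
    "\<And>S k. S \<in> cells T \<union> edges T \<Longrightarrow> Lo S k = coord k x \<or> g \<le> \<bar>Lo S k - coord k x\<bar>"
    "\<And>S k. S \<in> cells T \<union> edges T \<Longrightarrow> Hi S k = coord k x \<or> g \<le> \<bar>Hi S k - coord k x\<bar>"
    using gap[of x] by blast
  obtain r where r: "0 < r" "cball x r \<subseteq> Om"
    using assms mem_interior_cball by blast
  \<comment> \<open>Below the gap, and small enough that the displacements in both coordinates
    together stay within \<open>r\<close>.\<close>
  define d where "d = min (g / 2) (r / 2)"
  have d: "0 < d" "d < g" "2 * d \<le> r" using g(1) r(1) by (auto simp: d_def)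
  define y where "y k = (if e k then coord k x + d else coord k x - d)" for k
  let ?p = "pt True (y True) (y False)"
  have p: "coord k ?p = y k" for k by (cases k) (auto simp: coord_def pt_def)
  have "dist x ?p \<le> dist (fst x) (fst ?p) + dist (snd x) (snd ?p)"
    unfolding dist_prod_def by (rule sqrt_sum_squares_le_sum) auto
  also have "\<dots> = 2 * d"
    using d p[of True] p[of False] by (auto simp: dist_real_def y_def coord_def)
  finally have "?p \<in> Om" using r(2) d(3) by auto
  then obtain \<sigma> where s: "\<sigma> \<in> cells T" "?p \<in> \<sigma>" by (auto simp: mesh_domain_def)
  have py: "coord k ?p = coord k x + (if e k then d else - d)" for k by (rule trans[OF p]) (simp add: y_def)
  have "occ e x \<sigma>" by (rule occ_from_near[OF g(2,3) d(1,2) s py])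
  then show ?thesis using that by blast
qed

lemma occ_near:
  assumes "\<And>e. occ e x (c e)"
  obtains d where "0 < d"
    "\<And>e y. (\<And>k. \<bar>coord k y - coord k x\<bar> < d \<and> (e k \<longrightarrow> coord k x \<le> coord k y) \<and> (\<not> e k \<longrightarrow> coord k y \<le> coord k x)) \<Longrightarrow> y \<in> c e"
proof -
  define D where "D = (\<lambda>(e, k). if e k then Hi (c e) k - coord k x else coord k x - Lo (c e) k) ` UNIV"
  have fin: "finite D" by (simp add: D_def)
  have pos: "0 < (if e k then Hi (c e) k - coord k x else coord k x - Lo (c e) k)" for e k
    using assms[of e] unfolding occ_def by (auto dest!: spec[of _ k])
  have "Min D \<in> D" by (rule Min_in[OF fin]) (simp add: D_def)
  then have "0 < Min D" using pos by (auto simp: D_def)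
  moreover have "y \<in> c e"
    if y: "\<And>k. \<bar>coord k y - coord k x\<bar> < Min D \<and> (e k \<longrightarrow> coord k x \<le> coord k y) \<and> (\<not> e k \<longrightarrow> coord k y \<le> coord k x)" for e y
  proof -
    have "Lo (c e) k \<le> coord k y \<and> coord k y \<le> Hi (c e) k" for k
    proof -
      have "(if e k then Hi (c e) k - coord k x else coord k x - Lo (c e) k) \<in> D"
        unfolding D_def by (rule image_eqI[of _ _ "(e, k)"]) auto
      then have "Min D \<le> (if e k then Hi (c e) k - coord k x else coord k x - Lo (c e) k)"
        using fin by (rule Min_le[rotated])
      moreover have "if e k then Lo (c e) k \<le> coord k x else coord k x \<le> Hi (c e) k"
        using assms[of e] unfolding occ_def by (auto dest!: spec[of _ k])
      ultimately show ?thesis using y[of k] by (cases "e k") auto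
    qed
    then show ?thesis using cellD(2)[OF occ_cell[OF assms]] by simp
  qed
  ultimately show ?thesis using that by blast
qed

lemma occ_imp_interior:
  assumes "\<And>e. \<exists>\<sigma>. occ e x \<sigma>"
  shows "x \<in> interior Om"
proof -
  obtain c where c: "\<And>e. occ e x (c e)" using assms by metis
  obtain d where d: "0 < d"
    "\<And>e y. (\<And>k. \<bar>coord k y - coord k x\<bar> < d \<and> (e k \<longrightarrow> coord k x \<le> coord k y) \<and> (\<not> e k \<longrightarrow> coord k y \<le> coord k x)) \<Longrightarrow> y \<in> c e"
    using occ_near[of x c, OF c] by blast
  have "ball x d \<subseteq> Om"
  proof
    fix y assume y: "y \<in> ball x d"
    have "\<bar>coord k y - coord k x\<bar> < d" for k
      using y dist_fst_le[of x y] dist_snd_le[of x y] by (auto simp: coord_def dist_real_def)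
    then have "y \<in> c (\<lambda>k. coord k x \<le> coord k y)" by (intro d(2)) auto
    then show "y \<in> Om" using occ_cell[OF c] by (auto simp: mesh_domain_def)
  qed
  then show ?thesis using d(1) by (meson mem_interior)
qed

end

section \<open>Edges between adjacent quadrants\<close>

context mesh
begin

text \<open>\<open>ext k b x \<tau>\<close>: the edge \<open>\<tau>\<close> of axis \<open>k\<close> passes through \<open>x\<close> and continues from \<open>x\<close> in the
  direction in which \<open>coord (\<not> k)\<close> increases (if \<open>b\<close>) or decreases.\<close>

definition ext :: "bool \<Rightarrow> bool \<Rightarrow> point \<Rightarrow> point set \<Rightarrow> bool" where
  "ext k b x \<tau> \<longleftrightarrow> Lo \<tau> k = coord k x \<and>
     (if b then Lo \<tau> (\<not> k) \<le> coord (\<not> k) x \<and> coord (\<not> k) x < Hi \<tau> (\<not> k)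
      else Lo \<tau> (\<not> k) < coord (\<not> k) x \<and> coord (\<not> k) x \<le> Hi \<tau> (\<not> k))"

definition side :: "bool \<Rightarrow> bool \<Rightarrow> point set \<Rightarrow> point set \<Rightarrow> bool" where
  "side k b \<tau> \<sigma> \<longleftrightarrow> \<sigma> \<in> cells T \<and> \<tau> \<subseteq> \<sigma> \<and> (if b then Lo \<sigma> k else Hi \<sigma> k) = Lo \<tau> k"

lemma occD:
  assumes "occ e x \<sigma>"
  shows "\<sigma> \<in> cells T" "e k \<Longrightarrow> Lo \<sigma> k \<le> coord k x" "e k \<Longrightarrow> coord k x < Hi \<sigma> k"
    "\<not> e k \<Longrightarrow> Lo \<sigma> k < coord k x" "\<not> e k \<Longrightarrow> coord k x \<le> Hi \<sigma> k"
  using assms by (auto simp: occ_def dest!: spec[of _ k])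

lemma occ_choice:
  assumes "x \<in> interior Om"
  obtains q where "\<forall>e. occ e x (q e)"
proof -
  have "\<forall>e. \<exists>\<sigma>. occ e x \<sigma>" using occ_interior[OF assms] by blast
  then show ?thesis using that by (auto dest!: choice)
qed

lemma frontier_cell:
  assumes "\<sigma> \<in> cells T"
  shows "frontier \<sigma> = \<sigma> - interior \<sigma>"
  using cellD(4)[OF assms] by (simp add: frontier_def)

text \<open>The point \<open>p\<close> lies on the ray between the two quadrants, at half the gap
  from \<open>x\<close>, and on the frontier of \<open>\<sigma>\<close>; so some edge contains it.
  The gap forces this edge to run along the ray and to reach back to \<open>x\<close>.\<close>

lemma adjacent_cells_edge:
  assumes e: "occ e x \<sigma>" and e': "occ (e(k := \<not> e k)) x \<sigma>'" and ne: "\<sigma> \<noteq> \<sigma>'"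
  obtains \<tau> where "\<tau> \<in> edges T" "is_edge k \<tau>" "ext k (e (\<not> k)) x \<tau>"
proof -
  let ?n = "\<not> k"
  \<comment> \<open>Otherwise \<open>\<sigma>\<close> would extend across the line into the
    neighbouring quadrant and coincide with \<open>\<sigma>'\<close>.\<close>
  have bdry: "(if e k then Lo \<sigma> k else Hi \<sigma> k) = coord k x"
  proof (rule ccontr)
    assume *: "\<not> ?thesis"
    have "occ (e(k := \<not> e k)) x \<sigma>"
      using * occD(2-5)[OF e] occD(1)[OF e] cellD(1)[of \<sigma>] unfolding occ_def all_axis[of _ k]
      by (cases "e k"; cases "e ?n") (auto simp: order_less_le dest: less_imp_le)
    then show False using occ_unique[OF _ e'] ne by blast
  qed
  obtain g where g: "0 < g"
    "\<And>S k. S \<in> cells T \<union> edges T \<Longrightarrow> Lo S k = coord k x \<or> g \<le> \<bar>Lo S k - coord k x\<bar>"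
    "\<And>S k. S \<in> cells T \<union> edges T \<Longrightarrow> Hi S k = coord k x \<or> g \<le> \<bar>Hi S k - coord k x\<bar>"
    using gap[of x] by blast
  define y where "y = (if e ?n then coord ?n x + g / 2 else coord ?n x - g / 2)"
  define p where "p = pt k (coord k x) y"
  have cop: "coord k p = coord k x" "coord ?n p = y" by (auto simp: p_def)
  have s: "\<sigma> \<in> cells T" by (rule occD(1)[OF e])
  have "Lo \<sigma> ?n \<le> y \<and> y \<le> Hi \<sigma> ?n"
    using occD(2-5)[OF e, of ?n] g(1) g(2)[of \<sigma> ?n] g(3)[of \<sigma> ?n] s
    by (cases "e ?n") (auto simp: y_def)
  moreover have "Lo \<sigma> k \<le> coord k x \<and> coord k x \<le> Hi \<sigma> k"
    using occ_mem[OF e] cellD(2)[OF s] by blast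
  ultimately have "p \<in> \<sigma>" using cellD(2)[OF s] by (simp add: all_axis[of _ k] cop)
  moreover have "p \<notin> interior \<sigma>"
  proof
    assume "p \<in> interior \<sigma>"
    then have "Lo \<sigma> k < coord k p \<and> coord k p < Hi \<sigma> k" using cellD(3)[OF s] by blast
    then show False using bdry cop(1) by (auto split: if_splits)
  qed
  ultimately have "p \<in> frontier \<sigma>" using frontier_cell[OF s] by blast
  then obtain \<tau> where t: "\<tau> \<in> edges T" "p \<in> \<tau>" by (rule frontier_edge[OF s])
  obtain j where j: "is_edge j \<tau>" using edge_cases[OF t(1)] .
  have "j = k"
  proof (rule ccontr)
    assume "j \<noteq> k"
    then have "Lo \<tau> ?n = y" using edge_bounds(3)[OF j] t(2) cop by (cases k; cases j) auto
    then show False using g(1) g(2)[of \<tau> ?n] t(1) by (auto simp: y_def split: if_splits)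
  qed
  then have "is_edge k \<tau>" using j by simp
  moreover have "ext k (e ?n) x \<tau>"
    using edge_bounds(3)[OF \<open>is_edge k \<tau>\<close>, of p] t cop g(1) g(2)[of \<tau> ?n] g(3)[of \<tau> ?n]
    by (cases "e ?n") (auto simp: ext_def y_def)
  ultimately show ?thesis using that t(1) by blast
qed

text \<open>An edge never overhangs the cell beside it: at \<open>p\<close>, just past
  \<open>x\<close> on the edge, the frontier of the cell is covered by an edge, which must be
  \<open>\<tau>\<close> because distinct edges meet only at end points. Hence all of
  \<open>\<tau>\<close> lies in the cell.\<close>

lemma ext_occ_side:
  assumes t: "\<tau> \<in> edges T" "is_edge k \<tau>" "ext k (e (\<not> k)) x \<tau>" and e: "occ e x \<sigma>"
  shows "side k (e k) \<tau> \<sigma>"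
proof -
  let ?n = "\<not> k"
  obtain g where g: "0 < g"
    "\<And>S k. S \<in> cells T \<union> edges T \<Longrightarrow> Lo S k = coord k x \<or> g \<le> \<bar>Lo S k - coord k x\<bar>"
    "\<And>S k. S \<in> cells T \<union> edges T \<Longrightarrow> Hi S k = coord k x \<or> g \<le> \<bar>Hi S k - coord k x\<bar>"
    using gap[of x] by blast
  define y where "y = (if e ?n then coord ?n x + g / 2 else coord ?n x - g / 2)"
  define p where "p = pt k (coord k x) y"
  have cop: "coord k p = coord k x" "coord ?n p = y" by (auto simp: p_def)
  have s: "\<sigma> \<in> cells T" by (rule occD(1)[OF e])
  have ys: "Lo \<sigma> ?n < y \<and> y < Hi \<sigma> ?n"
    using occD(2-5)[OF e, of ?n] g(1) g(2)[of \<sigma> ?n] g(3)[of \<sigma> ?n] s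
    by (cases "e ?n") (auto simp: y_def)
  have yt: "Lo \<tau> ?n < y \<and> y < Hi \<tau> ?n"
    using t(3) g(1) g(2)[of \<tau> ?n] g(3)[of \<tau> ?n] t(1)
    by (cases "e ?n") (auto simp: y_def ext_def)
  have Lok: "Lo \<tau> k = coord k x" using t(3) by (simp add: ext_def)
  have pt: "p \<in> \<tau>" using edge_bounds(3)[OF t(2), of p] yt Lok cop by auto
  then have pni: "p \<notin> interior \<sigma>" by (rule edge_not_interior[OF t(1) _ s])
  have sk: "Lo \<sigma> k \<le> coord k x \<and> coord k x \<le> Hi \<sigma> k"
    using occ_mem[OF e] cellD(2)[OF s] by blast
  have "p \<in> \<sigma>" using cellD(2)[OF s] ys sk by (auto simp: all_axis[of _ k] cop)
  then have pf: "p \<in> frontier \<sigma>" using pni frontier_cell[OF s] by blast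
  have "\<not> (Lo \<sigma> k < coord k x \<and> coord k x < Hi \<sigma> k)"
    using pni cellD(3)[OF s] ys by (auto simp: all_axis[of _ k] cop)
  then have bdry: "(if e k then Lo \<sigma> k else Hi \<sigma> k) = Lo \<tau> k"
    using occD(2-5)[OF e, of k] sk Lok by (auto split: if_splits)
  obtain \<tau>' where t': "\<tau>' \<in> edges T" "p \<in> \<tau>'" "\<tau>' \<subseteq> frontier \<sigma>" by (rule frontier_edge[OF s pf])
  have "\<tau>' = \<tau>"
  proof (rule ccontr)
    assume "\<tau>' \<noteq> \<tau>"
    then have "p = lo \<tau> \<or> p = hi \<tau>" using edges_meet[OF t(1) t'(1)] pt t'(2) by blast
    then have "coord ?n p = Lo \<tau> ?n \<or> coord ?n p = Hi \<tau> ?n" by auto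
    then show False using yt cop by auto
  qed
  then have "\<tau> \<subseteq> \<sigma>" using t'(3) frontier_cell[OF s] by blast
  then show ?thesis using s bdry by (simp add: side_def)
qed

lemma side_occ:
  assumes t: "is_edge k \<tau>" "ext k (e (\<not> k)) x \<tau>" and s: "side k (e k) \<tau> \<sigma>"
  shows "occ e x \<sigma>"
proof -
  let ?n = "\<not> k"
  have c: "\<sigma> \<in> cells T" using s by (simp add: side_def)
  have "lo \<tau> \<in> \<tau>" "hi \<tau> \<in> \<tau>" using edge_bounds(1-3)[OF t(1)] by auto
  then have "lo \<tau> \<in> \<sigma>" "hi \<tau> \<in> \<sigma>" using s by (auto simp: side_def)
  then have "Lo \<sigma> ?n \<le> Lo \<tau> ?n" "Hi \<tau> ?n \<le> Hi \<sigma> ?n" using cellD(2)[OF c] by auto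
  then show ?thesis
    using t(2) s c cellD(1)[OF c, of k] unfolding occ_def all_axis[of _ k] ext_def side_def
    by (auto split: if_splits)
qed

definition mid :: "bool \<Rightarrow> point set \<Rightarrow> point" where
  "mid k \<tau> = pt k (Lo \<tau> k) ((Lo \<tau> (\<not> k) + Hi \<tau> (\<not> k)) / 2)"

lemma ext_mid: "is_edge k \<tau> \<Longrightarrow> ext k b (mid k \<tau>) \<tau>" and mid_mem: "is_edge k \<tau> \<Longrightarrow> mid k \<tau> \<in> \<tau>"
  using edge_bounds[of k \<tau>] by (auto simp: ext_def mid_def)

lemma ext_lo: "is_edge k \<tau> \<Longrightarrow> ext k True (lo \<tau>) \<tau>" and ext_hi: "is_edge k \<tau> \<Longrightarrow> ext k False (hi \<tau>) \<tau>"
  using edge_bounds[of k \<tau>] by (auto simp: ext_def)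

lemma ext_mem: "is_edge k \<tau> \<Longrightarrow> ext k b x \<tau> \<Longrightarrow> x \<in> \<tau>"
  using edge_bounds(3)[of k \<tau> x] by (auto simp: ext_def split: if_splits)

text \<open>Both cells occupy the same quadrant at the midpoint of the edge.\<close>

lemma side_unique:
  assumes "is_edge k \<tau>" "side k b \<tau> \<sigma>" "side k b \<tau> \<sigma>'"
  shows "\<sigma> = \<sigma>'"
  using occ_unique[of "\<lambda>_. b" "mid k \<tau>"] side_occ[of k \<tau> "\<lambda>_. b" "mid k \<tau>"] ext_mid assms by blast

lemma side_exists:
  assumes t: "\<tau> \<in> interior_edges T" "is_edge k \<tau>"
  obtains \<sigma> where "side k b \<tau> \<sigma>"
proof -
  obtain p where p: "p \<in> \<tau>" "p \<in> interior Om" and te: "\<tau> \<in> edges T"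
    using t(1) by (auto simp: interior_edges_def)
  \<comment> \<open>A direction in which the edge continues from \<open>p\<close>, which may be its
    upper end.\<close>
  define c where "c = (coord (\<not> k) p < Hi \<tau> (\<not> k))"
  define e where "e j = (if j = k then b else c)" for j
  have "ext k c p \<tau>"
    using p(1) edge_bounds(1-3)[OF t(2)] by (auto simp: ext_def c_def)
  then have "ext k (e (\<not> k)) p \<tau>" by (simp add: e_def)
  moreover obtain \<sigma> where "occ e p \<sigma>" using occ_interior[OF p(2)] .
  ultimately have "side k (e k) \<tau> \<sigma>" using ext_occ_side[OF te t(2)] by blast
  then show ?thesis using that by (simp add: e_def)
qed

text \<open>Away from its end points the edge continues both ways, so the cells on its two sides
  fill all four quadrants.\<close>

lemma relint_interior:
  assumes t: "is_edge k \<tau>" and s: "side k True \<tau> \<sigma>" "side k False \<tau> \<sigma>'"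
    and x: "\<And>b. ext k b x \<tau>"
  shows "x \<in> interior Om"
proof (rule occ_imp_interior)
  fix e
  have "\<exists>\<sigma>. side k (e k) \<tau> \<sigma>" using s by (cases "e k") auto
  then show "\<exists>\<sigma>. occ e x \<sigma>" using side_occ[OF t x] by blast
qed

lemma two_sides_interior_edge:
  assumes t: "\<tau> \<in> edges T" "is_edge k \<tau>" and s: "side k True \<tau> \<sigma>" "side k False \<tau> \<sigma>'"
  shows "\<tau> \<in> interior_edges T"
  using relint_interior[OF t(2) s ext_mid[OF t(2)]] mid_mem[OF t(2)] t(1)
  by (auto simp: interior_edges_def)

lemma interior_edge_relint:
  assumes t: "\<tau> \<in> interior_edges T" "is_edge k \<tau>" and x: "\<And>b. ext k b x \<tau>"
  shows "x \<in> interior Om"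
  using side_exists[OF t, of True] side_exists[OF t, of False] relint_interior[OF t(2) _ _ x] by metis

lemma adjacent_cells_interior_edge:
  assumes e: "occ e x \<sigma>" and e': "occ (e(k := \<not> e k)) x \<sigma>'" and ne: "\<sigma> \<noteq> \<sigma>'"
  obtains \<tau> where "\<tau> \<in> interior_edges T" "is_edge k \<tau>" "ext k (e (\<not> k)) x \<tau>"
    "side k (e k) \<tau> \<sigma>" "side k (\<not> e k) \<tau> \<sigma>'"
proof -
  obtain \<tau> where t: "\<tau> \<in> edges T" "is_edge k \<tau>" "ext k (e (\<not> k)) x \<tau>"
    by (rule adjacent_cells_edge[OF assms])
  have 1: "side k (e k) \<tau> \<sigma>" by (rule ext_occ_side[OF t e])
  have 2: "side k (\<not> e k) \<tau> \<sigma>'"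
    using ext_occ_side[OF t(1,2) _ e'] t(3) by simp
  have "\<tau> \<in> interior_edges T"
    using two_sides_interior_edge[OF t(1,2)] 1 2 by (cases "e k") auto
  then show ?thesis using that t 1 2 by blast
qed

section \<open>Jumps and boundaries at the vertices\<close>

lemma vertex_iff: "x \<in> vertices T \<longleftrightarrow> (\<exists>\<tau>\<in>edges T. x = lo \<tau> \<or> x = hi \<tau>)"
proof -
  have "rel_frontier \<tau> = {lo \<tau>, hi \<tau>}" if "\<tau> \<in> edges T" for \<tau>
    using edge_cases[OF that] edge_bounds(4) by metis
  then show ?thesis by (auto simp: vertices_def)
qed

text \<open>A vertex on an edge is one of its end points, so an edge that continues from a vertex
  begins there.\<close>

lemma vertex_ext:
  assumes v: "x \<in> vertices T" and t: "\<tau> \<in> edges T" "is_edge k \<tau>" "ext k b x \<tau>"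
  shows "x = (if b then lo \<tau> else hi \<tau>)"
proof -
  obtain \<tau>' where t': "\<tau>' \<in> edges T" "x = lo \<tau>' \<or> x = hi \<tau>'" using v vertex_iff by blast
  obtain j where j: "is_edge j \<tau>'" using edge_cases[OF t'(1)] .
  have "x \<in> \<tau>'" using t'(2) edge_bounds(1-3)[OF j] by auto
  then have "x = lo \<tau> \<or> x = hi \<tau>"
    using edges_meet[OF t(1) t'(1) _ ext_mem[OF t(2,3)]] t'(2) by blast
  then show ?thesis using t(3) by (auto simp: ext_def split: if_splits)
qed

lemma ext_unique:
  assumes t: "\<tau> \<in> edges T" "is_edge k \<tau>" "ext k b x \<tau>"
    and t': "\<tau>' \<in> edges T" "is_edge k \<tau>'" "ext k b x \<tau>'"
  shows "\<tau> = \<tau>'"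
proof (rule ccontr)
  assume ne: "\<tau> \<noteq> \<tau>'"
  let ?n = "\<not> k"
  define y where "y = (if b then (coord ?n x + min (Hi \<tau> ?n) (Hi \<tau>' ?n)) / 2
                       else (coord ?n x + max (Lo \<tau> ?n) (Lo \<tau>' ?n)) / 2)"
  define p where "p = pt k (coord k x) y"
  have cop: "coord k p = coord k x" "coord ?n p = y" by (auto simp: p_def)
  have y: "Lo \<tau> ?n < y \<and> y < Hi \<tau> ?n \<and> Lo \<tau>' ?n < y \<and> y < Hi \<tau>' ?n"
    using t(3) t'(3) by (cases b) (auto simp: ext_def y_def min_def max_def)
  have "p \<in> \<tau>" "p \<in> \<tau>'"
    using y t(3) t'(3) edge_bounds(3)[OF t(2), of p] edge_bounds(3)[OF t'(2), of p] by (auto simp: cop ext_def)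
  then have "p = lo \<tau> \<or> p = hi \<tau>" using edges_meet[OF t(1) t'(1) ne] by blast
  then have "coord ?n p = Lo \<tau> ?n \<or> coord ?n p = Hi \<tau> ?n" by auto
  then show False using y cop by auto
qed

text \<open>The axis is determined by the edge; hiding it here lets \<open>jump\<close> name the two
  cells of an edge directly.\<close>

definition cell_of :: "bool \<Rightarrow> point set \<Rightarrow> point set" where
  "cell_of b \<tau> = (SOME \<sigma>. \<exists>k. is_edge k \<tau> \<and> side k b \<tau> \<sigma>)"

lemma cell_of_eq:
  assumes "is_edge k \<tau>" "side k b \<tau> \<sigma>"
  shows "cell_of b \<tau> = \<sigma>"
proof -
  have "\<exists>j. is_edge j \<tau> \<and> side j b \<tau> (cell_of b \<tau>)"
    unfolding cell_of_def by (rule someI[of _ \<sigma>]) (use assms in blast)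
  then show ?thesis using is_edge_unique[OF assms(1)] side_unique[OF assms(1) _ assms(2)] by auto
qed

lemma side_cell_of:
  assumes "\<tau> \<in> interior_edges T" "is_edge k \<tau>"
  shows "side k b \<tau> (cell_of b \<tau>)"
  using side_exists[OF assms, of b] cell_of_eq[OF assms(2)] by metis

text \<open>The value to the left of \<open>\<tau>\<close> minus the value to the right, for the orientation from \<open>lo \<tau>\<close>
  to \<open>hi \<tau>\<close>.\<close>

definition jump :: "(point set \<Rightarrow> 'g::ab_group_add) \<Rightarrow> point set \<Rightarrow> 'g" where
  "jump g \<tau> = (if \<tau> \<in> interior_edges T then
      if vertical \<tau> then g (cell_of False \<tau>) - g (cell_of True \<tau>)
      else g (cell_of True \<tau>) - g (cell_of False \<tau>) else 0)"

text \<open>Taken at all points and not only at interior vertices: its values at the other vertices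
  are residues of poles too.\<close>

definition bdry :: "(point set \<Rightarrow> 'g::ab_group_add) \<Rightarrow> point \<Rightarrow> 'g" where
  "bdry c x = (\<Sum>\<tau>\<in>interior_edges T. (if hi \<tau> = x then c \<tau> else 0) - (if lo \<tau> = x then c \<tau> else 0))"

lemma finite_interior_edges: "finite (interior_edges T)"
  using finite_edges by (simp add: interior_edges_def)

text \<open>At most one edge leaves \<open>x\<close> in the given direction, and its jump is the
  difference of the values in the two quadrants beside it. At a T-junction the edge may be missing;
  then these quadrants belong to one cell and the right-hand side is zero as well.\<close>

lemma jump_sum_at_vertex:
  assumes x: "x \<in> vertices T" and q: "\<And>e. occ e x (q e)" and e: "e (\<not> k) = b"
  shows "(\<Sum>\<tau>\<in>{\<tau> \<in> interior_edges T. is_edge k \<tau>}. if (if b then lo \<tau> else hi \<tau>) = x then jump g \<tau> else 0)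
    = (if k then g (q (e(k := False))) - g (q (e(k := True)))
       else g (q (e(k := True))) - g (q (e(k := False))))" (is "?l = ?r")
proof -
  let ?X = "{\<tau> \<in> interior_edges T. is_edge k \<tau> \<and> (if b then lo \<tau> else hi \<tau>) = x}"
  have ie: "\<tau> \<in> edges T" if "\<tau> \<in> interior_edges T" for \<tau>
    using that by (simp add: interior_edges_def)
  have ex: "ext k b x \<tau>" if "\<tau> \<in> ?X" for \<tau>
    using that ext_lo[of k \<tau>] ext_hi[of k \<tau>] by (auto split: if_splits)
  have val: "jump g \<tau> = ?r" if "\<tau> \<in> ?X" for \<tau>
  proof -
    have t: "\<tau> \<in> interior_edges T" "is_edge k \<tau>" using that by auto
    have "side k c \<tau> (q (e(k := c)))" for c
      using ext_occ_side[OF ie[OF t(1)] t(2) _ q[of "e(k := c)"]] ex[OF that] e by simp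
    then have "cell_of c \<tau> = q (e(k := c))" for c using cell_of_eq[OF t(2)] by blast
    moreover have "vertical \<tau> \<longleftrightarrow> k"
      using is_edge_unique[OF t(2), of True] by (auto simp: is_edge_def)
    ultimately show ?thesis using t(1) by (simp add: jump_def)
  qed
  have "?l = (\<Sum>\<tau>\<in>?X. jump g \<tau>)"
    using finite_interior_edges by (intro sum.mono_neutral_cong_right) auto
  also have "\<dots> = ?r"
  proof (cases "?X = {}")
    case True
    have "q (e(k := True)) = q (e(k := False))"
    proof (rule ccontr)
      assume ne: "q (e(k := True)) \<noteq> q (e(k := False))"
      have "occ ((e(k := True))(k := \<not> (e(k := True)) k)) x (q (e(k := False)))" using q by simp
      then obtain \<tau> where "\<tau> \<in> interior_edges T" "is_edge k \<tau>" "ext k ((e(k := True)) (\<not> k)) x \<tau>"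
        by (rule adjacent_cells_interior_edge[OF q _ ne])
      then have "\<tau> \<in> ?X" using vertex_ext[OF x ie] e by simp
      then show False using True by blast
    qed
    then show ?thesis unfolding True by (cases k) auto
  next
    case False
    then obtain \<tau> where t: "\<tau> \<in> ?X" by blast
    have "?X = {\<tau>}" using t ext_unique[OF ie _ ex ie _ ex] by blast
    then show ?thesis using val[OF t] by simp
  qed
  finally show ?thesis .
qed

lemma bdry_jump:
  assumes x: "x \<in> interior_vertices T"
  shows "bdry (jump g) x = 0"
proof -
  have xv: "x \<in> vertices T" and xi: "x \<in> interior Om" using x by (auto simp: interior_vertices_def)
  obtain q where "\<forall>e. occ e x (q e)" by (rule occ_choice[OF xi])
  then have q: "\<And>e. occ e x (q e)" by blast
  \<comment> \<open>The value in the quadrant with direction \<open>a\<close> in the first and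
    \<open>b\<close> in the second coordinate. The four sums below are the differences met on one
    turn around \<open>x\<close>, so they cancel.\<close>
  define r where "r a b = g (q (\<lambda>k. if k then a else b))" for a b
  let ?E = "\<lambda>k. {\<tau> \<in> interior_edges T. is_edge k \<tau>}"
  have upd: "(\<lambda>k. if k then a else b)(True := c) = (\<lambda>k. if k then c else b)"
    "(\<lambda>k. if k then a else b)(False := c) = (\<lambda>k. if k then a else c)" for a b c :: bool
    by (auto simp: fun_eq_iff)
  have v: "(\<Sum>\<tau>\<in>?E True. if (if b then lo \<tau> else hi \<tau>) = x then jump g \<tau> else 0) = r False b - r True b" for b
    using jump_sum_at_vertex[OF xv q, of "\<lambda>k. if k then True else b" True b g]
    unfolding upd r_def by simp
  have h: "(\<Sum>\<tau>\<in>?E False. if (if b then lo \<tau> else hi \<tau>) = x then jump g \<tau> else 0) = r b True - r b False" for b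
    using jump_sum_at_vertex[OF xv q, of "\<lambda>k. if k then b else True" False b g]
    unfolding upd r_def by simp
  have "\<tau> \<in> ?E True \<union> ?E False" if "\<tau> \<in> interior_edges T" for \<tau>
  proof -
    have "\<tau> \<in> edges T" using that by (simp add: interior_edges_def)
    then obtain k where "is_edge k \<tau>" by (rule edge_cases)
    then show ?thesis using that by (cases k) auto
  qed
  then have un: "interior_edges T = ?E True \<union> ?E False" by auto
  have "(\<Sum>\<tau>\<in>interior_edges T. f \<tau>) = (\<Sum>\<tau>\<in>?E True. f \<tau>) + (\<Sum>\<tau>\<in>?E False. f \<tau>)" for f :: "point set \<Rightarrow> 'a"
    using finite_interior_edges is_edge_unique by (subst un, intro sum.union_disjoint) auto
  then show ?thesis
    unfolding bdry_def sum_subtractf using v[of True] v[of False] h[of True] h[of False] by simp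
qed

text \<open>If neither edge existed, the cell in the upper right quadrant would also fill the two
  adjacent quadrants and have \<open>x\<close> in its interior, but no edge enters the interior of a
  cell.\<close>

lemma interior_vertex_forward_edge:
  assumes x: "x \<in> interior_vertices T"
  obtains \<tau> where "\<tau> \<in> interior_edges T" "lo \<tau> = x"
proof -
  have xv: "x \<in> vertices T" and xi: "x \<in> interior Om" using x by (auto simp: interior_vertices_def)
  obtain q where "\<forall>e. occ e x (q e)" by (rule occ_choice[OF xi])
  then have q: "\<And>e. occ e x (q e)" by blast
  let ?e = "\<lambda>_::bool. True"
  have "\<exists>k. q ?e \<noteq> q (?e(k := False))"
  proof (rule ccontr)
    assume "\<not> ?thesis"
    then have *: "q (?e(k := False)) = q ?e" for k by metis
    have "Lo (q ?e) k < coord k x \<and> coord k x < Hi (q ?e) k" for k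
      using occD(3)[OF q[of ?e], of k] occD(4)[OF q[of "?e(k := False)"], of k] * by simp
    then have "x \<in> interior (q ?e)" using cellD(3)[OF occ_cell[OF q]] by blast
    moreover obtain \<tau> where t: "\<tau> \<in> edges T" "x = lo \<tau> \<or> x = hi \<tau>" using xv vertex_iff by blast
    moreover obtain k where "is_edge k \<tau>" using edge_cases[OF t(1)] .
    then have "x \<in> \<tau>" using t(2) edge_bounds(1-3)[of k \<tau>] by auto
    ultimately show False using edge_not_interior occ_cell[OF q] by blast
  qed
  then obtain k where ne: "q ?e \<noteq> q (?e(k := False))" by blast
  have "occ (?e(k := \<not> ?e k)) x (q (?e(k := False)))" using q by simp
  then obtain \<tau> where t: "\<tau> \<in> interior_edges T" "is_edge k \<tau>" "ext k (?e (\<not> k)) x \<tau>"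
    by (rule adjacent_cells_interior_edge[OF q _ ne])
  then have "lo \<tau> = x" using vertex_ext[OF xv, of \<tau> k True] by (auto simp: interior_edges_def)
  then show ?thesis using that t(1) by blast
qed

end

section \<open>Consequences of simple connectedness\<close>

definition cpx :: "point \<Rightarrow> complex" where
  "cpx x = Complex (fst x) (snd x)"

lemma linear_cpx: "linear cpx"
  by (rule linearI) (auto simp: cpx_def complex_eq_iff)

lemma bij_cpx: "bij cpx"
proof (rule bijI)
  show "inj cpx" by (rule injI) (auto simp: cpx_def prod_eq_iff)
  show "surj cpx"
  proof (rule surjI)
    show "cpx (Re z, Im z) = z" for z by (simp add: cpx_def)
  qed
qed

lemmas interior_cpx = interior_bijective_linear_image[OF linear_cpx bij_cpx]

lemma cpx_inject [simp]: "cpx x = cpx y \<longleftrightarrow> x = y"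
  using bij_cpx by (simp add: bij_def inj_eq)

lemma mem_cpx_image [simp]: "cpx x \<in> cpx ` S \<longleftrightarrow> x \<in> S"
  by auto

lemma continuous_on_cpx [continuous_intros]: "continuous_on S cpx"
  using linear_continuous_on[of cpx S] linear_cpx by (simp add: linear_linear)

lemma isCont_cpx: "isCont cpx x"
  using linear_continuous_at[of cpx x] linear_cpx by (simp add: linear_linear)

lemma homeomorphic_cpx: "S homeomorphic cpx ` S"
  unfolding homeomorphic_minimal
proof (intro exI[of _ cpx] exI[of _ "\<lambda>z. (Re z, Im z)"] conjI)
  show "continuous_on (cpx ` S) (\<lambda>z. (Re z, Im z))" by (intro continuous_intros)
  show "continuous_on S cpx" by (rule continuous_on_cpx)
qed (auto simp: cpx_def)

text \<open>A point of the frontier is a limit of points outside the set, near which the winding number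
  of a loop in the interior is constant.\<close>

lemma simply_connected_interior:
  fixes S :: "complex set"
  assumes "simply_connected S" "connected (interior S)"
  shows "simply_connected (interior S)"
  unfolding simply_connected_eq_winding_number_zero[OF open_interior]
proof (intro conjI allI impI)
  fix g z
  assume *: "path g \<and> path_image g \<subseteq> interior S \<and> pathfinish g = pathstart g \<and> z \<notin> interior S"
  then have g: "path g" "path_image g \<subseteq> interior S" "pathfinish g = pathstart g" by auto
  have "open (- path_image g)" using closed_path_image[OF g(1)] by (simp add: open_Compl)
  moreover have "z \<in> - path_image g" using * by auto
  ultimately obtain e where e: "0 < e" "ball z e \<subseteq> - path_image g" by (meson openE)
  have "\<not> ball z e \<subseteq> S" using * e(1) by (auto simp: mem_interior)
  then obtain w where w: "w \<in> ball z e" "w \<notin> S" by blast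
  have "winding_number g w = 0"
    using w(2) g interior_subset[of S] by (intro simply_connected_imp_winding_number_zero[OF assms(1)]) auto
  moreover have "winding_number g constant_on ball z e"
    using e(2) by (intro winding_number_constant[OF g(1,3)]) auto
  ultimately show "winding_number g z = 0"
    using w(1) e(1) by (metis constant_on_def centre_in_ball)
qed (rule assms)

text \<open>Places the branch cut of \<open>Ln ((z - q) / (z - p))\<close> on the segment. A
  quotient \<open>r \<le> 0\<close> gives \<open>(1 - r) * z = q - r * p\<close>, the point with
  parameter \<open>1 / (1 - r)\<close>; at \<open>z = p\<close> the quotient is 0 by convention, and
  \<open>p\<close> is an end point.\<close>

lemma quotient_nonpos_Reals:
  fixes z :: complex
  assumes "(z - q) / (z - p) \<in> \<real>\<^sub>\<le>\<^sub>0"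
  shows "z \<in> closed_segment p q"
proof (cases "z = p")
  case False
  obtain r where r: "r \<le> 0" "(z - q) / (z - p) = of_real r"
    using assms by (auto elim: nonpos_Reals_cases)
  define u where "u = 1 / (1 - r)"
  have u: "0 \<le> u" "u \<le> 1" using r(1) by (auto simp: u_def)
  have "z - p \<noteq> 0" using False by simp
  then have "z - q = of_real r * (z - p)" using r(2) by (rule iffD1[OF nonzero_divide_eq_eq])
  then have "of_real (1 - r) * z = q - of_real r * p" by (simp add: algebra_simps)
  moreover have U: "of_real u * of_real (1 - r) = (1::complex)"
    using r(1) by (simp add: u_def flip: of_real_mult)
  ultimately have "z = of_real u * (q - of_real r * p)"
    by (metis mult.assoc mult_1)
  also have "\<dots> = of_real (1 - u) * p + of_real u * q"
  proof -
    have "of_real u * of_real r = of_real u - (1::complex)" using U by (simp add: algebra_simps)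
    then show ?thesis by (simp add: right_diff_distrib left_diff_distrib mult.assoc[symmetric])
  qed
  finally show ?thesis using u by (auto simp: closed_segment_def scaleR_conv_of_real)
qed auto

text \<open>The arguments are the quotients seen at distance \<open>d\<close> from the midpoint of a
  segment of half-length \<open>h\<close>, on its two sides. Each is minus a number tending to 1
  within an open half plane, so adding or subtracting \<open>\<i> * pi\<close> reduces the limit to
  \<open>Ln 1\<close>.\<close>

lemma tendsto_Ln_across:
  assumes h: "0 < h"
  shows "((\<lambda>d. Ln (- ((of_real h - \<i> * of_real d) / (of_real h + \<i> * of_real d)))) \<longlongrightarrow> \<i> * pi) (at_right 0)"
    and "((\<lambda>d. Ln (- ((of_real h + \<i> * of_real d) / (of_real h - \<i> * of_real d)))) \<longlongrightarrow> - \<i> * pi) (at_right 0)"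
proof -
  define v where "v d = (of_real h - \<i> * of_real d) / (of_real h + \<i> * of_real d)" for d :: real
  define w where "w d = (of_real h + \<i> * of_real d) / (of_real h - \<i> * of_real d)" for d :: real
  have ne: "of_real h + \<i> * of_real d \<noteq> 0" "of_real h - \<i> * of_real d \<noteq> 0" for d
    using h by (auto simp: complex_eq_iff)
  have Im: "Im (v d) < 0" "0 < Im (w d)" if "0 < d" for d
    using h that by (auto simp: v_def w_def Im_divide power2_eq_square field_simps add_pos_pos
        intro!: divide_neg_pos)
  have nz: "v d \<noteq> 0" "w d \<noteq> 0" for d using ne[of d] by (auto simp: v_def w_def)
  have lim: "((\<lambda>d. Ln (v d)) \<longlongrightarrow> Ln (v 0)) (at_right 0)" "((\<lambda>d. Ln (w d)) \<longlongrightarrow> Ln (w 0)) (at_right 0)"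
    unfolding v_def w_def using ne[of 0] h by (auto intro!: tendsto_eq_intros)
  have v0: "v 0 = 1" "w 0 = 1" using h by (auto simp: v_def w_def)
  have "eventually (\<lambda>d. Ln (v d) + \<i> * pi = Ln (- v d)) (at_right 0)"
    unfolding eventually_at_right_field
  proof (intro exI[of _ 1] conjI allI impI)
    show "Ln (v d) + \<i> * pi = Ln (- v d)" if "0 < d" for d
      using Ln_minus[OF nz(1)[of d]] Im(1)[OF that] by simp
  qed simp
  moreover have "((\<lambda>d. Ln (v d) + \<i> * pi) \<longlongrightarrow> \<i> * pi) (at_right 0)"
    using tendsto_add[OF lim(1) tendsto_const] v0 by simp
  ultimately show "((\<lambda>d. Ln (- ((of_real h - \<i> * of_real d) / (of_real h + \<i> * of_real d)))) \<longlongrightarrow> \<i> * pi) (at_right 0)"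
    using Lim_transform_eventually unfolding v_def by fast
  have "eventually (\<lambda>d. Ln (w d) - \<i> * pi = Ln (- w d)) (at_right 0)"
    unfolding eventually_at_right_field
  proof (intro exI[of _ 1] conjI allI impI)
    show "Ln (w d) - \<i> * pi = Ln (- w d)" if "0 < d" for d
      using Ln_minus[OF nz(2)[of d]] Im(2)[OF that] by simp
  qed simp
  moreover have "((\<lambda>d. Ln (w d) - \<i> * pi) \<longlongrightarrow> - \<i> * pi) (at_right 0)"
    using tendsto_diff[OF lim(2) tendsto_const] v0 by simp
  ultimately show "((\<lambda>d. Ln (- ((of_real h + \<i> * of_real d) / (of_real h - \<i> * of_real d)))) \<longlongrightarrow> - \<i> * pi) (at_right 0)"
    using Lim_transform_eventually unfolding w_def by fast
qed

lemma Ln_quotient_deriv: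
  fixes z :: complex
  assumes "z - q \<noteq> 0" "z - p \<noteq> 0" "(z - q) / (z - p) \<notin> \<real>\<^sub>\<le>\<^sub>0"
  shows "((\<lambda>z. Ln ((z - q) / (z - p))) has_field_derivative 1 / (z - q) - 1 / (z - p)) (at z)"
proof -
  have "((\<lambda>z. (z - q) / (z - p)) has_field_derivative (1 * (z - p) - (z - q) * 1) / ((z - p) * (z - p))) (at z)"
    using assms by (intro DERIV_divide) (auto intro!: derivative_eq_intros)
  from DERIV_chain2[OF has_field_derivative_Ln[OF assms(3)] this]
  have "((\<lambda>z. Ln ((z - q) / (z - p))) has_field_derivative
    inverse ((z - q) / (z - p)) * ((1 * (z - p) - (z - q) * 1) / ((z - p) * (z - p)))) (at z)" .
  moreover have "inverse (a / b) * ((1 * b - a * 1) / (b * b)) = 1 / a - 1 / b"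
    if "a \<noteq> 0" "b \<noteq> 0" for a b :: complex
    using that by (simp add: field_simps)
  ultimately show ?thesis using assms(1,2) by metis
qed

lemma edge_convex: "is_edge k \<tau> \<Longrightarrow> closed_segment (lo \<tau>) (hi \<tau>) \<subseteq> \<tau>"
proof -
  assume k: "is_edge k \<tau>"
  have "\<exists>a b. \<tau> = closed_segment a b" by (rule edge_closed_segment[OF k]) blast
  then have "convex \<tau>" by auto
  then show ?thesis using edge_bounds(1-3)[OF k] by (intro closed_segment_subset) auto
qed

lemma cpx_quotient_edge:
  assumes "is_edge k \<tau>" "(cpx x - cpx (hi \<tau>)) / (cpx x - cpx (lo \<tau>)) \<in> \<real>\<^sub>\<le>\<^sub>0"
  shows "x \<in> \<tau>"
proof -
  have "cpx x \<in> closed_segment (cpx (lo \<tau>)) (cpx (hi \<tau>))" by (rule quotient_nonpos_Reals[OF assms(2)])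
  then have "cpx x \<in> cpx ` closed_segment (lo \<tau>) (hi \<tau>)"
    using closed_segment_linear_image[OF linear_cpx] by auto
  then show ?thesis using edge_convex[OF assms(1)] by auto
qed

section \<open>A function on the cells from a sum of logarithms\<close>

context mesh
begin

definition edge_logs :: "(point set \<Rightarrow> real) \<Rightarrow> complex \<Rightarrow> complex" where
  "edge_logs c z = (\<Sum>\<tau>\<in>interior_edges T. of_real (c \<tau>) * Ln ((z - cpx (hi \<tau>)) / (z - cpx (lo \<tau>))))"

definition edge_poles :: "(point set \<Rightarrow> real) \<Rightarrow> complex \<Rightarrow> complex" where
  "edge_poles c z = (\<Sum>\<tau>\<in>interior_edges T. of_real (c \<tau>) * (1 / (z - cpx (hi \<tau>)) - 1 / (z - cpx (lo \<tau>))))"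

lemma interior_edge_cases:
  assumes "\<tau> \<in> interior_edges T"
  obtains k where "is_edge k \<tau>" "\<tau> \<in> edges T" "lo \<tau> \<in> \<tau>" "hi \<tau> \<in> \<tau>" "lo \<tau> \<in> vertices T" "hi \<tau> \<in> vertices T"
proof -
  have t: "\<tau> \<in> edges T" using assms by (simp add: interior_edges_def)
  obtain k where k: "is_edge k \<tau>" by (rule edge_cases[OF t])
  show ?thesis using that[OF k t] edge_bounds(1-3)[OF k] vertex_iff t by auto
qed

lemma finite_vertices: "finite (vertices T)"
proof -
  have "vertices T \<subseteq> lo ` edges T \<union> hi ` edges T" using vertex_iff by auto
  then show ?thesis using finite_edges finite_subset by blast
qed

text \<open>Exchanging the two sums collects the poles by vertices and shows the residues.\<close>

lemma edge_poles_eq: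
  "edge_poles c z = (\<Sum>v\<in>vertices T. of_real (bdry c v) / (z - cpx v))"
proof -
  have "(\<Sum>v\<in>vertices T. of_real (bdry c v) / (z - cpx v)) =
    (\<Sum>v\<in>vertices T. \<Sum>\<tau>\<in>interior_edges T.
      (if hi \<tau> = v then of_real (c \<tau>) / (z - cpx (hi \<tau>)) else 0) - (if lo \<tau> = v then of_real (c \<tau>) / (z - cpx (lo \<tau>)) else 0))"
    unfolding bdry_def of_real_sum sum_divide_distrib
    by (intro sum.cong) (auto simp: diff_divide_distrib)
  also have "\<dots> = (\<Sum>\<tau>\<in>interior_edges T. \<Sum>v\<in>vertices T.
      (if hi \<tau> = v then of_real (c \<tau>) / (z - cpx (hi \<tau>)) else 0) - (if lo \<tau> = v then of_real (c \<tau>) / (z - cpx (lo \<tau>)) else 0))"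
    by (rule sum.swap)
  also have "\<dots> = edge_poles c z"
    unfolding edge_poles_def
  proof (intro sum.cong)
    fix \<tau> assume "\<tau> \<in> interior_edges T"
    then have "lo \<tau> \<in> vertices T" "hi \<tau> \<in> vertices T" by (auto elim: interior_edge_cases)
    then show "(\<Sum>v\<in>vertices T. (if hi \<tau> = v then of_real (c \<tau>) / (z - cpx (hi \<tau>)) else 0)
        - (if lo \<tau> = v then of_real (c \<tau>) / (z - cpx (lo \<tau>)) else 0))
      = of_real (c \<tau>) * (1 / (z - cpx (hi \<tau>)) - 1 / (z - cpx (lo \<tau>)))"
      by (simp add: sum_subtractf finite_vertices right_diff_distrib)
  qed simp
  finally show ?thesis by simp
qed

text \<open>The branch cuts lie on edges, and edges avoid the interiors of cells.\<close>

lemma edge_logs_deriv: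
  assumes s: "\<sigma> \<in> cells T" and x: "x \<in> interior \<sigma>"
  shows "(edge_logs c has_field_derivative edge_poles c (cpx x)) (at (cpx x))"
proof -
  have "((\<lambda>z. of_real (c \<tau>) * Ln ((z - cpx (hi \<tau>)) / (z - cpx (lo \<tau>)))) has_field_derivative
      of_real (c \<tau>) * (1 / (cpx x - cpx (hi \<tau>)) - 1 / (cpx x - cpx (lo \<tau>)))) (at (cpx x))"
    if t: "\<tau> \<in> interior_edges T" for \<tau>
  proof -
    obtain k where k: "is_edge k \<tau>" "\<tau> \<in> edges T" "lo \<tau> \<in> \<tau>" "hi \<tau> \<in> \<tau>" using t by (rule interior_edge_cases)
    have xn: "x \<notin> \<tau>" using edge_not_interior[OF k(2) _ s] x by blast
    then have ne: "cpx x - cpx (hi \<tau>) \<noteq> 0" "cpx x - cpx (lo \<tau>) \<noteq> 0" using k(3,4) by auto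
    have nr: "(cpx x - cpx (hi \<tau>)) / (cpx x - cpx (lo \<tau>)) \<notin> \<real>\<^sub>\<le>\<^sub>0"
      using cpx_quotient_edge[OF k(1)] xn by blast
    show ?thesis by (intro DERIV_cmult Ln_quotient_deriv ne nr)
  qed
  then show ?thesis unfolding edge_logs_def edge_poles_def by (intro DERIV_sum) auto
qed

lemma mid_off_edges:
  assumes "\<tau> \<in> edges T" "is_edge k \<tau>" "\<tau>' \<in> edges T" "\<tau>' \<noteq> \<tau>"
  shows "mid k \<tau> \<notin> \<tau>'"
proof
  assume "mid k \<tau> \<in> \<tau>'"
  then have "mid k \<tau> = lo \<tau> \<or> mid k \<tau> = hi \<tau>"
    using edges_meet[OF assms(1,3)] assms(4) mid_mem[OF assms(2)] by blast
  then have "coord (\<not> k) (mid k \<tau>) = Lo \<tau> (\<not> k) \<or> coord (\<not> k) (mid k \<tau>) = Hi \<tau> (\<not> k)" by auto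
  then show False using edge_bounds(1)[OF assms(2)] by (auto simp: mid_def)
qed

definition near_mid :: "bool \<Rightarrow> bool \<Rightarrow> point set \<Rightarrow> real \<Rightarrow> point" where
  "near_mid k b \<tau> d = pt k (Lo \<tau> k + (if b then d else - d)) ((Lo \<tau> (\<not> k) + Hi \<tau> (\<not> k)) / 2)"

lemma near_mid_tendsto: "((\<lambda>d. cpx (near_mid k b \<tau> d)) \<longlongrightarrow> cpx (mid k \<tau>)) (at_right 0)"
proof -
  have "((\<lambda>d. near_mid k b \<tau> d) \<longlongrightarrow> near_mid k b \<tau> 0) (at_right 0)"
    unfolding near_mid_def pt_def by (cases k; cases b; simp only: if_True if_False; intro tendsto_intros)
  then have "((\<lambda>d. cpx (near_mid k b \<tau> d)) \<longlongrightarrow> cpx (near_mid k b \<tau> 0)) (at_right 0)"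
    by (rule isCont_tendsto_compose[OF isCont_cpx])
  moreover have "near_mid k b \<tau> 0 = mid k \<tau>" by (simp add: near_mid_def mid_def)
  ultimately show ?thesis by (simp only:)
qed

lemma near_mid_interior:
  assumes k: "is_edge k \<tau>" and s: "side k b \<tau> \<sigma>"
  shows "eventually (\<lambda>d. near_mid k b \<tau> d \<in> interior \<sigma>) (at_right 0)"
proof -
  have c: "\<sigma> \<in> cells T" using s by (simp add: side_def)
  have "lo \<tau> \<in> \<tau>" "hi \<tau> \<in> \<tau>" using edge_bounds(1-3)[OF k] by auto
  then have "lo \<tau> \<in> \<sigma>" "hi \<tau> \<in> \<sigma>" using s by (auto simp: side_def)
  then have "Lo \<sigma> (\<not> k) \<le> Lo \<tau> (\<not> k)" "Hi \<tau> (\<not> k) \<le> Hi \<sigma> (\<not> k)" using cellD(2)[OF c] by auto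
  then have "near_mid k b \<tau> d \<in> interior \<sigma>" if "0 < d" "d < Hi \<sigma> k - Lo \<sigma> k" for d
    using that s edge_bounds(1)[OF k]
    unfolding cellD(3)[OF c] all_axis[of _ k] near_mid_def side_def by (cases b) auto
  then show ?thesis
    unfolding eventually_at_right_field using cellD(1)[OF c, of k] by (intro exI[of _ "Hi \<sigma> k - Lo \<sigma> k"]) auto
qed

text \<open>\<open>b = k\<close> describes the right-hand side of the edge directed from
  \<open>lo \<tau>\<close> to \<open>hi \<tau>\<close>: larger first coordinates for a vertical
  edge, smaller second coordinates for a horizontal one.\<close>

lemma Ln_near_mid:
  assumes k: "is_edge k \<tau>"
  shows "((\<lambda>d. Ln ((cpx (near_mid k b \<tau> d) - cpx (hi \<tau>)) / (cpx (near_mid k b \<tau> d) - cpx (lo \<tau>))))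
      \<longlongrightarrow> (if b = k then - \<i> * pi else \<i> * pi)) (at_right 0)"
proof -
  define h where "h = (Hi \<tau> (\<not> k) - Lo \<tau> (\<not> k)) / 2"
  have h: "0 < h" using edge_bounds(1)[OF k] by (simp add: h_def)
  have eq: "Hi \<tau> k = Lo \<tau> k" by (rule edge_bounds(2)[OF k])
  have m: "(Lo \<tau> (\<not> k) + Hi \<tau> (\<not> k)) / 2 = Lo \<tau> (\<not> k) + h" "Hi \<tau> (\<not> k) = Lo \<tau> (\<not> k) + 2 * h"
    by (simp_all add: h_def field_simps)
  have ne: "of_real h + \<i> * of_real d \<noteq> 0" "of_real h - \<i> * of_real d \<noteq> 0" for d
    using h by (auto simp: complex_eq_iff)
  have "(cpx (near_mid k b \<tau> d) - cpx (hi \<tau>)) / (cpx (near_mid k b \<tau> d) - cpx (lo \<tau>)) =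
    (if b = k then - ((of_real h + \<i> * of_real d) / (of_real h - \<i> * of_real d))
     else - ((of_real h - \<i> * of_real d) / (of_real h + \<i> * of_real d)))" for d
  proof -
    let ?w = "cpx (near_mid k b \<tau> d)"
    \<comment> \<open>\<open>u\<close> is the direction of the edge as a complex number and
      \<open>e\<close> the signed distance to its left; \<open>u\<close> cancels in the
      quotient.\<close>
    define u where "u = (if k then \<i> else (1::complex))"
    define e where "e = (if b = k then - d else d)"
    have w: "?w - cpx (hi \<tau>) = u * (- (of_real h - \<i> * of_real e))"
      "?w - cpx (lo \<tau>) = u * (of_real h + \<i> * of_real e)"
      using m eq unfolding near_mid_def cpx_def lo_def hi_def pt_def u_def e_def
      by (cases k; cases b; simp only: if_True if_False; simp add: complex_eq_iff)+
    have "u \<noteq> 0" by (simp add: u_def)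
    have "(?w - cpx (hi \<tau>)) / (?w - cpx (lo \<tau>)) =
        - ((of_real h - \<i> * of_real e) / (of_real h + \<i> * of_real e))"
      by (simp only: w mult_divide_mult_cancel_left[OF \<open>u \<noteq> 0\<close>] minus_divide_left)
    then show ?thesis by (cases "b = k") (auto simp: e_def)
  qed
  then show ?thesis using tendsto_Ln_across[OF h] by (cases "b = k") auto
qed

text \<open>The derivative of the sum of logarithms has poles only at vertices outside \<open>interior Om\<close>,
  since \<open>c\<close> has zero boundary at the others.\<close>

lemma jump_surj:
  assumes sc: "simply_connected Om" and con: "connected (interior Om)"
    and c: "\<And>x. x \<in> interior_vertices T \<Longrightarrow> bdry c x = (0::real)"
  obtains g where "\<And>\<tau>. \<tau> \<in> interior_edges T \<Longrightarrow> jump g \<tau> = c \<tau>"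
proof -
  let ?S = "cpx ` interior Om"
  have "simply_connected (cpx ` Om)"
    using homeomorphic_simply_connected[OF homeomorphic_cpx sc] .
  moreover have "connected ?S"
    using con by (intro connected_continuous_image continuous_on_cpx)
  ultimately have "simply_connected (interior (cpx ` Om))"
    by (intro simply_connected_interior) (simp_all add: interior_cpx)
  then have "simply_connected ?S" "open ?S" using open_interior[of "cpx ` Om"] by (simp_all add: interior_cpx)
  moreover have "edge_poles c holomorphic_on ?S"
  proof -
    have "edge_poles c z = (\<Sum>v\<in>vertices T - interior Om. of_real (bdry c v) / (z - cpx v))" for z
      unfolding edge_poles_eq using finite_vertices c
      by (intro sum.mono_neutral_right) (auto simp: interior_vertices_def)
    then have "edge_poles c = (\<lambda>z. \<Sum>v\<in>vertices T - interior Om. of_real (bdry c v) / (z - cpx v))" by blast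
    then show ?thesis by (auto intro!: holomorphic_intros)
  qed
  ultimately obtain H where H: "\<And>z. z \<in> ?S \<Longrightarrow> (H has_field_derivative edge_poles c z) (at z)"
    using simply_connected_eq_global_primitive[of ?S] by blast
  \<comment> \<open>On the convex interior of a cell both functions are primitives of
    \<open>edge_poles c\<close>, so they differ by a constant.\<close>
  have "\<exists>K. \<forall>x\<in>interior \<sigma>. edge_logs c (cpx x) - H (cpx x) = K" if s: "\<sigma> \<in> cells T" for \<sigma>
  proof -
    have sub: "interior \<sigma> \<subseteq> interior Om"
      using s by (intro interior_mono) (auto simp: mesh_domain_def)
    have "convex \<sigma>" using is_cell[OF s] by (auto simp: is_cell_def intro!: convex_Times)
    then have "convex (cpx ` interior \<sigma>)"
      by (intro convex_linear_image linear_cpx convex_interior)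
    moreover have "((\<lambda>z. edge_logs c z - H z) has_field_derivative 0) (at z within cpx ` interior \<sigma>)"
      if "z \<in> cpx ` interior \<sigma>" for z
    proof -
      from that obtain x where x: "z = cpx x" "x \<in> interior \<sigma>" by (rule imageE)
      have "((\<lambda>z. edge_logs c z - H z) has_field_derivative edge_poles c z - edge_poles c z) (at z)"
        unfolding x(1) using sub x(2) by (intro DERIV_diff edge_logs_deriv[OF s] H) auto
      then show ?thesis by (simp add: has_field_derivative_at_within)
    qed
    ultimately obtain K where "\<forall>z\<in>cpx ` interior \<sigma>. edge_logs c z - H z = K"
      using has_field_derivative_zero_constant[of "cpx ` interior \<sigma>" "\<lambda>z. edge_logs c z - H z"] by blast
    then show ?thesis by auto
  qed
  then obtain K where K: "\<And>\<sigma> x. \<sigma> \<in> cells T \<Longrightarrow> x \<in> interior \<sigma> \<Longrightarrow> edge_logs c (cpx x) - H (cpx x) = K \<sigma>"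
    by metis
  \<comment> \<open>The limits of the logarithm from the left and from the right of its own edge
    differ by \<open>2 * pi * \<i>\<close>, and all other terms are continuous at the midpoint;
    hence the imaginary part and the factor \<open>2 * pi\<close>.\<close>
  have "jump (\<lambda>\<sigma>. Im (K \<sigma>) / (2 * pi)) \<tau> = c \<tau>" if t: "\<tau> \<in> interior_edges T" for \<tau>
  proof -
    obtain k where k: "is_edge k \<tau>" "\<tau> \<in> edges T" using t by (rule interior_edge_cases)
    define R where "R z = (\<Sum>\<tau>'\<in>interior_edges T - {\<tau>}.
      of_real (c \<tau>') * Ln ((z - cpx (hi \<tau>')) / (z - cpx (lo \<tau>'))))" for z
    let ?z = "cpx (mid k \<tau>)"
    have "isCont R ?z"
      unfolding R_def
    proof (intro continuous_intros)
      fix \<tau>' assume t': "\<tau>' \<in> interior_edges T - {\<tau>}"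
      then obtain j where j: "is_edge j \<tau>'" "\<tau>' \<in> edges T" "lo \<tau>' \<in> \<tau>'"
        by (auto elim: interior_edge_cases)
      have off: "mid k \<tau> \<notin> \<tau>'" using mid_off_edges[OF k(2,1) j(2)] t' by blast
      then show "?z - cpx (lo \<tau>') \<noteq> 0" using j(3) by auto
      show "(?z - cpx (hi \<tau>')) / (?z - cpx (lo \<tau>')) \<notin> \<real>\<^sub>\<le>\<^sub>0"
        using cpx_quotient_edge[OF j(1)] off by blast
    qed
    moreover have "mid k \<tau> \<in> interior Om" by (rule interior_edge_relint[OF t k(1) ext_mid[OF k(1)]])
    then have "isCont H ?z" using H DERIV_isCont by blast
    ultimately have cont: "isCont (\<lambda>z. R z - H z) ?z" by (intro continuous_intros)
    have val: "K (cell_of b \<tau>) = of_real (c \<tau>) * (if b = k then - \<i> * pi else \<i> * pi) + (R ?z - H ?z)" for b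
    proof (rule tendsto_unique)
      let ?F = "at_right (0::real)"
      let ?w = "\<lambda>d. cpx (near_mid k b \<tau> d)"
      have sd: "side k b \<tau> (cell_of b \<tau>)" by (rule side_cell_of[OF t k(1)])
      then have "cell_of b \<tau> \<in> cells T" by (simp add: side_def)
      then have "eventually (\<lambda>d. edge_logs c (?w d) - H (?w d) = K (cell_of b \<tau>)) ?F"
        by (intro eventually_mono[OF near_mid_interior[OF k(1) sd]] K)
      then show "((\<lambda>d. edge_logs c (?w d) - H (?w d)) \<longlongrightarrow> K (cell_of b \<tau>)) ?F"
        by (rule tendsto_eventually)
      have "edge_logs c z = of_real (c \<tau>) * Ln ((z - cpx (hi \<tau>)) / (z - cpx (lo \<tau>))) + R z" for z
        unfolding edge_logs_def R_def using finite_interior_edges t by (intro sum.remove) auto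
      moreover have "((\<lambda>d. of_real (c \<tau>) * Ln ((?w d - cpx (hi \<tau>)) / (?w d - cpx (lo \<tau>))) + (R (?w d) - H (?w d)))
          \<longlongrightarrow> of_real (c \<tau>) * (if b = k then - \<i> * pi else \<i> * pi) + (R ?z - H ?z)) ?F"
        by (intro tendsto_add tendsto_mult tendsto_const Ln_near_mid[OF k(1)]
            isCont_tendsto_compose[OF cont near_mid_tendsto])
      ultimately show "((\<lambda>d. edge_logs c (?w d) - H (?w d))
          \<longlongrightarrow> of_real (c \<tau>) * (if b = k then - \<i> * pi else \<i> * pi) + (R ?z - H ?z)) ?F"
        by (simp add: algebra_simps)
    qed simp
    have "vertical \<tau> \<longleftrightarrow> k" using is_edge_unique[OF k(1), of True] by (auto simp: is_edge_def)
    then show ?thesis using t by (cases k) (simp_all add: jump_def val field_simps)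
  qed
  then show ?thesis using that by blast
qed

text \<open>A finite union of closed convex sets is an ANR. This is for lifting to a logarithm on
  the domain itself, where boundary points are at issue.\<close>

lemma locally_path_connected_domain: "locally path_connected Om"
proof (rule ANR_imp_locally_path_connected)
  show "ANR Om"
    unfolding mesh_domain_def
    using cellD(4) is_cell by (intro ANR_finite_Union_convex_closed finite_cells)
      (auto simp: is_cell_def intro!: convex_Times)
qed

text \<open>If only two opposite quadrants at \<open>x\<close> were covered, a continuous logarithm of
  \<open>(z - P) / (z - Q)\<close>, with \<open>P\<close> and \<open>Q\<close> in the two other quadrants, would differ from the
  principal one by a constant on the connected interior; but the latter has different limits
  at \<open>x\<close> from the two covered quadrants.\<close>

lemma no_pinch:
  assumes sc: "simply_connected Om" and con: "connected (interior Om)"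
    and s1: "occ e x \<sigma>1" and s2: "occ (\<lambda>k. \<not> e k) x \<sigma>2"
  shows "\<exists>k \<sigma>. occ (e(k := \<not> e k)) x \<sigma>"
proof (rule ccontr)
  assume "\<not> ?thesis"
  then have none: "\<And>k \<sigma>. \<not> occ (e(k := \<not> e k)) x \<sigma>" by blast
  obtain g where g: "0 < g"
    "\<And>S k. S \<in> cells T \<union> edges T \<Longrightarrow> Lo S k = coord k x \<or> g \<le> \<bar>Lo S k - coord k x\<bar>"
    "\<And>S k. S \<in> cells T \<union> edges T \<Longrightarrow> Hi S k = coord k x \<or> g \<le> \<bar>Hi S k - coord k x\<bar>"
    using gap[of x] by blast
  define h where "h = g / 2"
  have h: "0 < h" "h < g" using g(1) by (auto simp: h_def)
  define sg where "sg k = (if e k then 1 else - 1 :: real)" for k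
  have sg2: "sg k * sg k = 1" for k by (simp add: sg_def)
  \<comment> \<open>\<open>dp\<close> runs along the diagonal through the two uncovered quadrants,
    \<open>ap\<close> along the one through the covered quadrants. For parameters up to
    \<open>h\<close> in absolute value, \<open>dp\<close> meets the domain only at
    \<open>x\<close>.\<close>
  define dp where "dp t = (fst x + t * sg True, snd x - t * sg False)" for t
  define ap where "ap t = (fst x + t * sg True, snd x + t * sg False)" for t
  have codp: "coord k (dp t) = coord k x + (if (e(False := \<not> e False)) k then t else - t)" for k t
    by (cases k) (auto simp: dp_def coord_def sg_def)
  have codp': "coord k (dp t) = coord k x + (if (e(True := \<not> e True)) k then - t else - (- t))" for k t
    by (cases k) (auto simp: dp_def coord_def sg_def)
  have coap: "coord k (ap t) = coord k x + (if e k then t else - t)" for k t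
    by (cases k) (auto simp: ap_def coord_def sg_def)
  have off: "dp t \<notin> Om" if "t \<noteq> 0" "\<bar>t\<bar> \<le> h" for t
  proof
    assume "dp t \<in> Om"
    then obtain \<sigma> where s: "\<sigma> \<in> cells T" "dp t \<in> \<sigma>" by (auto simp: mesh_domain_def)
    show False
    proof (cases "0 < t")
      case True
      have "occ (e(False := \<not> e False)) x \<sigma>"
        by (rule occ_from_near[OF g(2,3) True _ s codp]) (use that h True in auto)
      then show False using none by blast
    next
      case False
      have "occ (e(True := \<not> e True)) x \<sigma>"
        by (rule occ_from_near[OF g(2,3) _ _ s codp']) (use that h False in auto)
      then show False using none by blast
    qed
  qed
  define P Q where "P = cpx (dp h)" and "Q = cpx (dp (- h))"
  define f where "f y = (cpx y - P) / (cpx y - Q)" for y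
  have nePQ: "cpx y - P \<noteq> 0" "cpx y - Q \<noteq> 0" if "y \<in> Om" for y
    using off[of h] off[of "- h"] h that by (auto simp: P_def Q_def)
  have xOm: "x \<in> Om" using occ_mem[OF s1] occ_cell[OF s1] by (auto simp: mesh_domain_def)
  have xi: "x \<notin> interior Om" using occ_interior none by blast
  have fnr: "f y \<notin> \<real>\<^sub>\<le>\<^sub>0" if y: "y \<in> interior Om" for y
  proof
    assume "f y \<in> \<real>\<^sub>\<le>\<^sub>0"
    then have "cpx y \<in> closed_segment Q P" unfolding f_def by (rule quotient_nonpos_Reals)
    then obtain u where u: "0 \<le> u" "u \<le> 1" "cpx y = (1 - u) *\<^sub>R Q + u *\<^sub>R P"
      by (auto simp: closed_segment_def)
    define t where "t = (2 * u - 1) * h"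
    have "cpx y = cpx (dp t)"
      unfolding u(3) P_def Q_def by (auto simp: cpx_def dp_def t_def complex_eq_iff algebra_simps)
    then have yt: "y = dp t" by simp
    have "\<bar>2 * u - 1\<bar> \<le> 1" using u by auto
    then have "\<bar>t\<bar> \<le> h" using h by (simp add: t_def abs_mult)
    then have "t = 0" using off[of t] y yt interior_subset[of Om] by blast
    then have "y = x" using yt by (simp add: dp_def)
    then show False using xi y by simp
  qed
  have cf: "continuous_on Om f"
    unfolding f_def using nePQ by (auto intro!: continuous_intros)
  have fnz: "f y \<noteq> 0" if "y \<in> Om" for y using nePQ[OF that] by (simp add: f_def)
  have "\<exists>L. continuous_on Om L \<and> (\<forall>y\<in>Om. f y = exp (L y))"
    by (rule continuous_logarithm_on_simply_connected[OF cf sc locally_path_connected_domain fnz]) auto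
  then obtain L where L: "continuous_on Om L" "\<And>y. y \<in> Om \<Longrightarrow> f y = exp (L y)" by blast
  define M where "M y = L y - Ln (f y)" for y
  have iO: "interior Om \<subseteq> Om" by (rule interior_subset)
  have "continuous_on (interior Om) M"
    unfolding M_def using fnr continuous_on_subset[OF L(1) iO] continuous_on_subset[OF cf iO]
    by (intro continuous_intros) auto
  \<comment> \<open>The values of \<open>M\<close> are multiples of \<open>2 * pi * \<i>\<close>, so
    distinct ones are at least 1 apart, and continuity on a connected set makes \<open>M\<close>
    constant.\<close>
  moreover have "1 \<le> norm (M y' - M y)" if "y \<in> interior Om" "y' \<in> interior Om" "M y' \<noteq> M y" for y y'
  proof -
    have e1: "exp (M z) = 1" if "z \<in> interior Om" for z
    proof -
      have "z \<in> Om" using that iO by blast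
      then have "f z \<noteq> 0" "f z = exp (L z)" using L(2)[of z] by auto
      then show ?thesis by (simp add: M_def exp_diff)
    qed
    have "exp (M y' - M y) = 1" using e1 that by (simp add: exp_diff)
    then obtain n :: int where n: "Re (M y' - M y) = 0" "Im (M y' - M y) = of_int (2 * n) * pi"
      by (auto simp: exp_eq_1)
    then have "n \<noteq> 0" using that(3) by (auto simp: complex_eq_iff)
    then have "1 \<le> \<bar>of_int (2 * n) :: real\<bar>" by linarith
    then have "1 * 1 \<le> \<bar>of_int (2 * n) :: real\<bar> * pi" using pi_ge_two by (intro mult_mono) auto
    also have "\<dots> = \<bar>Im (M y' - M y)\<bar>" unfolding n(2) by (simp add: abs_mult)
    finally show ?thesis using abs_Im_le_cmod[of "M y' - M y"] by linarith
  qed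
  ultimately have "M constant_on interior Om"
    by (intro continuous_discrete_range_constant[OF con]) (auto intro!: exI[of _ "1::real"])
  then obtain K where K: "\<And>y. y \<in> interior Om \<Longrightarrow> M y = K" by (auto simp: constant_on_def)
  have lim: "L x - l = K"
    if s: "occ e' x \<sigma>" and ap: "\<And>k t. coord k (p t) = coord k x + (if e' k then t else - t)"
      and pc: "(p \<longlongrightarrow> x) (at_right 0)" and l: "((\<lambda>t. Ln (f (p t))) \<longlongrightarrow> l) (at_right 0)" for e' \<sigma> p l
  proof (rule tendsto_unique)
    have sc: "\<sigma> \<in> cells T" by (rule occ_cell[OF s])
    have "interior \<sigma> \<subseteq> interior Om"
      using sc by (intro interior_mono) (auto simp: mesh_domain_def)
    moreover have "p t \<in> interior \<sigma>" if "0 < t" "t < g" for t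
      unfolding cellD(3)[OF sc]
    proof
      fix k
      show "Lo \<sigma> k < coord k (p t) \<and> coord k (p t) < Hi \<sigma> k"
        using g(2)[of \<sigma> k] g(3)[of \<sigma> k] sc that occD(2-5)[OF s, of k] ap[of k t] by (cases "e' k") auto
    qed
    ultimately have ev: "eventually (\<lambda>t. p t \<in> interior Om) (at_right 0)"
      unfolding eventually_at_right_field using g(1) by (intro exI[of _ g]) auto
    then have "eventually (\<lambda>t. M (p t) = K) (at_right 0)" by (rule eventually_mono) (rule K)
    then show "((\<lambda>t. M (p t)) \<longlongrightarrow> K) (at_right 0)" by (rule tendsto_eventually)
    have "eventually (\<lambda>t. p t \<in> Om) (at_right 0)"
      using ev by (rule eventually_mono) (use iO in blast)
    then have "((\<lambda>t. L (p t)) \<longlongrightarrow> L x) (at_right 0)"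
      by (rule continuous_on_tendsto_compose[OF L(1) pc xOm])
    then show "((\<lambda>t. M (p t)) \<longlongrightarrow> L x - l) (at_right 0)"
      unfolding M_def using l by (intro tendsto_diff)
  qed simp
  define u where "u = Complex (sg True) (- sg False)"
  \<comment> \<open>The direction from \<open>Q\<close> to \<open>P\<close> is \<open>u\<close>; the
    sign \<open>\<kappa>\<close> tells whether the quadrant \<open>e\<close> lies to the left of it
    (1) or to the right, which fixes the sign of the limit.\<close>
  define \<kappa> where "\<kappa> = sg True * sg False"
  have u: "u \<noteq> 0" by (simp add: u_def complex_eq_iff sg_def)
  have fap: "f (ap t) = - ((of_real h - \<i> * of_real (\<kappa> * t)) / (of_real h + \<i> * of_real (\<kappa> * t)))" for t
  proof -
    have "cpx (ap t) - P = u * - (of_real h - \<i> * of_real (\<kappa> * t))"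
      "cpx (ap t) - Q = u * (of_real h + \<i> * of_real (\<kappa> * t))"
      by (cases "e True"; cases "e False"; simp add: P_def Q_def cpx_def ap_def dp_def u_def \<kappa>_def complex_eq_iff sg_def)+
    then show ?thesis
      by (simp only: f_def mult_divide_mult_cancel_left[OF u] minus_divide_left)
  qed
  have pc: "(ap \<longlongrightarrow> x) (at_right 0)" "((\<lambda>t. ap (- t)) \<longlongrightarrow> x) (at_right 0)"
  proof -
    have "(ap \<longlongrightarrow> (fst x + 0 * sg True, snd x + 0 * sg False)) (at_right 0)"
      "((\<lambda>t. ap (- t)) \<longlongrightarrow> (fst x + - 0 * sg True, snd x + - 0 * sg False)) (at_right 0)"
      unfolding ap_def by (intro tendsto_intros)+
    then show "(ap \<longlongrightarrow> x) (at_right 0)" "((\<lambda>t. ap (- t)) \<longlongrightarrow> x) (at_right 0)" by simp_all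
  qed
  have coap': "coord k (ap (- t)) = coord k x + (if \<not> e k then t else - t)" for k t using coap by simp
  note T = tendsto_Ln_across[OF h(1)]
  have "\<kappa> = 1 \<or> \<kappa> = - 1" by (auto simp: \<kappa>_def sg_def)
  then show False
  proof
    assume "\<kappa> = 1"
    then have A: "((\<lambda>t. Ln (f (ap t))) \<longlongrightarrow> \<i> * pi) (at_right 0)"
      "((\<lambda>t. Ln (f (ap (- t)))) \<longlongrightarrow> - \<i> * pi) (at_right 0)"
      using T by (simp_all add: fap)
    have "L x - \<i> * pi = K" "L x - - \<i> * pi = K"
      by (rule lim[OF s1 coap pc(1) A(1)], rule lim[OF s2 coap' pc(2) A(2)])
    then have "\<i> * pi = - \<i> * pi" by (metis diff_left_imp_eq)
    then show False by (simp add: complex_eq_iff)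
  next
    assume "\<kappa> = - 1"
    then have A: "((\<lambda>t. Ln (f (ap t))) \<longlongrightarrow> - \<i> * pi) (at_right 0)"
      "((\<lambda>t. Ln (f (ap (- t)))) \<longlongrightarrow> \<i> * pi) (at_right 0)"
      using T by (simp_all add: fap)
    have "L x - - \<i> * pi = K" "L x - \<i> * pi = K"
      by (rule lim[OF s1 coap pc(1) A(1)], rule lim[OF s2 coap' pc(2) A(2)])
    then have "\<i> * pi = - \<i> * pi" by (metis diff_left_imp_eq)
    then show False by (simp add: complex_eq_iff)
  qed
qed

end

section \<open>Smoothness of piecewise polynomials\<close>

definition partial :: "bool \<Rightarrow> real poly poly \<Rightarrow> real poly poly" where
  "partial k p = (if k then map_poly pderiv p else pderiv p)"

definition line_form :: "bool \<Rightarrow> real \<Rightarrow> real poly poly" where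
  "line_form k a = (if k then [:[:- a, 1:]:] else [:[:- a:], 1:])"

lemma eval2_simps [simp]:
  "eval2 0 x = 0" "eval2 1 x = 1" "eval2 (p + q) x = eval2 p x + eval2 q x"
  "eval2 (p - q) x = eval2 p x - eval2 q x" "eval2 (p * q) x = eval2 p x * eval2 q x"
  "eval2 (- p) x = - eval2 p x"
  by (simp_all add: eval2_def)

lemma eval2_pCons: "eval2 (pCons c p) x = poly c (fst x) + snd x * eval2 p x"
  by (simp add: eval2_def)

lemma eval2_smult: "eval2 (Polynomial.smult [:a:] p) x = a * eval2 p x"
  by (simp add: eval2_def)

lemma eval2_of_nat [simp]: "eval2 (of_nat n) x = of_nat n"
  by (induction n) simp_all

lemma eval2_line_form: "eval2 (line_form k a) x = coord k x - a"
  by (simp add: eval2_pCons line_form_def coord_def)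

lemma continuous_on_eval2: "continuous_on S (eval2 p)"
proof (induction p)
  case (pCons c p)
  have "continuous_on S (\<lambda>x. poly c (fst x) + snd x * eval2 p x)"
    by (intro continuous_intros pCons)
  then show ?case by (simp add: eval2_pCons[abs_def])
qed simp

lemma partial_add: "partial k (p + q) = partial k p + partial k q"
  by (auto simp: partial_def pderiv_add poly_eq_iff coeff_map_poly)

lemma partial_0 [simp]: "partial k 0 = 0"
  by (simp add: partial_def)

lemma partial_diff: "partial k (p - q) = partial k p - partial k q"
  using partial_add[of k "p - q" q] by simp

lemma partial_mult: "partial k (p * q) = partial k p * q + p * partial k q"
proof (cases k)
  case True
  have add: "map_poly pderiv (p + q) = map_poly pderiv p + map_poly pderiv q" for p q :: "real poly poly"
    using partial_add[of True p q] by (simp add: partial_def)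
  have sm: "map_poly pderiv (Polynomial.smult c q) = Polynomial.smult (pderiv c) q + Polynomial.smult c (map_poly pderiv q)"
    for c and q :: "real poly poly"
    by (simp add: poly_eq_iff coeff_map_poly pderiv_mult algebra_simps)
  have "map_poly pderiv (p * q) = map_poly pderiv p * q + p * map_poly pderiv q"
    by (induction p) (simp_all add: add sm map_poly_pCons algebra_simps)
  then show ?thesis using True by (simp add: partial_def)
qed (simp add: partial_def pderiv_mult algebra_simps)

lemma partial_of_nat_mult: "partial k (of_nat n * p) = of_nat n * partial k p"
  by (induction n) (simp_all add: partial_add distrib_right)

lemma partial_line_form: "partial k (line_form k a) = 1" "partial k (line_form (\<not> k) a) = 0"
  by (auto simp: partial_def line_form_def map_poly_pCons pderiv_pCons one_pCons)

lemma eval2_deriv: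
  "((\<lambda>z. eval2 p (pt k z w)) has_real_derivative eval2 (partial k p) (pt k u w)) (at u)"
proof (cases k)
  case True
  have "pderiv (poly p [:w:]) = poly (map_poly pderiv p) [:w:]"
    by (induction p) (simp_all add: map_poly_pCons pderiv_add pderiv_smult)
  then show ?thesis
    using True poly_DERIV[of "poly p [:w:]" u] by (simp add: eval2_def pt_def partial_def)
next
  case False
  have "((\<lambda>z. eval2 p (w, z)) has_real_derivative eval2 (pderiv p) (w, u)) (at u)"
  proof (induction p)
    case (pCons c p)
    then show ?case
      by (auto simp: eval2_pCons pderiv_pCons intro!: derivative_eq_intros)
  qed simp
  then show ?thesis using False by (simp add: pt_def partial_def)
qed

definition partials :: "bool \<Rightarrow> nat \<Rightarrow> real poly poly \<Rightarrow> real poly poly" where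
  "partials k j = partial k ^^ j"

lemma partials_simps [simp]: "partials k 0 p = p" "partials k (Suc j) p = partial k (partials k j p)"
  by (simp_all add: partials_def)

lemma partials_diff: "partials k j (p - q) = partials k j p - partials k j q"
  by (induction j) (simp_all add: partial_diff)

text \<open>Leibniz rule; only two terms survive because the line form has derivative 1.\<close>

lemma partials_line_form_mult: "partials k (Suc j) (line_form k a * q) = line_form k a * partials k (Suc j) q + of_nat (Suc j) * partials k j q"
proof (induction j)
  case (Suc j)
  have "partials k (Suc (Suc j)) (line_form k a * q) = partial k (line_form k a * partials k (Suc j) q + of_nat (Suc j) * partials k j q)"
    using Suc by simp
  also have "\<dots> = line_form k a * partials k (Suc (Suc j)) q + of_nat (Suc (Suc j)) * partials k (Suc j) q"
    by (simp only: partial_add partial_mult[of k "line_form k a"] partial_of_nat_mult partial_line_form partials_simps) (simp add: algebra_simps)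
  finally show ?case .
qed (simp add: partial_mult partial_line_form algebra_simps)

lemma partials_other_line_form_mult: "partials k j (line_form (\<not> k) a * q) = line_form (\<not> k) a * partials k j q"
  by (induction j) (simp_all add: partial_mult partial_line_form)

lemma line_form_power_dvd_vanish:
  assumes "line_form k a ^ Suc r dvd p" "j \<le> r" "coord k x = a"
  shows "eval2 (partials k j p) x = 0"
  using assms(1,2)
proof (induction r arbitrary: p j)
  case 0
  then show ?case using assms(3) by (auto simp: dvd_def eval2_line_form)
next
  case (Suc r)
  from Suc.prems(1) obtain q where q: "p = line_form k a ^ Suc (Suc r) * q" by (auto simp: dvd_def)
  define p' where "p' = line_form k a ^ Suc r * q"
  have p: "p = line_form k a * p'" by (simp add: q p'_def algebra_simps)
  show ?case
  proof (cases j)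
    case 0
    then show ?thesis using assms(3) by (simp add: p eval2_line_form)
  next
    case (Suc i)
    have "eval2 (partials k i p') x = 0"
      by (rule Suc.IH) (use Suc.prems(2) Suc in \<open>auto simp: p'_def\<close>)
    then show ?thesis unfolding Suc p partials_line_form_mult using assms(3) by (simp add: eval2_line_form)
  qed
qed

text \<open>A factor that is constant in the direction of differentiation survives every derivative,
  so the order \<open>j\<close> is unrestricted.\<close>

lemma line_form_other_dvd_vanish:
  assumes "line_form i a ^ Suc r dvd p" "coord i x = a" "i \<noteq> k"
  shows "eval2 (partials k j p) x = 0"
proof -
  have "i = (\<not> k)" using assms(3) by auto
  moreover obtain q where "p = line_form i a * q" using assms(1) by (auto simp: dvd_def mult.assoc)
  ultimately show ?thesis using partials_other_line_form_mult[of k j a q] assms(2) by (simp add: eval2_line_form)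
qed

text \<open>Restricted to the line, \<open>p\<close> is a polynomial in one variable with infinitely
  many roots.\<close>

lemma line_form_dvd_iff_vanish:
  assumes "infinite W" "\<And>w. w \<in> W \<Longrightarrow> eval2 p (pt k a w) = 0"
  shows "line_form k a dvd p"
proof (cases k)
  case True
  have "eval2 p (a, w) = poly (map_poly (\<lambda>c. poly c a) p) w" for w
    by (induction p) (simp_all add: eval2_pCons map_poly_pCons)
  then have "W \<subseteq> {w. poly (map_poly (\<lambda>c. poly c a) p) w = 0}"
    using assms(2) True by (auto simp: pt_def)
  then have "map_poly (\<lambda>c. poly c a) p = 0"
    using poly_roots_finite assms(1) finite_subset by blast
  then have "poly (coeff p n) a = 0" for n
    by (metis coeff_0 coeff_map_poly poly_0)
  then show ?thesis using True by (simp add: line_form_def const_poly_dvd_iff poly_eq_0_iff_dvd[symmetric])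
next
  case False
  have "W \<subseteq> {w. poly (poly p [:a:]) w = 0}"
    using assms(2) False by (auto simp: pt_def eval2_def)
  then have "poly p [:a:] = 0"
    using poly_roots_finite assms(1) finite_subset by blast
  then show ?thesis using False poly_eq_0_iff_dvd[of p "[:a:]"] by (simp add: line_form_def)
qed

text \<open>Induction strips off one factor: on the line, the derivative of order
  \<open>j + 1\<close> of \<open>p\<close> is \<open>j + 1\<close> times the derivative of order
  \<open>j\<close> of the quotient.\<close>

lemma vanish_line_form_power_dvd:
  assumes "infinite W" "\<And>j w. j \<le> r \<Longrightarrow> w \<in> W \<Longrightarrow> eval2 (partials k j p) (pt k a w) = 0"
  shows "line_form k a ^ Suc r dvd p"
  using assms(2)
proof (induction r arbitrary: p)
  case 0
  then show ?case using line_form_dvd_iff_vanish[OF assms(1), of p k a] 0[of 0] by simp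
next
  case (Suc r)
  have "line_form k a dvd p" using line_form_dvd_iff_vanish[OF assms(1), of p k a] Suc.prems[of 0] by simp
  then obtain q where q: "p = line_form k a * q" by (auto simp: dvd_def)
  have "line_form k a ^ Suc r dvd q"
  proof (rule Suc.IH)
    fix j w assume jw: "j \<le> r" "w \<in> W"
    then have "eval2 (partials k (Suc j) p) (pt k a w) = 0" by (intro Suc.prems) auto
    then have "of_nat (Suc j) * eval2 (partials k j q) (pt k a w) = 0"
      unfolding q partials_line_form_mult by (simp only: eval2_simps eval2_of_nat eval2_line_form coord_pt) simp
    then show "eval2 (partials k j q) (pt k a w) = 0" by simp
  qed
  then show ?case unfolding q by (simp only: power_Suc[of _ "Suc r"] mult_dvd_mono dvd_refl)
qed

lemma eval2_zero_on_box:
  assumes "a < b" "c < d" "\<And>x. a < fst x \<Longrightarrow> fst x < b \<Longrightarrow> c < snd x \<Longrightarrow> snd x < d \<Longrightarrow> eval2 p x = 0"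
  shows "p = 0"
proof (rule ccontr)
  assume "p \<noteq> 0"
  have "poly p [:w:] = 0" if "c < w" "w < d" for w
  proof (rule ccontr)
    assume "poly p [:w:] \<noteq> 0"
    then have "finite {z. poly (poly p [:w:]) z = 0}" by (rule poly_roots_finite)
    moreover have "{a<..<b} \<subseteq> {z. poly (poly p [:w:]) z = 0}"
      using assms(3)[of "(_, w)"] that by (auto simp: eval2_def)
    ultimately show False using infinite_Ioo[OF assms(1)] finite_subset by blast
  qed
  then have "(\<lambda>w. [:w:]) ` {c<..<d} \<subseteq> {q. poly p q = 0}" by auto
  moreover have "infinite ((\<lambda>w. [:w:]) ` {c<..<d})"
    using infinite_Ioo[OF assms(2)] by (subst finite_image_iff) (auto simp: inj_on_def)
  ultimately show False using poly_roots_finite[OF \<open>p \<noteq> 0\<close>] finite_subset by blast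
qed

section \<open>Differentiability along an axis\<close>

definition C_along :: "bool \<Rightarrow> nat \<Rightarrow> (point \<Rightarrow> real) \<Rightarrow> point \<Rightarrow> bool" where
  "C_along k n f x \<longleftrightarrow>
     (\<exists>U D. open U \<and> x \<in> U \<and> (\<forall>y\<in>U. D 0 y = f y) \<and> (\<forall>j\<le>n. continuous_on U (D j)) \<and>
        (\<forall>j<n. \<forall>y\<in>U. ((\<lambda>z. D j (pt k z (coord (\<not> k) y))) has_real_derivative D (Suc j) y) (at (coord k y))))"

lemma C_along_iff: "C_along k n f x \<longleftrightarrow> (if k then C_in_s n f x else C_in_t n f x)"
  by (cases k) (simp_all add: C_along_def C_in_s_def C_in_t_def pt_def coord_def split_def)

lemma glue_DERIV:
  fixes g1 g2 :: "real \<Rightarrow> real"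
  assumes "(g1 has_real_derivative d) (at a)" "(g2 has_real_derivative d) (at a)" "g1 a = g2 a"
  shows "((\<lambda>z. if a \<le> z then g1 z else g2 z) has_real_derivative d) (at a)"
proof -
  let ?g = "\<lambda>z. if a \<le> z then g1 z else g2 z"
  have "((\<lambda>y. (g1 y - g1 a) / (y - a)) \<longlongrightarrow> d) (at_right a)" "((\<lambda>y. (g2 y - g2 a) / (y - a)) \<longlongrightarrow> d) (at_left a)"
    using assms(1,2) tendsto_within_subset[OF _ subset_UNIV] unfolding has_field_derivative_iff by blast+
  then have "((\<lambda>y. (?g y - ?g a) / (y - a)) \<longlongrightarrow> d) (at_right a)" "((\<lambda>y. (?g y - ?g a) / (y - a)) \<longlongrightarrow> d) (at_left a)"
    using assms(3) by (auto elim!: Lim_transform_eventually simp: eventually_at_filter)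
  then show ?thesis
    unfolding has_field_derivative_iff by (intro filterlim_split_at)
qed

definition line_smoothness :: "(real \<Rightarrow> nat) \<Rightarrow> (real \<Rightarrow> nat) \<Rightarrow> bool \<Rightarrow> real \<Rightarrow> nat" where
  "line_smoothness rh rv k = (if k then rh else rv)"

lemma edge_coord:
  assumes "is_edge k \<tau>"
  shows "smoothness rh rv \<tau> = line_smoothness rh rv k (Lo \<tau> k)" "Delta rh rv \<tau> = line_form k (Lo \<tau> k) ^ Suc (line_smoothness rh rv k (Lo \<tau> k))"
proof -
  have v: "vertical \<tau> \<longleftrightarrow> k" using is_edge_unique[OF assms, of True] by (auto simp: is_edge_def)
  have "coord k ` \<tau> = {Lo \<tau> k}"
  proof -
    have "lo \<tau> \<in> \<tau>" using edge_bounds(1-3)[OF assms] by auto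
    then have "Lo \<tau> k \<in> coord k ` \<tau>" by (rule rev_image_eqI) simp
    then show ?thesis using edge_bounds(3)[OF assms] by auto
  qed
  then have "(if k then s_coord \<tau> else t_coord \<tau>) = Lo \<tau> k"
    by (cases k) (simp_all add: s_coord_def t_coord_def coord_def[abs_def])
  then show "smoothness rh rv \<tau> = line_smoothness rh rv k (Lo \<tau> k)" "Delta rh rv \<tau> = line_form k (Lo \<tau> k) ^ Suc (line_smoothness rh rv k (Lo \<tau> k))"
    using v by (cases k; simp add: smoothness_def line_smoothness_def Delta_def edge_poly_def line_form_def)+
qed

section \<open>Polynomials on cells that match across edges\<close>

context mesh
begin

text \<open>The divisibility condition of the edges, imposed on adjacent quadrants at every point
  instead. It is trivial if they belong to one cell, so one may pass between quadrants without
  asking for an edge.\<close>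

definition matched :: "(real \<Rightarrow> nat) \<Rightarrow> (real \<Rightarrow> nat) \<Rightarrow> (point set \<Rightarrow> real poly poly) \<Rightarrow> bool" where
  "matched rh rv c \<longleftrightarrow> (\<forall>k e x \<sigma> \<sigma>'. occ e x \<sigma> \<longrightarrow> occ (e(k := \<not> e k)) x \<sigma>' \<longrightarrow>
     line_form k (coord k x) ^ Suc (line_smoothness rh rv k (coord k x)) dvd c \<sigma> - c \<sigma>')"

lemma jump_sides:
  assumes "\<tau> \<in> interior_edges T" "is_edge k \<tau>" "side k True \<tau> \<sigma>" "side k False \<tau> \<sigma>'"
  shows "jump c \<tau> = (if k then c \<sigma>' - c \<sigma> else c \<sigma> - c \<sigma>')"
proof -
  have "vertical \<tau> \<longleftrightarrow> k" using is_edge_unique[OF assms(2), of True] by (auto simp: is_edge_def)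
  then show ?thesis
    using assms(1) cell_of_eq[OF assms(2,3)] cell_of_eq[OF assms(2,4)] by (simp add: jump_def)
qed

lemma dvd_diff_swap: "(d :: 'a :: comm_ring_1) dvd a - b \<longleftrightarrow> d dvd b - a"
  by (metis dvd_minus_iff minus_diff_eq)

lemma matchedI:
  assumes "\<And>\<tau>. \<tau> \<in> interior_edges T \<Longrightarrow> Delta rh rv \<tau> dvd jump c \<tau>"
  shows "matched rh rv c"
  unfolding matched_def
proof (intro allI impI)
  fix k e x \<sigma> \<sigma>' assume o: "occ e x \<sigma>" "occ (e(k := \<not> e k)) x \<sigma>'"
  show "line_form k (coord k x) ^ Suc (line_smoothness rh rv k (coord k x)) dvd c \<sigma> - c \<sigma>'"
  proof (cases "\<sigma> = \<sigma>'")
    case False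
    obtain \<tau> where t: "\<tau> \<in> interior_edges T" "is_edge k \<tau>" "ext k (e (\<not> k)) x \<tau>"
      "side k (e k) \<tau> \<sigma>" "side k (\<not> e k) \<tau> \<sigma>'"
      by (rule adjacent_cells_interior_edge[OF o False])
    have "Lo \<tau> k = coord k x" using t(3) by (simp add: ext_def)
    then have dj: "line_form k (coord k x) ^ Suc (line_smoothness rh rv k (coord k x)) dvd jump c \<tau>"
      using assms[OF t(1)] edge_coord(2)[OF t(2), of rh rv] by simp
    have "jump c \<tau> = c \<sigma> - c \<sigma>' \<or> jump c \<tau> = c \<sigma>' - c \<sigma>"
      using t(4,5) jump_sides[OF t(1,2)] by (cases "e k"; cases k) auto
    then show ?thesis
    proof
      assume "jump c \<tau> = c \<sigma> - c \<sigma>'"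
      with dj show ?thesis by (simp only:)
    next
      assume "jump c \<tau> = c \<sigma>' - c \<sigma>"
      with dj show ?thesis by (simp only: dvd_diff_swap[of _ "c \<sigma>" "c \<sigma>'"])
    qed
  qed simp
qed

lemma matched_eval_adjacent:
  assumes "matched rh rv c" "occ e x \<sigma>" "occ (e(k := \<not> e k)) x \<sigma>'"
  shows "eval2 (c \<sigma>) x = eval2 (c \<sigma>') x"
proof -
  have "line_form k (coord k x) ^ Suc (line_smoothness rh rv k (coord k x)) dvd c \<sigma> - c \<sigma>'"
    using assms unfolding matched_def by blast
  from line_form_power_dvd_vanish[OF this, of 0 x] show ?thesis by simp
qed

text \<open>Single-valuedness on the whole domain, including its boundary. Cells in equal or
  adjacent quadrants agree directly; for opposite ones \<open>no_pinch\<close> supplies a cell in a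
  quadrant adjacent to both.\<close>

lemma matched_eval:
  assumes sc: "simply_connected Om" and con: "connected (interior Om)" and c: "matched rh rv c"
    and s: "\<sigma> \<in> cells T" "\<sigma>' \<in> cells T" "x \<in> \<sigma>" "x \<in> \<sigma>'"
  shows "eval2 (c \<sigma>) x = eval2 (c \<sigma>') x"
proof -
  obtain e where e: "occ e x \<sigma>" by (rule occ_exists[OF s(1,3)])
  obtain e' where e': "occ e' x \<sigma>'" by (rule occ_exists[OF s(2,4)])
  note adj = matched_eval_adjacent[OF c]
  consider "e' = e" | k where "e' = e(k := \<not> e k)" | "e' = (\<lambda>k. \<not> e k)"
  proof -
    have "e' = e \<or> e' = e(True := \<not> e True) \<or> e' = e(False := \<not> e False) \<or> e' = (\<lambda>k. \<not> e k)"
      unfolding fun_eq_iff all_bool_eq by auto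
    then show thesis using that by blast
  qed
  then show ?thesis
  proof cases
    case 1
    then show ?thesis using occ_unique[OF e] e' by blast
  next
    case (2 k)
    then show ?thesis using adj[OF e] e' by blast
  next
    case 3
    obtain k \<sigma>'' where s'': "occ (e(k := \<not> e k)) x \<sigma>''"
      using no_pinch[OF sc con e] e' 3 by blast
    have "e' = (e(k := \<not> e k))((\<not> k) := \<not> (e(k := \<not> e k)) (\<not> k))"
      unfolding 3 fun_eq_iff all_axis[of _ k] by auto
    then show ?thesis using adj[OF e s''] adj[OF s''] e' by metis
  qed
qed

definition compat :: "point \<Rightarrow> (bool \<Rightarrow> bool) \<Rightarrow> point \<Rightarrow> bool" where
  "compat x e y \<longleftrightarrow> (\<forall>i. (e i \<longrightarrow> coord i x \<le> coord i y) \<and> (\<not> e i \<longrightarrow> coord i y \<le> coord i x))"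

text \<open>The quadrant is changed one axis at a time. If both directions of an axis admit
  \<open>y\<close>, then \<open>y\<close> lies on the corresponding line through \<open>x\<close>.
  Crossing the line of axis \<open>k\<close> preserves derivatives along \<open>k\<close> up to its
  smoothness; crossing the other line preserves all of them.\<close>

lemma matched_agree:
  assumes c: "matched rh rv c" and q: "\<And>e. occ e x (q e)" and j: "j \<le> line_smoothness rh rv k (coord k x)"
    and e: "compat x e y" "compat x e' y"
  shows "eval2 (partials k j (c (q e))) y = eval2 (partials k j (c (q e'))) y"
proof -
  have step: "eval2 (partials k j (c (q e))) y = eval2 (partials k j (c (q (e(i := b))))) y"
    if "compat x e y" "compat x (e(i := b)) y" for e i b
  proof (cases "b = e i")
    case True
    then have "e(i := b) = e" by auto
    then show ?thesis by simp
  next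
    case False
    then have b: "b = (\<not> e i)" by auto
    then have eq: "coord i y = coord i x"
      using that unfolding compat_def by (cases "e i") (auto dest!: spec[of _ i])
    have dv: "line_form i (coord i x) ^ Suc (line_smoothness rh rv i (coord i x)) dvd c (q e) - c (q (e(i := b)))"
      using c q unfolding matched_def b by blast
    have "eval2 (partials k j (c (q e) - c (q (e(i := b))))) y = 0"
    proof (cases "i = k")
      case True
      then show ?thesis using line_form_power_dvd_vanish[OF dv[unfolded True] j] eq by simp
    next
      case False
      then show ?thesis using line_form_other_dvd_vanish[OF dv eq] by simp
    qed
    then show ?thesis by (simp add: partials_diff)
  qed
  have "compat x (e(True := e' True)) y" using e by (auto simp: compat_def all_bool_eq)
  moreover have "(e(True := e' True))(False := e' False) = e'" by (auto simp: fun_eq_iff all_bool_eq)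
  ultimately show ?thesis using step[of e True "e' True"] step[of "e(True := e' True)" False "e' False"] e by simp
qed

text \<open>Each \<open>D j\<close> is composed of derivatives of the four quadrant polynomials,
  which agree where closed quadrants overlap. A finite closed cover then gives continuity, and
  gluing gives differentiability at the line of axis \<open>k\<close> through
  \<open>x\<close>.\<close>

lemma matched_C_along:
  assumes c: "matched rh rv c" and x: "x \<in> interior Om"
    and f: "\<And>\<sigma> y. \<sigma> \<in> cells T \<Longrightarrow> y \<in> \<sigma> \<Longrightarrow> f y = eval2 (c \<sigma>) y"
  shows "C_along k (line_smoothness rh rv k (coord k x)) f x"
proof -
  let ?r = "line_smoothness rh rv k (coord k x)"
  obtain q where "\<forall>e. occ e x (q e)" by (rule occ_choice[OF x])
  then have q: "\<And>e. occ e x (q e)" by blast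
  obtain d where d: "0 < d"
    "\<And>e y. (\<And>k. \<bar>coord k y - coord k x\<bar> < d \<and> (e k \<longrightarrow> coord k x \<le> coord k y) \<and> (\<not> e k \<longrightarrow> coord k y \<le> coord k x)) \<Longrightarrow> y \<in> q e"
    using occ_near[of x q, OF q] by blast
  define sg where "sg y = (\<lambda>i. coord i x \<le> coord i y)" for y
  have csg: "compat x (sg y) y" for y by (auto simp: compat_def sg_def)
  define D where "D j y = eval2 (partials k j (c (q (sg y)))) y" for j y
  have D: "D j y = eval2 (partials k j (c (q e))) y" if "j \<le> ?r" "compat x e y" for j e y
    unfolding D_def using matched_agree[OF c q that(1) csg that(2)] .
  have cco: "continuous_on UNIV (coord i)" for i
    by (cases i) (auto simp: coord_def[abs_def] intro!: continuous_intros)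
  show ?thesis
    unfolding C_along_def
  proof (intro exI[of _ "ball x d"] exI[of _ D] conjI ballI allI impI)
    show "D 0 y = f y" if "y \<in> ball x d" for y
    proof -
      have "\<bar>coord i y - coord i x\<bar> < d" for i
        using that dist_fst_le[of x y] dist_snd_le[of x y] by (auto simp: coord_def dist_real_def)
      then have "y \<in> q (sg y)" by (intro d(2)) (auto simp: sg_def)
      then show ?thesis using f[OF occ_cell[OF q]] by (simp add: D_def)
    qed
    show "continuous_on (ball x d) (D j)" if j: "j \<le> ?r" for j
    proof (rule continuous_on_subset)
      have "continuous_on (\<Union>e\<in>UNIV. {y. compat x e y}) (D j)"
      proof (rule continuous_on_closed_Union)
        fix e
        have "closed {y. compat x e y}"
          unfolding compat_def
          by (intro closed_Collect_all closed_Collect_conj closed_Collect_imp closed_Collect_le open_Collect_const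
              continuous_on_const cco)
        then show "closed {y. compat x e y}" .
        show "continuous_on {y. compat x e y} (D j)"
          using continuous_on_eval2[of "{y. compat x e y}" "partials k j (c (q e))"]
          by (rule continuous_on_eq) (use D[OF j] in auto)
      qed simp
      moreover have "(\<Union>e\<in>UNIV. {y. compat x e y}) = UNIV" using csg by blast
      ultimately show "continuous_on UNIV (D j)" by simp
    qed simp
    show "((\<lambda>z. D j (pt k z (coord (\<not> k) y))) has_real_derivative D (Suc j) y) (at (coord k y))"
      if j: "j < ?r" for j y
    proof -
      let ?w = "coord (\<not> k) y"
      \<comment> \<open>The quadrants on the two sides of the line of axis \<open>k\<close>, with
        the same direction along the line as \<open>y\<close>.\<close>
      define e where "e b = (sg y)(k := b)" for b
      have ce: "compat x (e b) (pt k z ?w)" if "if b then coord k x \<le> z else z \<le> coord k x" for b z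
        using that csg[of y] unfolding compat_def all_axis[of _ k] by (auto simp: e_def)
      have der: "((\<lambda>z. eval2 (partials k j (c (q (e b)))) (pt k z ?w)) has_real_derivative
          eval2 (partials k (Suc j) (c (q (e b)))) (pt k u ?w)) (at u)" for b u
        using eval2_deriv[of "partials k j (c (q (e b)))" k ?w u] by simp
      have Dz: "D i (pt k z ?w) = eval2 (partials k i (c (q (e b)))) (pt k z ?w)"
        if "i \<le> ?r" "if b then coord k x \<le> z else z \<le> coord k x" for i b z
        using D[OF that(1) ce[OF that(2)]] .
      have glue: "D i (pt k z ?w) = (if coord k x \<le> z then eval2 (partials k i (c (q (e True)))) (pt k z ?w)
          else eval2 (partials k i (c (q (e False)))) (pt k z ?w))" if "i \<le> ?r" for i z
        using Dz[OF that, of True z] Dz[OF that, of False z] by simp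
      have y: "pt k (coord k y) ?w = y" by simp
      consider "coord k y = coord k x" | "coord k x < coord k y" | "coord k y < coord k x" by linarith
      then show ?thesis
      proof cases
        case 1
        \<comment> \<open>On the line both polynomials have the value \<open>D j\<close> and the
          derivative \<open>D (Suc j)\<close>; for the latter \<open>Suc j \<le> ?r\<close> is
          essential.\<close>
        have "eval2 (partials k (Suc j) (c (q (e b)))) (pt k (coord k y) ?w) = D (Suc j) y" for b
          using Dz[of "Suc j" b "coord k y"] 1 j unfolding y by (cases b) auto
        moreover have "eval2 (partials k j (c (q (e True)))) (pt k (coord k x) ?w) = eval2 (partials k j (c (q (e False)))) (pt k (coord k x) ?w)"
          using Dz[of j True "coord k x"] Dz[of j False "coord k x"] j by simp
        ultimately show ?thesis
          unfolding glue[OF less_imp_le[OF j]] 1[symmetric] using der[of _ "coord k y"]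
          by (intro glue_DERIV) (simp_all only: 1)
      next
        case 2
        have "eval2 (partials k (Suc j) (c (q (e True)))) (pt k (coord k y) ?w) = D (Suc j) y"
          using Dz[of "Suc j" True "coord k y"] 2 j unfolding y by simp
        then have "((\<lambda>z. eval2 (partials k j (c (q (e True)))) (pt k z ?w)) has_real_derivative D (Suc j) y) (at (coord k y))"
          using der[of True "coord k y"] by simp
        then show ?thesis
          by (rule has_field_derivative_transform_within_open[of _ _ _ "{coord k x<..}"])
            (use 2 glue[OF less_imp_le[OF j]] in auto)
      next
        case 3
        have "eval2 (partials k (Suc j) (c (q (e False)))) (pt k (coord k y) ?w) = D (Suc j) y"
          using Dz[of "Suc j" False "coord k y"] 3 j unfolding y by simp
        then have "((\<lambda>z. eval2 (partials k j (c (q (e False)))) (pt k z ?w)) has_real_derivative D (Suc j) y) (at (coord k y))"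
          using der[of False "coord k y"] by simp
        then show ?thesis
          by (rule has_field_derivative_transform_within_open[of _ _ _ "{..<coord k x}"])
            (use 3 glue[OF less_imp_le[OF j]] in auto)
      qed
    qed
  qed (use d(1) in auto)
qed

lemma continuous_on_pt: "continuous_on S (\<lambda>z. pt k z w)" "continuous_on S (\<lambda>w. pt k z w)"
  unfolding pt_def by (cases k; simp; intro continuous_intros)+

text \<open>Inside each cell \<open>D j\<close> is the derivative of its polynomial, and by
  continuity this persists on the edge. So \<open>p\<close> and \<open>p'\<close> share their
  derivatives up to order \<open>r\<close> at infinitely many points of the line, which forces
  divisibility.\<close>

lemma C_along_Delta_dvd:
  assumes t: "\<tau> \<in> interior_edges T" "is_edge k \<tau>" and s: "side k True \<tau> \<sigma>" "side k False \<tau> \<sigma>'"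
    and C: "C_along k r f (mid k \<tau>)"
    and f: "\<And>x. x \<in> \<sigma> \<Longrightarrow> f x = eval2 p x" "\<And>x. x \<in> \<sigma>' \<Longrightarrow> f x = eval2 p' x"
  shows "line_form k (Lo \<tau> k) ^ Suc r dvd p - p'"
proof -
  let ?a = "Lo \<tau> k" let ?n = "\<not> k"
  obtain U D where UD: "open U" "mid k \<tau> \<in> U" "\<forall>y\<in>U. D 0 y = f y" "\<forall>j\<le>r. continuous_on U (D j)"
    "\<forall>j<r. \<forall>y\<in>U. ((\<lambda>z. D j (pt k z (coord ?n y))) has_real_derivative D (Suc j) y) (at (coord k y))"
    using C unfolding C_along_def by (elim exE conjE)
  have U: "open U" "mid k \<tau> \<in> U" "\<And>y. y \<in> U \<Longrightarrow> D 0 y = f y"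
    "\<And>j. j \<le> r \<Longrightarrow> continuous_on U (D j)"
    "\<And>j y. j < r \<Longrightarrow> y \<in> U \<Longrightarrow> ((\<lambda>z. D j (pt k z (coord ?n y))) has_real_derivative D (Suc j) y) (at (coord k y))"
    using UD by simp_all
  define W where "W = {w. pt k ?a w \<in> U \<and> Lo \<tau> ?n < w \<and> w < Hi \<tau> ?n}"
  \<comment> \<open>Induction on \<open>j\<close>: near \<open>y\<close>, on its line in direction
    \<open>k\<close>, \<open>D j\<close> already equals the polynomial derivative, and uniqueness of
    derivatives settles \<open>D (Suc j)\<close>.\<close>
  have inside: "D j y = eval2 (partials k j p) y"
    if "j \<le> r" "y \<in> U" "y \<in> interior \<sigma>" "\<And>x. x \<in> \<sigma> \<Longrightarrow> f x = eval2 p x" for j y \<sigma> p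
    using that(1-3)
  proof (induction j arbitrary: y)
    case 0
    then have "y \<in> \<sigma>" "y \<in> U" using interior_subset by auto
    then show ?case using U(3) that(4) by simp
  next
    case (Suc j)
    let ?w = "coord ?n y"
    let ?S = "(\<lambda>z. pt k z ?w) -` (U \<inter> interior \<sigma>)"
    have S: "open ?S" using U(1) continuous_on_pt(1)[of UNIV k ?w]
      by (intro open_vimage open_Int) auto
    have yS: "coord k y \<in> ?S" using Suc.prems by simp
    have eq: "D j (pt k z ?w) = eval2 (partials k j p) (pt k z ?w)" if "z \<in> ?S" for z
      using Suc.IH[of "pt k z ?w"] Suc.prems(1) that by simp
    have "((\<lambda>z. D j (pt k z ?w)) has_real_derivative D (Suc j) y) (at (coord k y))"
      by (rule U(5)) (use Suc.prems in auto)
    from has_field_derivative_transform_within_open[OF this S yS eq]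
    have "((\<lambda>z. eval2 (partials k j p) (pt k z ?w)) has_real_derivative D (Suc j) y) (at (coord k y))" .
    moreover have "((\<lambda>z. eval2 (partials k j p) (pt k z ?w)) has_real_derivative eval2 (partials k (Suc j) p) y) (at (coord k y))"
      using eval2_deriv[of "partials k j p" k ?w "coord k y"] by simp
    ultimately show ?case by (rule DERIV_unique)
  qed
  have edge: "D j (pt k ?a w) = eval2 (partials k j p) (pt k ?a w)"
    if j: "j \<le> r" and w: "w \<in> W" and sd: "side k b \<tau> \<sigma>" and fp: "\<And>x. x \<in> \<sigma> \<Longrightarrow> f x = eval2 p x" for j w b \<sigma> p
  proof (rule tendsto_unique)
    let ?g = "\<lambda>d. pt k (?a + (if b then d else - d)) w"
    have cs: "\<sigma> \<in> cells T" using sd by (simp add: side_def)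
    have "lo \<tau> \<in> \<tau>" "hi \<tau> \<in> \<tau>" using edge_bounds(1-3)[OF t(2)] by auto
    then have "lo \<tau> \<in> \<sigma>" "hi \<tau> \<in> \<sigma>" using sd by (auto simp: side_def)
    then have "Lo \<sigma> ?n \<le> Lo \<tau> ?n" "Hi \<tau> ?n \<le> Hi \<sigma> ?n" using cellD(2)[OF cs] by auto
    then have "?g d \<in> interior \<sigma>" if "0 < d" "d < Hi \<sigma> k - Lo \<sigma> k" for d
      using that sd w unfolding cellD(3)[OF cs] all_axis[of _ k] side_def W_def by (cases b) auto
    then have 1: "eventually (\<lambda>d. ?g d \<in> interior \<sigma>) (at_right 0)"
      unfolding eventually_at_right_field using cellD(1)[OF cs, of k] by (intro exI[of _ "Hi \<sigma> k - Lo \<sigma> k"]) auto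
    have "isCont (\<lambda>z. pt k z w) ?a"
      using continuous_on_pt(1)[of UNIV k w] by (simp add: continuous_on_eq_continuous_at)
    moreover have "((\<lambda>d. ?a + (if b then d else - d)) \<longlongrightarrow> ?a) (at_right 0)"
      by (cases b) (auto intro!: tendsto_eq_intros)
    ultimately have lim: "(?g \<longlongrightarrow> pt k ?a w) (at_right 0)" by (rule isCont_tendsto_compose)
    have wU: "pt k ?a w \<in> U" using w by (simp add: W_def)
    have 2: "eventually (\<lambda>d. ?g d \<in> U) (at_right 0)" by (rule topological_tendstoD[OF lim U(1) wU])
    show "((\<lambda>d. D j (?g d)) \<longlongrightarrow> D j (pt k ?a w)) (at_right 0)"
      by (rule continuous_on_tendsto_compose[OF U(4)[OF j] lim wU 2])
    have "((\<lambda>d. eval2 (partials k j p) (?g d)) \<longlongrightarrow> eval2 (partials k j p) (pt k ?a w)) (at_right 0)"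
      by (rule continuous_on_tendsto_compose[OF continuous_on_eval2[of UNIV] lim]) auto
    moreover have "eventually (\<lambda>d. eval2 (partials k j p) (?g d) = D j (?g d)) (at_right 0)"
      using 1 2 by eventually_elim (use inside[OF j _ _ fp] in auto)
    ultimately show "((\<lambda>d. D j (?g d)) \<longlongrightarrow> eval2 (partials k j p) (pt k ?a w)) (at_right 0)"
      by (rule Lim_transform_eventually)
  qed simp
  have "infinite W"
  proof -
    have "W = (\<lambda>w. pt k ?a w) -` U \<inter> {Lo \<tau> ?n<..<Hi \<tau> ?n}" by (auto simp: W_def)
    moreover have "open ((\<lambda>w. pt k ?a w) -` U)"
      using continuous_on_pt(2)[of UNIV k ?a] U(1) by (intro open_vimage) auto
    ultimately have "open W" by auto
    moreover have "(Lo \<tau> ?n + Hi \<tau> ?n) / 2 \<in> W"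
      using U(2) edge_bounds(1)[OF t(2)] by (auto simp: W_def mid_def)
    ultimately show ?thesis using finite_imp_not_open by blast
  qed
  then show ?thesis
  proof (rule vanish_line_form_power_dvd)
    fix j w assume "j \<le> r" "w \<in> W"
    then show "eval2 (partials k j (p - p')) (pt k ?a w) = 0"
      using edge[OF _ _ s(1) f(1)] edge[OF _ _ s(2) f(2)] by (simp add: partials_diff)
  qed
qed

end

section \<open>The dimension formula\<close>

lemma pscale_sum: "pscale a (sum f S) = (\<Sum>x\<in>S. pscale a (f x))"
  by (induction S rule: infinite_finite_induct) (simp_all add: pscale_def smult_add_right)

lemma pscale_simps: "pscale a 0 = 0" "pscale a (p - q) = pscale a p - pscale a q" "pscale a (p + q) = pscale a p + pscale a q"
  by (simp_all add: pscale_def smult_diff_right smult_add_right)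

lemma fun_ops: "(\<lambda>f g x. f x + g x) = (+)" "(\<lambda>x. 0) = 0"
  by (auto simp: fun_eq_iff)

lemma chains_mono: "(\<And>i. i \<in> I \<Longrightarrow> A i \<subseteq> B i) \<Longrightarrow> chains I A \<subseteq> chains I B"
  unfolding chains_def by blast

lemma single_in_chains: "i \<in> I \<Longrightarrow> p \<in> A i \<Longrightarrow> (\<And>j. j \<in> I \<Longrightarrow> 0 \<in> A j) \<Longrightarrow> (\<lambda>j. if j = i then p else 0) \<in> chains I A"
  by (auto simp: chains_def)

lemma J_edge_eq:
  assumes "is_edge k \<tau>"
  shows "J_edge rh rv m m' \<tau> = {p. line_form k (Lo \<tau> k) ^ Suc (line_smoothness rh rv k (Lo \<tau> k)) dvd p} \<inter> bideg_lt (Suc m) (Suc m')"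
  by (simp only: J_edge_def R_space_eq edge_coord(2)[OF assms])

lemma line_form_power: "line_form True a ^ n = [:[:- a, 1:] ^ n:]" "line_form False a ^ n = [:[:- a:], 1:] ^ n"
  by (simp_all add: line_form_def poly_const_pow)

lemma degree_linear_pow: "degree ([:- a, 1:] ^ n :: real poly) = n" "[:- a, 1:] ^ n \<noteq> (0 :: real poly)"
  by (simp_all add: degree_power_eq)

text \<open>The smoothness bound matters: beyond it the ideal meets the polynomials of the given
  bidegree only in 0, and the codimension stays below the edge term.\<close>

lemma ldim_J_edge:
  assumes "is_edge k \<tau>" "smoothness rh rv \<tau> \<le> (if k then m else m')"
  shows "fin_lin pscale (J_edge rh rv m m' \<tau>)"
    "int (ldim pscale (J_edge rh rv m m' \<tau>)) =
      (int m + 1) * (int m' + 1) - (if k then int m' + 1 else int m + 1) * (int (smoothness rh rv \<tau>) + 1)"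
proof -
  let ?r = "line_smoothness rh rv k (Lo \<tau> k)"
  have sm: "smoothness rh rv \<tau> = ?r" by (rule edge_coord(1)[OF assms(1)])
  show "fin_lin pscale (J_edge rh rv m m' \<tau>)"
    unfolding J_edge_eq[OF assms(1)]
    using ldim_const_multiples(1)[OF degree_linear_pow(2)] ldim_linear_multiples(1)
    by (cases k) (simp_all only: line_form_power)
  have "ldim pscale (J_edge rh rv m m' \<tau>) = (if k then (m - ?r) * Suc m' else Suc m * (m' - ?r))"
    unfolding J_edge_eq[OF assms(1)]
    by (cases k) (simp_all only: line_form_power degree_linear_pow if_True if_False diff_Suc_Suc
        ldim_const_multiples(2)[OF degree_linear_pow(2)] ldim_linear_multiples(2))
  then show "int (ldim pscale (J_edge rh rv m m' \<tau>)) =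
      (int m + 1) * (int m' + 1) - (if k then int m' + 1 else int m + 1) * (int (smoothness rh rv \<tau>) + 1)"
    using assms(2) unfolding sm
    by (cases k) (simp_all only: if_True if_False of_nat_mult of_nat_diff of_nat_Suc, simp_all add: algebra_simps)
qed

text \<open>The smoothness bounds exclude a failure of the formula: for two cells sharing one
  vertical edge of smoothness \<open>r > m\<close>, the splines have dimension
  \<open>(m + 1) * (m' + 1)\<close>, but the right-hand side is the smaller number
  \<open>2 * (m + 1) * (m' + 1) - (m' + 1) * (r + 1)\<close>.\<close>

locale mesh_setting = mesh +
  fixes rh rv :: "real \<Rightarrow> nat" and m m' :: nat
  assumes vertex_edges: "\<forall>\<gamma>\<in>vertices T. (\<exists>\<tau>\<in>edges T. horizontal \<tau> \<and> \<gamma> \<in> \<tau>) \<and> (\<exists>\<tau>\<in>edges T. vertical \<tau> \<and> \<gamma> \<in> \<tau>)"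
    and simply_connected: "simply_connected (mesh_domain T)"
    and connected: "connected (interior (mesh_domain T))"
    and smooth_v: "\<forall>\<tau>\<in>interior_vedges T. smoothness rh rv \<tau> \<le> m"
    and smooth_h: "\<forall>\<tau>\<in>interior_hedges T. smoothness rh rv \<tau> \<le> m'"
begin

abbreviation "IE \<equiv> interior_edges T"
abbreviation "IV \<equiv> interior_vertices T"
abbreviation "R \<equiv> bideg_lt (Suc m) (Suc m')"
abbreviation "J \<equiv> J_edge rh rv m m'"
abbreviation "JV \<equiv> J_vertex T rh rv m m'"

section \<open>The ideals at edges and vertices\<close>

lemma finite_IV: "finite IV"
  using finite_vertices by (simp add: interior_vertices_def)

lemma smoothness_bound:
  assumes "\<tau> \<in> IE" "is_edge k \<tau>"
  shows "smoothness rh rv \<tau> \<le> (if k then m else m')"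
  using assms smooth_v smooth_h by (cases k) (auto simp: interior_vedges_def interior_hedges_def is_edge_def)

lemma fin_lin_J:
  assumes "\<tau> \<in> IE"
  shows "fin_lin pscale (J \<tau>)"
proof -
  obtain k where k: "is_edge k \<tau>" using assms by (rule interior_edge_cases)
  show ?thesis by (rule ldim_J_edge(1)[OF k smoothness_bound[OF assms k]])
qed

lemma J_subset_R: "J \<tau> \<subseteq> R"
  by (auto simp: J_edge_def R_space_eq)

text \<open>An edge through an interior vertex is itself interior, so the smoothness bounds reach
  both lines through the vertex.\<close>

lemma vertex_lines:
  assumes "x \<in> IV"
  obtains \<tau>v \<tau>h where "\<tau>v \<in> IE" "is_edge True \<tau>v" "x \<in> \<tau>v" "Lo \<tau>v True = fst x"
    "\<tau>h \<in> IE" "is_edge False \<tau>h" "x \<in> \<tau>h" "Lo \<tau>h False = snd x"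
proof -
  have x: "x \<in> vertices T" "x \<in> interior Om" using assms by (auto simp: interior_vertices_def)
  obtain \<tau>v \<tau>h where t: "\<tau>v \<in> edges T" "is_edge True \<tau>v" "x \<in> \<tau>v" "\<tau>h \<in> edges T" "is_edge False \<tau>h" "x \<in> \<tau>h"
    using vertex_edges x(1) by (auto simp: is_edge_def)
  have "Lo \<tau>v True = fst x" "Lo \<tau>h False = snd x"
    using edge_bounds(3)[OF t(2), of x] edge_bounds(3)[OF t(5), of x] t by (auto simp: coord_def)
  then show ?thesis using that t x(2) by (auto simp: interior_edges_def)
qed

lemma JV_eq:
  assumes x: "x \<in> IV"
  shows "JV x = {p + q | p q. p \<in> {p. [:[:- fst x, 1:] ^ Suc (rh (fst x)):] dvd p} \<inter> R \<and>
      q \<in> {p. [:[:- snd x:], 1:] ^ Suc (rv (snd x)) dvd p} \<inter> R}"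
proof -
  have Jv: "J \<tau> = {p. [:[:- fst x, 1:] ^ Suc (rh (fst x)):] dvd p} \<inter> R" if "vertical \<tau>" "x \<in> \<tau>" for \<tau>
  proof -
    have k: "is_edge True \<tau>" using that by (simp add: is_edge_def)
    have "Lo \<tau> True = fst x" using edge_bounds(3)[OF k, of x] that by (simp add: coord_def)
    then show ?thesis using J_edge_eq[OF k, of rh rv m m'] by (simp only: line_form_power line_smoothness_def if_True)
  qed
  have Jh: "J \<tau> = {p. [:[:- snd x:], 1:] ^ Suc (rv (snd x)) dvd p} \<inter> R" if "horizontal \<tau>" "x \<in> \<tau>" for \<tau>
  proof -
    have k: "is_edge False \<tau>" using that by (simp add: is_edge_def)
    have "Lo \<tau> False = snd x" using edge_bounds(3)[OF k, of x] that by (simp add: coord_def)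
    then show ?thesis using J_edge_eq[OF k, of rh rv m m'] by (simp only: line_form_power line_smoothness_def if_False)
  qed
  have "x \<in> vertices T" using x by (simp add: interior_vertices_def)
  then obtain \<tau>v \<tau>h where "\<tau>v \<in> edges T" "vertical \<tau>v" "x \<in> \<tau>v" "\<tau>h \<in> edges T" "horizontal \<tau>h" "x \<in> \<tau>h"
    using vertex_edges by blast
  then show ?thesis unfolding J_vertex_def using Jv Jh by blast
qed

lemma ldim_JV:
  assumes x: "x \<in> IV"
  shows "fin_lin pscale (JV x)"
    "int (ldim pscale (JV x)) = (int m + 1) * (int m' + 1) - (int (rh (fst x)) + 1) * (int (rv (snd x)) + 1)"
proof -
  obtain \<tau>v \<tau>h where t: "\<tau>v \<in> IE" "is_edge True \<tau>v" "Lo \<tau>v True = fst x"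
    "\<tau>h \<in> IE" "is_edge False \<tau>h" "Lo \<tau>h False = snd x"
    using x by (rule vertex_lines)
  have "rh (fst x) \<le> m" "rv (snd x) \<le> m'"
    using smoothness_bound[OF t(1,2)] smoothness_bound[OF t(4,5)]
      edge_coord(1)[OF t(2), of rh rv] edge_coord(1)[OF t(5), of rh rv] t(3,6) by (simp_all add: line_smoothness_def)
  then have d: "degree ([:- fst x, 1:] ^ Suc (rh (fst x)) :: real poly) \<le> Suc m" "Suc (rv (snd x)) \<le> Suc m'"
    by (simp_all only: degree_linear_pow Suc_le_mono)
  note s = ldim_sum_multiples[OF degree_linear_pow(2) d, of "snd x"]
  show "fin_lin pscale (JV x)" unfolding JV_eq[OF x] by (rule s(2))
  show "int (ldim pscale (JV x)) = (int m + 1) * (int m' + 1) - (int (rh (fst x)) + 1) * (int (rv (snd x)) + 1)"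
    unfolding JV_eq[OF x] s(1) degree_linear_pow by (simp add: add.commute)
qed

lemma JV_subset_R:
  assumes "x \<in> IV"
  shows "JV x \<subseteq> R"
  using is_lin_bideg_lt[of "Suc m" "Suc m'"] unfolding JV_eq[OF assms] is_lin_def by blast

lemma J_subset_JV:
  assumes x: "x \<in> IV" and t: "\<tau> \<in> IE" "x \<in> \<tau>"
  shows "J \<tau> \<subseteq> JV x"
proof
  fix p assume p: "p \<in> J \<tau>"
  obtain k where k: "is_edge k \<tau>" "\<tau> \<in> edges T" using t(1) by (rule interior_edge_cases)
  obtain \<tau>v \<tau>h where o: "\<tau>v \<in> IE" "is_edge True \<tau>v" "x \<in> \<tau>v" "\<tau>h \<in> IE" "is_edge False \<tau>h" "x \<in> \<tau>h"
    using x by (rule vertex_lines)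
  have 0: "0 \<in> J \<tau>v" "0 \<in> J \<tau>h" using fin_lin_J o by (auto simp: fin_lin_def is_lin_def)
  have e: "\<tau>v \<in> edges T" "\<tau>h \<in> edges T" using o by (auto simp: interior_edges_def)
  show "p \<in> JV x"
  proof (cases k)
    case True
    show ?thesis unfolding J_vertex_def
      by (rule CollectI, rule exI[of _ p], rule exI[of _ 0], rule exI[of _ \<tau>], rule exI[of _ \<tau>h])
        (use p 0 o e k t True in \<open>auto simp: is_edge_def\<close>)
  next
    case False
    show ?thesis unfolding J_vertex_def
      by (rule CollectI, rule exI[of _ 0], rule exI[of _ p], rule exI[of _ \<tau>v], rule exI[of _ \<tau>])
        (use p 0 o e k t False in \<open>auto simp: is_edge_def\<close>)
  qed
qed

section \<open>The complex with coefficients in \<open>R\<close> and its ideals\<close>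

definition interior_bdry :: "(point set \<Rightarrow> 'g::ab_group_add) \<Rightarrow> point \<Rightarrow> 'g" where
  "interior_bdry c = (\<lambda>x. if x \<in> IV then bdry c x else 0)"

lemma lin_on_jump: "lin_on A (fscale pscale) (fscale pscale) jump"
  by (auto simp: lin_on_def fun_eq_iff jump_def fscale_def pscale_simps)

lemma lin_on_interior_bdry: "lin_on A (fscale pscale) (fscale pscale) interior_bdry"
proof -
  have "bdry (c + d) x = bdry c x + bdry d x" for c d :: "point set \<Rightarrow> real poly poly" and x
    unfolding bdry_def sum.distrib[symmetric] by (intro sum.cong) auto
  moreover have "bdry (fscale pscale a c) x = pscale a (bdry c x)" for a and c :: "point set \<Rightarrow> real poly poly" and x
    unfolding bdry_def pscale_sum by (intro sum.cong) (auto simp: fscale_def pscale_simps)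
  ultimately show ?thesis by (auto simp: lin_on_def fun_eq_iff interior_bdry_def fscale_def pscale_simps)
qed

lemma coeff_bdry: "coeff (coeff (bdry c x) j) i = bdry (\<lambda>\<tau>. coeff (coeff (c \<tau>) j) i) x"
  by (auto simp: bdry_def coeff_sum intro!: sum.cong)

lemma coeff_jump: "coeff (coeff (jump c \<tau>) j) i = jump (\<lambda>\<tau>. coeff (coeff (c \<tau>) j) i) \<tau>"
  by (auto simp: jump_def)

lemma edge_chains_eq: "edge_chains T rh rv m m' = chains IE J"
  by (simp add: edge_chains_def chains_def)

lemma vertex_chains_eq: "vertex_chains T rh rv m m' = chains IV JV"
  by (simp add: vertex_chains_def chains_def)

text \<open>Reversing an edge changes the sign of its coefficient. The sign change \<open>F\<close>
  is an involution of the chains, so the image, and with it \<open>H0\<close>, does not depend on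
  the orientation.\<close>

lemma boundary1_image:
  assumes ori: "orientation T ori"
  shows "boundary1 T ori ` edge_chains T rh rv m m' = interior_bdry ` chains IE J"
proof -
  define F where "F c = (\<lambda>\<tau>. if fst (ori \<tau>) = lo \<tau> then c \<tau> else - c \<tau>)" for c :: "point set \<Rightarrow> real poly poly"
  have b: "boundary1 T ori c = interior_bdry (F c)" for c
  proof
    fix x
    have "vertex_gen T (snd (ori \<tau>)) (c \<tau>) x - vertex_gen T (fst (ori \<tau>)) (c \<tau>) x =
      (if x \<in> IV then (if hi \<tau> = x then F c \<tau> else 0) - (if lo \<tau> = x then F c \<tau> else 0) else 0)"
      if t: "\<tau> \<in> IE" for \<tau>
    proof -
      obtain k where k: "is_edge k \<tau>" "\<tau> \<in> edges T" using t by (rule interior_edge_cases)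
      have "{lo \<tau>, hi \<tau>} = {fst (ori \<tau>), snd (ori \<tau>)}"
        using ori k edge_bounds(4)[OF k(1)] by (simp add: orientation_def)
      then have "fst (ori \<tau>) = lo \<tau> \<and> snd (ori \<tau>) = hi \<tau> \<or> fst (ori \<tau>) = hi \<tau> \<and> snd (ori \<tau>) = lo \<tau>"
        by (auto simp: doubleton_eq_iff)
      then show ?thesis
      proof (elim disjE conjE)
        assume "fst (ori \<tau>) = lo \<tau>" "snd (ori \<tau>) = hi \<tau>"
        then show ?thesis by (simp add: vertex_gen_def F_def)
      next
        assume "fst (ori \<tau>) = hi \<tau>" "snd (ori \<tau>) = lo \<tau>"
        moreover have "hi \<tau> \<noteq> lo \<tau>" using edge_bounds(5)[OF k(1)] by simp
        ultimately show ?thesis by (simp add: vertex_gen_def F_def)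
      qed
    qed
    then show "boundary1 T ori c x = interior_bdry (F c) x"
      by (simp add: boundary1_def interior_bdry_def bdry_def)
  qed
  have F: "F ` chains IE J = chains IE J"
  proof -
    have FI: "F c \<in> chains IE J" if "c \<in> chains IE J" for c
      using that is_lin_neg[OF fin_lin_is_lin[OF fin_lin_J]] by (auto simp: chains_def F_def)
    have "F (F c) = c" for c by (auto simp: F_def)
    then have "c \<in> F ` chains IE J" if "c \<in> chains IE J" for c
      using FI[OF that] by (intro image_eqI[of _ _ "F c"]) auto
    then show ?thesis using FI by blast
  qed
  have "boundary1 T ori = (\<lambda>c. interior_bdry (F c))" by (rule ext) (rule b)
  then have "boundary1 T ori ` chains IE J = interior_bdry ` (F ` chains IE J)" by (simp only: image_image)
  then show ?thesis by (simp only: F edge_chains_eq)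
qed

lemma interior_bdry_J_chains: "interior_bdry ` chains IE J \<subseteq> chains IV JV"
proof
  fix d assume "d \<in> interior_bdry ` chains IE J"
  then obtain c where c: "c \<in> chains IE J" "d = interior_bdry c" by blast
  have "bdry c x \<in> JV x" if x: "x \<in> IV" for x
    unfolding bdry_def
  proof (rule is_lin_sum[OF fin_lin_is_lin[OF ldim_JV(1)[OF x]]])
    fix \<tau> assume t: "\<tau> \<in> IE"
    have l: "is_lin pscale (JV x)" by (rule fin_lin_is_lin[OF ldim_JV(1)[OF x]])
    have "c \<tau> \<in> J \<tau>" using c(1) t by (simp add: chains_def)
    moreover have "lo \<tau> \<in> \<tau>" "hi \<tau> \<in> \<tau>" using t by (auto elim: interior_edge_cases)
    ultimately have "hi \<tau> = x \<or> lo \<tau> = x \<Longrightarrow> c \<tau> \<in> JV x" using J_subset_JV[OF x t] by auto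
    moreover have "0 \<in> JV x" using l by (simp add: is_lin_def)
    ultimately show "(if hi \<tau> = x then c \<tau> else 0) - (if lo \<tau> = x then c \<tau> else 0) \<in> JV x"
      using is_lin_diff[OF l] by auto
  qed
  then show "d \<in> chains IV JV" by (auto simp: c(2) interior_bdry_def chains_def)
qed

lemma fin_lin_chains_R: "finite I \<Longrightarrow> fin_lin (fscale pscale) (chains I (\<lambda>_. R))"
  and ldim_chains_R: "finite I \<Longrightarrow> ldim (fscale pscale) (chains I (\<lambda>_. R)) = card I * (Suc m * Suc m')"
  using ldim_chains[OF vector_space_pscale, of I "\<lambda>_. R"] by (simp_all add: ldim_bideg_lt)

lemma ldim_chains_R_int:
  assumes "finite I"
  shows "int (ldim (fscale pscale) (chains I (\<lambda>_. R))) = int (card I) * ((int m + 1) * (int m' + 1))"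
  unfolding ldim_chains_R[OF assms] by (simp add: algebra_simps)

lemma interior_bdry_surj: "interior_bdry ` chains IE (\<lambda>_. R) = chains IV (\<lambda>_. R)"
proof (intro subset_antisym subsetI)
  fix d assume "d \<in> interior_bdry ` chains IE (\<lambda>_. R)"
  then obtain c where c: "c \<in> chains IE (\<lambda>_. R)" "d = interior_bdry c" by blast
  have "0 \<in> R" using is_lin_bideg_lt by (simp add: is_lin_def)
  then have "bdry c x \<in> R" for x
    unfolding bdry_def using c(1) is_lin_diff[OF is_lin_bideg_lt]
    by (intro is_lin_sum[OF is_lin_bideg_lt]) (auto simp: chains_def)
  then show "d \<in> chains IV (\<lambda>_. R)" by (auto simp: c(2) interior_bdry_def chains_def)
next
  let ?Im = "interior_bdry ` chains IE (\<lambda>_. R)"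
  have 0: "0 \<in> R" using is_lin_bideg_lt by (simp add: is_lin_def)
  have Im: "is_lin (fscale pscale) ?Im"
    by (rule is_lin_image[OF lin_on_interior_bdry fin_lin_is_lin[OF fin_lin_chains_R[OF finite_interior_edges]]
          vector_space_fscale[OF vector_space_pscale]])
  define \<delta> where "\<delta> x p = (\<lambda>y. if y = x then p else 0)" for x :: point and p :: "real poly poly"
  \<comment> \<open>The boundary of \<open>p\<close> on a forward edge is \<open>p\<close> at its
    end minus \<open>p\<close> at \<open>x\<close>. Passing to the end raises the sum of the
    coordinates, so the induction runs on the number of interior vertices with larger sum; it stops
    where the end is not interior.\<close>
  have single: "\<delta> x p \<in> ?Im" if "x \<in> IV" "p \<in> R" for x p
    using that(1)
  proof (induction "card {y \<in> IV. fst x + snd x < fst y + snd y}" arbitrary: x rule: less_induct)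
    case less
    obtain \<tau> where t: "\<tau> \<in> IE" "lo \<tau> = x" using less.prems by (rule interior_vertex_forward_edge)
    obtain k where k: "is_edge k \<tau>" using t(1) by (rule interior_edge_cases)
    have "coord k (lo \<tau>) + coord (\<not> k) (lo \<tau>) < coord k (hi \<tau>) + coord (\<not> k) (hi \<tau>)"
      using edge_bounds(1,2)[OF k] by simp
    then have gt: "fst x + snd x < fst (hi \<tau>) + snd (hi \<tau>)"
      unfolding t(2) by (cases k) (auto simp: coord_def)
    define e where "e = (\<lambda>\<tau>'. if \<tau>' = \<tau> then p else 0)"
    have e: "e \<in> chains IE (\<lambda>_. R)"
      unfolding e_def by (rule single_in_chains) (use t(1) \<open>p \<in> R\<close> 0 in auto)
    have "bdry e y = (if hi \<tau> = y then p else 0) - (if x = y then p else 0)" for y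
    proof -
      have "bdry e y = (\<Sum>\<tau>'\<in>IE. if \<tau>' = \<tau> then (if hi \<tau> = y then p else 0) - (if x = y then p else 0) else 0)"
        unfolding bdry_def e_def t(2)[symmetric] by (intro sum.cong) auto
      then show ?thesis using t(1) finite_interior_edges by simp
    qed
    then have eq: "\<delta> x p = (if hi \<tau> \<in> IV then \<delta> (hi \<tau>) p else 0) - interior_bdry e"
      using less.prems gt by (auto simp: fun_eq_iff interior_bdry_def \<delta>_def)
    have "(if hi \<tau> \<in> IV then \<delta> (hi \<tau>) p else 0) \<in> ?Im"
    proof (cases "hi \<tau> \<in> IV")
      case True
      have "{y \<in> IV. fst (hi \<tau>) + snd (hi \<tau>) < fst y + snd y} \<subset> {y \<in> IV. fst x + snd x < fst y + snd y}"
        using gt True by auto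
      then have "card {y \<in> IV. fst (hi \<tau>) + snd (hi \<tau>) < fst y + snd y} < card {y \<in> IV. fst x + snd x < fst y + snd y}"
        using finite_IV by (intro psubset_card_mono) auto
      then show ?thesis using less.hyps True by simp
    next
      case False
      then show ?thesis using Im by (simp add: is_lin_def)
    qed
    then show ?case unfolding eq using e by (intro is_lin_diff[OF Im]) auto
  qed
  fix d assume d: "d \<in> chains IV (\<lambda>_. R)"
  have "(\<Sum>x\<in>S. \<delta> x (d x)) y = (\<Sum>x\<in>S. \<delta> x (d x) y)" for S y
    by (induction S rule: infinite_finite_induct) simp_all
  then have "d = (\<Sum>x\<in>IV. \<delta> x (d x))"
    using d finite_IV by (auto simp: fun_eq_iff \<delta>_def chains_def)
  also have "\<dots> \<in> ?Im"
    by (rule is_lin_sum[OF Im]) (use d single in \<open>auto simp: chains_def\<close>)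
  finally show "d \<in> ?Im" .
qed

lemma jump_exact: "{c \<in> chains IE (\<lambda>_. R). interior_bdry c = 0} = jump ` chains (cells T) (\<lambda>_. R)"
proof (intro subset_antisym subsetI)
  fix c assume "c \<in> jump ` chains (cells T) (\<lambda>_. R)"
  then obtain g where g: "g \<in> chains (cells T) (\<lambda>_. R)" "c = jump g" by blast
  have "jump g \<tau> \<in> R" if t: "\<tau> \<in> IE" for \<tau>
  proof -
    obtain k where k: "is_edge k \<tau>" using t by (rule interior_edge_cases)
    have "cell_of b \<tau> \<in> cells T" for b using side_cell_of[OF t k, of b] by (simp add: side_def)
    then show ?thesis using g(1) is_lin_diff[OF is_lin_bideg_lt] t by (auto simp: jump_def chains_def)
  qed
  then show "c \<in> {c \<in> chains IE (\<lambda>_. R). interior_bdry c = 0}"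
    using bdry_jump by (auto simp: g(2) chains_def interior_bdry_def fun_eq_iff) (simp add: jump_def)
next
  fix c assume "c \<in> {c \<in> chains IE (\<lambda>_. R). interior_bdry c = 0}"
  then have c: "c \<in> chains IE (\<lambda>_. R)" "interior_bdry c = 0" by auto
  have "\<exists>g. \<forall>\<tau>\<in>IE. jump g \<tau> = coeff (coeff (c \<tau>) j) i" for j i
  proof -
    have "bdry (\<lambda>\<tau>. coeff (coeff (c \<tau>) j) i) x = 0" if "x \<in> IV" for x
      using fun_cong[OF c(2), of x] that coeff_bdry[of c x j i] by (simp add: interior_bdry_def)
    then obtain g where "\<And>\<tau>. \<tau> \<in> IE \<Longrightarrow> jump g \<tau> = coeff (coeff (c \<tau>) j) i"
      using jump_surj[OF simply_connected connected] by blast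
    then show ?thesis by blast
  qed
  then obtain g where g: "\<And>j i \<tau>. \<tau> \<in> IE \<Longrightarrow> jump (g j i) \<tau> = coeff (coeff (c \<tau>) j) i" by metis
  \<comment> \<open>Cuts off the functions found for coefficients beyond the bidegree, where the
    coefficients of \<open>c\<close> vanish too.\<close>
  define G where "G \<sigma> = (if \<sigma> \<in> cells T then poly2 (Suc m) (Suc m') (\<lambda>j i. g j i \<sigma>) else 0)" for \<sigma>
  have G: "G \<in> chains (cells T) (\<lambda>_. R)" by (simp add: chains_def G_def poly2_in_bideg_lt)
  have "jump G \<tau> = c \<tau>" for \<tau>
  proof (cases "\<tau> \<in> IE")
    case True
    obtain k where k: "is_edge k \<tau>" using True by (rule interior_edge_cases)
    have cc: "cell_of b \<tau> \<in> cells T" for b using side_cell_of[OF True k, of b] by (simp add: side_def)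
    have cR: "c \<tau> \<in> R" using c(1) True by (simp add: chains_def)
    show ?thesis
    proof (rule poly2_eqI)
      fix j i
      have "coeff (coeff (jump G \<tau>) j) i = (if i < Suc m \<and> j < Suc m' then jump (g j i) \<tau> else 0)"
        unfolding coeff_jump using cc by (auto simp: jump_def G_def simp del: less_Suc_eq)
      also have "\<dots> = coeff (coeff (c \<tau>) j) i"
        using cR g[OF True] by (auto simp: bideg_lt_def not_less simp del: less_Suc_eq)
      finally show "coeff (coeff (jump G \<tau>) j) i = coeff (coeff (c \<tau>) j) i" .
    qed
  next
    case False
    then show ?thesis using c(1) by (simp add: jump_def chains_def)
  qed
  then have "c = jump G" by auto
  then show "c \<in> jump ` chains (cells T) (\<lambda>_. R)" using G by (rule image_eqI)
qed

section \<open>Splines as matched families of polynomials\<close>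

definition matched_chains :: "(point set \<Rightarrow> real poly poly) set" where
  "matched_chains = {c \<in> chains (cells T) (\<lambda>_. R). jump c \<in> chains IE J}"

text \<open>For matched families any cell containing \<open>x\<close> gives the same value, so the
  choice is immaterial.\<close>

definition spline_of :: "(point set \<Rightarrow> real poly poly) \<Rightarrow> point \<Rightarrow> real" where
  "spline_of c x = (if x \<in> Om then eval2 (c (SOME \<sigma>. \<sigma> \<in> cells T \<and> x \<in> \<sigma>)) x else 0)"

lemma matched_chain: "c \<in> matched_chains \<Longrightarrow> matched rh rv c"
  by (intro matchedI) (auto simp: matched_chains_def chains_def J_edge_def)

lemma spline_of_eval:
  assumes "c \<in> matched_chains" "\<sigma> \<in> cells T" "x \<in> \<sigma>"
  shows "spline_of c x = eval2 (c \<sigma>) x"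
proof -
  have x: "x \<in> Om" using assms(2,3) by (auto simp: mesh_domain_def)
  have "(SOME \<sigma>. \<sigma> \<in> cells T \<and> x \<in> \<sigma>) \<in> cells T \<and> x \<in> (SOME \<sigma>. \<sigma> \<in> cells T \<and> x \<in> \<sigma>)"
    by (rule someI[of _ \<sigma>]) (use assms in blast)
  then show ?thesis
    using matched_eval[OF simply_connected connected matched_chain[OF assms(1)] _ assms(2) _ assms(3)] x
    by (simp add: spline_of_def)
qed

lemma spline_smoothness:
  assumes "\<tau> \<in> IE" "is_edge k \<tau>" "x \<in> \<tau>"
  shows "C_along k (line_smoothness rh rv k (coord k x)) f x \<longleftrightarrow>
    (if k then C_in_s (smoothness rh rv \<tau>) f x else C_in_t (smoothness rh rv \<tau>) f x)"
proof -
  have "Lo \<tau> k = coord k x" using edge_bounds(3)[OF assms(2)] assms(3) by simp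
  then show ?thesis by (simp only: C_along_iff edge_coord(1)[OF assms(2)])
qed

lemma splines_iff:
  "f \<in> splines T rh rv m m' \<longleftrightarrow> (\<forall>x. x \<notin> Om \<longrightarrow> f x = 0) \<and> (\<forall>\<sigma>\<in>cells T. \<exists>p\<in>R. \<forall>x\<in>\<sigma>. f x = eval2 p x) \<and>
     (\<forall>\<tau>\<in>IE. \<forall>k. is_edge k \<tau> \<longrightarrow> (\<forall>x\<in>\<tau> \<inter> interior Om. C_along k (line_smoothness rh rv k (coord k x)) f x))"
  using spline_smoothness
  by (auto simp: splines_def R_space_eq interior_vedges_def interior_hedges_def all_bool_eq is_edge_def)

lemma spline_of_image: "spline_of ` matched_chains = splines T rh rv m m'"
proof (intro subset_antisym subsetI)
  fix f assume "f \<in> spline_of ` matched_chains"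
  then obtain c where c: "c \<in> matched_chains" "f = spline_of c" by blast
  show "f \<in> splines T rh rv m m'"
    unfolding splines_iff
  proof (intro conjI ballI allI impI)
    show "f x = 0" if "x \<notin> Om" for x using that by (simp add: c(2) spline_of_def)
    show "\<exists>p\<in>R. \<forall>x\<in>\<sigma>. f x = eval2 p x" if "\<sigma> \<in> cells T" for \<sigma>
      using that c spline_of_eval by (intro bexI[of _ "c \<sigma>"]) (auto simp: matched_chains_def chains_def)
    show "C_along k (line_smoothness rh rv k (coord k x)) f x" if "x \<in> \<tau> \<inter> interior Om" for \<tau> k x
      using that spline_of_eval[OF c(1)] by (intro matched_C_along[OF matched_chain[OF c(1)]]) (auto simp: c(2))
  qed
next
  fix f assume "f \<in> splines T rh rv m m'"
  then have f: "\<And>x. x \<notin> Om \<Longrightarrow> f x = 0" "\<forall>\<sigma>\<in>cells T. \<exists>p\<in>R. \<forall>x\<in>\<sigma>. f x = eval2 p x"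
    "\<And>\<tau> k x. \<tau> \<in> IE \<Longrightarrow> is_edge k \<tau> \<Longrightarrow> x \<in> \<tau> \<Longrightarrow> x \<in> interior Om \<Longrightarrow> C_along k (line_smoothness rh rv k (coord k x)) f x"
    unfolding splines_iff by auto
  obtain p where p: "\<And>\<sigma>. \<sigma> \<in> cells T \<Longrightarrow> p \<sigma> \<in> R" "\<And>\<sigma> x. \<sigma> \<in> cells T \<Longrightarrow> x \<in> \<sigma> \<Longrightarrow> f x = eval2 (p \<sigma>) x"
    using bchoice[OF f(2)[unfolded Bex_def]] by blast
  define c where "c \<sigma> = (if \<sigma> \<in> cells T then p \<sigma> else 0)" for \<sigma>
  have cR: "c \<in> chains (cells T) (\<lambda>_. R)" using p by (simp add: c_def chains_def)
  \<comment> \<open>\<open>jump_exact\<close> includes that jumps of families in \<open>R\<close>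
    lie in \<open>R\<close>; what remains is divisibility.\<close>
  have "jump c \<in> chains IE (\<lambda>_. R)" using cR jump_exact by blast
  moreover have "Delta rh rv \<tau> dvd jump c \<tau>" if t: "\<tau> \<in> IE" for \<tau>
  proof -
    obtain k where k: "is_edge k \<tau>" using t by (rule interior_edge_cases)
    let ?s = "cell_of True \<tau>" and ?s' = "cell_of False \<tau>"
    note sd = side_cell_of[OF t k]
    have ct: "?s \<in> cells T" "?s' \<in> cells T" using sd by (auto simp: side_def)
    have com: "coord k (mid k \<tau>) = Lo \<tau> k" by (simp add: mid_def)
    \<comment> \<open>Smoothness at this single point already forces divisibility, since it controls
      derivatives on a neighbourhood.\<close>
    have "mid k \<tau> \<in> interior Om" by (rule interior_edge_relint[OF t k ext_mid[OF k]])
    then have "C_along k (line_smoothness rh rv k (Lo \<tau> k)) f (mid k \<tau>)"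
      using f(3)[OF t k mid_mem[OF k]] com by simp
    moreover have "f x = eval2 (c ?s) x" if "x \<in> ?s" for x using p ct that by (simp add: c_def)
    moreover have "f x = eval2 (c ?s') x" if "x \<in> ?s'" for x using p ct that by (simp add: c_def)
    ultimately have "Delta rh rv \<tau> dvd c ?s - c ?s'"
      unfolding edge_coord(2)[OF k] by (rule C_along_Delta_dvd[OF t k sd sd])
    then show ?thesis
      unfolding jump_sides[OF t k sd sd] using dvd_diff_swap[of _ "c ?s" "c ?s'"] by (cases k) simp_all
  qed
  ultimately have c: "c \<in> matched_chains"
    using cR by (auto simp: matched_chains_def chains_def J_edge_def R_space_eq)
  have "f x = spline_of c x" for x
  proof (cases "x \<in> Om")
    case True
    then obtain \<sigma> where s: "\<sigma> \<in> cells T" "x \<in> \<sigma>" by (auto simp: mesh_domain_def)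
    then show ?thesis using spline_of_eval[OF c s] p by (simp add: c_def)
  next
    case False
    then show ?thesis using f(1) by (simp add: spline_of_def)
  qed
  then show "f \<in> spline_of ` matched_chains" using c by (intro image_eqI[of _ _ c]) auto
qed

lemma fin_lin_matched_chains: "fin_lin (fscale pscale) matched_chains"
proof -
  have C: "fin_lin (fscale pscale) (chains (cells T) (\<lambda>_. R))" by (rule fin_lin_chains_R[OF finite_cells])
  have J: "is_lin (fscale pscale) (chains IE J)"
    by (rule is_lin_chains[OF vector_space_pscale fin_lin_is_lin[OF fin_lin_J]])
  show ?thesis
    unfolding matched_chains_def
    by (rule fin_lin_subset[OF C is_lin_vimage[OF lin_on_jump fin_lin_is_lin[OF C] J]]) auto
qed

text \<open>\<open>spline_of\<close> is injective because a cell contains an open box, on which only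
  the zero polynomial vanishes.\<close>

lemma dim_spline_space: "real_dim (spline_space T rh rv m m') = ldim (fscale pscale) matched_chains"
proof -
  have "spline_space T rh rv m m' = lin_space (fscale (*)) (splines T rh rv m m')"
    by (simp add: spline_space_def lin_space_def fscale_def[abs_def] fun_ops)
  then have "real_dim (spline_space T rh rv m m') = ldim (fscale (*)) (spline_of ` matched_chains)"
    by (simp add: ldim_def spline_of_image)
  also have "\<dots> = ldim (fscale pscale) matched_chains"
  proof (rule ldim_inj_on[OF fin_lin_matched_chains])
    show "lin_on matched_chains (fscale pscale) (fscale (*)) spline_of"
      by (auto simp: lin_on_def fun_eq_iff spline_of_def fscale_def pscale_def eval2_smult)
    show "vector_space (fscale (*) :: real \<Rightarrow> (point \<Rightarrow> real) \<Rightarrow> point \<Rightarrow> real)"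
      by (rule vector_space_fscale[OF vector_space_real])
    fix c assume c: "c \<in> matched_chains" "spline_of c = 0"
    have "c \<sigma> = 0" for \<sigma>
    proof (cases "\<sigma> \<in> cells T")
      case True
      have "eval2 (c \<sigma>) x = 0"
        if "Lo \<sigma> True < fst x" "fst x < Hi \<sigma> True" "Lo \<sigma> False < snd x" "snd x < Hi \<sigma> False" for x
      proof -
        have "x \<in> \<sigma>" using that cellD(2)[OF True, of x] by (auto simp: all_bool_eq coord_def)
        then show ?thesis using spline_of_eval[OF c(1) True] fun_cong[OF c(2), of x] by simp
      qed
      then show ?thesis by (rule eval2_zero_on_box[OF cellD(1)[OF True] cellD(1)[OF True]])
    qed (use c(1) in \<open>simp add: matched_chains_def chains_def\<close>)
    then show "c = 0" by auto
  qed
  finally show ?thesis .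
qed

text \<open>The dimensions of the ideals contain \<open>?N\<close> once per interior edge and
  vertex; these terms cancel against the full complex and leave the codimensions, with
  \<open>?N\<close> once per cell.\<close>

lemma dimension_formula:
  assumes ori: "orientation T ori"
  shows "int (real_dim (spline_space T rh rv m m')) =
      (\<Sum>\<sigma>\<in>cells T. (int m + 1) * (int m' + 1))
    - (\<Sum>\<tau>\<in>interior_hedges T. (int m + 1) * (int (smoothness rh rv \<tau>) + 1))
    - (\<Sum>\<tau>\<in>interior_vedges T. (int m' + 1) * (int (smoothness rh rv \<tau>) + 1))
    + (\<Sum>\<gamma>\<in>interior_vertices T. (int (rh (fst \<gamma>)) + 1) * (int (rv (snd \<gamma>)) + 1))
    + int (h_number T ori rh rv m m')"
proof -
  let ?N = "(int m + 1) * (int m' + 1)"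
  let ?e = "\<lambda>\<tau>. int (smoothness rh rv \<tau>) + 1"
  have I1: "is_lin (fscale pscale) (chains IE J)" "chains IE J \<subseteq> chains IE (\<lambda>_. R)"
    by (rule is_lin_chains[OF vector_space_pscale fin_lin_is_lin[OF fin_lin_J]], assumption)
      (rule chains_mono[OF J_subset_R])
  have I0: "is_lin (fscale pscale) (chains IV JV)" "chains IV JV \<subseteq> chains IV (\<lambda>_. R)"
    by (rule is_lin_chains[OF vector_space_pscale fin_lin_is_lin[OF ldim_JV(1)]], assumption)
      (rule chains_mono[OF JV_subset_R])
  have "vertex_chain_space T rh rv m m' = lin_space (fscale pscale) (chains IV JV)"
    by (simp add: vertex_chain_space_def lin_space_def vertex_chains_eq fscale_def[abs_def] pscale_def[abs_def] fun_ops)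
  then have h: "h_number T ori rh rv m m' = real_dim (quotient_space (lin_space (fscale pscale) (chains IV JV)) (interior_bdry ` chains IE J))"
    by (simp add: h_number_def H0_def boundary1_image[OF ori])
  have "int (ldim (fscale pscale) matched_chains) =
     int (ldim (fscale pscale) (chains (cells T) (\<lambda>_. R))) - int (ldim (fscale pscale) (chains IE (\<lambda>_. R)))
     + int (ldim (fscale pscale) (chains IV (\<lambda>_. R))) + int (ldim (fscale pscale) (chains IE J))
     - int (ldim (fscale pscale) (chains IV JV)) + int (h_number T ori rh rv m m')"
    unfolding h matched_chains_def
    by (rule exact_complex_dim[OF fin_lin_chains_R[OF finite_cells] fin_lin_chains_R[OF finite_interior_edges]
          fin_lin_chains_R[OF finite_IV] lin_on_jump lin_on_interior_bdry interior_bdry_surj jump_exact I1 I0 interior_bdry_J_chains])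
  also have "ldim (fscale pscale) (chains IE J) = (\<Sum>\<tau>\<in>IE. ldim pscale (J \<tau>))"
    by (rule ldim_chains(2)[OF vector_space_pscale finite_interior_edges fin_lin_J])
  also have "ldim (fscale pscale) (chains IV JV) = (\<Sum>x\<in>IV. ldim pscale (JV x))"
    by (rule ldim_chains(2)[OF vector_space_pscale finite_IV ldim_JV(1)])
  finally have main: "int (ldim (fscale pscale) matched_chains) =
      int (card (cells T)) * ?N - int (card IE) * ?N + int (card IV) * ?N
      + (\<Sum>\<tau>\<in>IE. int (ldim pscale (J \<tau>))) - (\<Sum>x\<in>IV. int (ldim pscale (JV x))) + int (h_number T ori rh rv m m')"
    by (simp only: ldim_chains_R_int[OF finite_cells] ldim_chains_R_int[OF finite_interior_edges]
        ldim_chains_R_int[OF finite_IV] of_nat_sum)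
  have vert: "(\<Sum>x\<in>IV. int (ldim pscale (JV x))) =
      int (card IV) * ?N - (\<Sum>x\<in>IV. (int (rh (fst x)) + 1) * (int (rv (snd x)) + 1))"
    by (simp add: ldim_JV(2) sum_subtractf)
  have "horizontal \<tau> \<or> vertical \<tau>" if t: "\<tau> \<in> IE" for \<tau>
  proof -
    obtain k where "is_edge k \<tau>" using t by (rule interior_edge_cases)
    then show ?thesis by (cases k) (auto simp: is_edge_def)
  qed
  then have un: "IE = interior_hedges T \<union> interior_vedges T"
    unfolding interior_hedges_def interior_vedges_def by blast
  have dj: "interior_hedges T \<inter> interior_vedges T = {}"
    using is_edge_unique[of True _ False] by (auto simp: interior_hedges_def interior_vedges_def is_edge_def)
  have fin: "finite (interior_hedges T)" "finite (interior_vedges T)"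
    using finite_interior_edges un by auto
  have h': "int (ldim pscale (J \<tau>)) = ?N - (int m + 1) * ?e \<tau>" if "\<tau> \<in> interior_hedges T" for \<tau>
    using that ldim_J_edge(2)[of False \<tau> rh rv m m'] smooth_h by (auto simp: interior_hedges_def is_edge_def)
  have v': "int (ldim pscale (J \<tau>)) = ?N - (int m' + 1) * ?e \<tau>" if "\<tau> \<in> interior_vedges T" for \<tau>
    using that ldim_J_edge(2)[of True \<tau> rh rv m m'] smooth_v by (auto simp: interior_vedges_def is_edge_def)
  have "(\<Sum>\<tau>\<in>IE. int (ldim pscale (J \<tau>))) = (\<Sum>\<tau>\<in>interior_hedges T. ?N - (int m + 1) * ?e \<tau>)
      + (\<Sum>\<tau>\<in>interior_vedges T. ?N - (int m' + 1) * ?e \<tau>)"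
    unfolding un sum.union_disjoint[OF fin dj] using h' v' by simp
  also have "\<dots> = int (card IE) * ?N - (\<Sum>\<tau>\<in>interior_hedges T. (int m + 1) * ?e \<tau>)
      - (\<Sum>\<tau>\<in>interior_vedges T. (int m' + 1) * ?e \<tau>)"
    unfolding un card_Un_disjoint[OF fin dj] sum_subtractf by (simp add: algebra_simps)
  finally show ?thesis unfolding dim_spline_space main vert by simp
qed

end

theorem theorem3p1:
  fixes T :: tmesh and rh rv :: "real \<Rightarrow> nat" and m m' :: nat
    and ori :: "point set \<Rightarrow> point \<times> point"
  assumes "T_mesh T"
    and "\<forall>\<gamma>\<in>vertices T. (\<exists>\<tau>\<in>edges T. horizontal \<tau> \<and> \<gamma> \<in> \<tau>) \<and> (\<exists>\<tau>\<in>edges T. vertical \<tau> \<and> \<gamma> \<in> \<tau>)"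
    and "simply_connected (mesh_domain T)"
    and "connected (interior (mesh_domain T))"
    and "orientation T ori"
    and "\<forall>\<tau>\<in>interior_vedges T. smoothness rh rv \<tau> \<le> m"
    and "\<forall>\<tau>\<in>interior_hedges T. smoothness rh rv \<tau> \<le> m'"
  shows "int (real_dim (spline_space T rh rv m m')) =
      (\<Sum>\<sigma>\<in>cells T. (int m + 1) * (int m' + 1))
    - (\<Sum>\<tau>\<in>interior_hedges T. (int m + 1) * (int (smoothness rh rv \<tau>) + 1))
    - (\<Sum>\<tau>\<in>interior_vedges T. (int m' + 1) * (int (smoothness rh rv \<tau>) + 1))
    + (\<Sum>\<gamma>\<in>interior_vertices T. (int (rh (fst \<gamma>)) + 1) * (int (rv (snd \<gamma>)) + 1))
    + int (h_number T ori rh rv m m')"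
proof -
  interpret mesh_setting T rh rv m m' by unfold_locales fact+
  show ?thesis by (rule dimension_formula) fact
qed

end
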